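(* (1) Let $1<p\le\infty$. A vector field $\bm{u}:\mathbb{B}\to\mathbb{R}^3$ belongs to $\bm{h}^p_e(\mathbb{B})$ if and only if $\bm{u}=\bm{P}_e\bm{f}$ for some $\bm{f}\in\bm{L}^p(\mathbb{S})$. (2) $\bm{u}\in\bm{h}^1_e(\mathbb{B})$ if and only if $\bm{u}=\bm{P}_e\bm{\mu}$ for some $\bm{\mu}\in\bm{M}(\mathbb{S})$.
   Context: $\mathbb{B}$ is the open unit ball of $\mathbb{R}^3$, $\mathbb{S}$ the unit sphere, $\sigma$ surface measure. Lamé constants $\mu>0$, $2\mu+\lambda>0$; $\Delta^*\bm{u}=\mu\Delta\bm{u}+(\lambda+\mu)\nabla\,\mathrm{div}\,\bm{u}$. For $1\le p<\infty$, $\bm{h}^p_e(\mathbb{B})$ is the space of solutions $\bm{u}:\mathbb{B}\to\mathbb{R}^3$ of $\Delta^*\bm{u}=0$ with $\sup_{0\le r<1}(\int_{\mathbb{S}}|\bm{u}(rw)|^pd\sigma(w))^{1/p}<\infty$; $\bm{h}^\infty_e(\mathbb{B})$ is the space of bounded solutions. $\bm{M}(\mathbb{S})$ is the space of $\mathbb{R}^3$-valued Borel measures $\bm{\mu}=(\mu_1,\mu_2,\mu_3)$ on $\mathbb{S}$ (each $\mu_i$ a finite signed Borel measure). With $\beta=\frac{\lambda+\mu}{2\lambda+6\mu}$, $\alpha=\frac{\lambda+2\mu}{\lambda+3\mu}$, $P(x,\eta)=\frac{1}{4\pi}\frac{1-|x|^2}{|x-\eta|^3}$, $\Phi(x,\eta)=\frac{1}{4\pi}\int_0^1\big(\frac{1-t^2|x|^2}{(1-2tx\cdot\eta+t^2|x|^2)^{3/2}}-1-3tx\cdot\eta\big)\frac{dt}{t^{1+\alpha}}$,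 the elastic Poisson kernel is $\mathcal{P}_e(x,\eta)=P(x,\eta)\mathcal{I}+\mathcal{L}(x,\eta)$, $\mathcal{L}_{ij}=\beta(1-|x|^2)\partial_{x_i}\partial_{x_j}\Phi$. $\bm{P}_e\bm{f}(x)=\int_{\mathbb{S}}\mathcal{P}_e(x,\eta)\bm{f}(\eta)d\sigma(\eta)$ and $\bm{P}_e\bm{\mu}(x)=\int_{\mathbb{S}}\mathcal{P}_e(x,\eta)(d\mu_1,d\mu_2,d\mu_3)^t(\eta)$. *)

theory Defs
  imports "HOL-Analysis.Analysis"
begin

type_synonym R3 = "real ^ 3"

text \<open>Surface measure on the unit sphere S of R^3, defined via cones:
  sigma(A) = 3 * Lebesgue volume of {r w | 0 < r <= 1, w in A}
  (so that sigma(S) = 4 pi). Measurable sets: Borel subsets of S.\<close>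
definition sphere_measure :: "R3 measure" where
  "sphere_measure = measure_of (sphere 0 1) (sets (restrict_space borel (sphere 0 1)))
     (\<lambda>A. 3 * emeasure lborel {r *\<^sub>R w | r w. r \<in> {0<..1} \<and> w \<in> A})"

definition pd :: "3 \<Rightarrow> (R3 \<Rightarrow> 'b::real_normed_vector) \<Rightarrow> R3 \<Rightarrow> 'b" where
  "pd i f x = vector_derivative (\<lambda>t. f (x + t *\<^sub>R axis i 1)) (at 0)"

definition C2_ball :: "(R3 \<Rightarrow> R3) \<Rightarrow> bool" where
  "C2_ball u \<longleftrightarrow>
     continuous_on (ball 0 1) u \<and>
     (\<forall>i. \<forall>x\<in>ball 0 1. (\<lambda>t. u (x + t *\<^sub>R axis i 1)) differentiable (at 0)) \<and>
     (\<forall>i. continuous_on (ball 0 1) (pd i u)) \<and>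
     (\<forall>i j. \<forall>x\<in>ball 0 1. (\<lambda>t. pd i u (x + t *\<^sub>R axis j 1)) differentiable (at 0)) \<and>
     (\<forall>i j. continuous_on (ball 0 1) (pd j (pd i u)))"

definition divg :: "(R3 \<Rightarrow> R3) \<Rightarrow> R3 \<Rightarrow> real" where
  "divg u x = (\<Sum>i\<in>UNIV. pd i u x $ i)"

definition lame_op :: "real \<Rightarrow> real \<Rightarrow> (R3 \<Rightarrow> R3) \<Rightarrow> R3 \<Rightarrow> R3" where
  "lame_op lam mu u x =
     mu *\<^sub>R (\<Sum>i\<in>UNIV. pd i (pd i u) x) + (lam + mu) *\<^sub>R (\<chi> j. pd j (divg u) x)"

definition elastic_harmonic :: "real \<Rightarrow> real \<Rightarrow> (R3 \<Rightarrow> R3) \<Rightarrow> bool" where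
  "elastic_harmonic lam mu u \<longleftrightarrow> C2_ball u \<and> (\<forall>x\<in>ball 0 1. lame_op lam mu u x = 0)"

definition hpe :: "real \<Rightarrow> real \<Rightarrow> ereal \<Rightarrow> (R3 \<Rightarrow> R3) set" where
  "hpe lam mu p = {u. elastic_harmonic lam mu u \<and>
     (if p = \<infinity> then bounded (u ` ball 0 1)
      else (\<exists>C::real. \<forall>r. 0 \<le> r \<and> r < 1 \<longrightarrow>
              (\<integral>\<^sup>+ w. ennreal (norm (u (r *\<^sub>R w)) powr real_of_ereal p) \<partial>sphere_measure)
                \<le> ennreal C))}"

definition Lp_sphere :: "ereal \<Rightarrow> (R3 \<Rightarrow> R3) set" where
  "Lp_sphere p = {f. f \<in> borel_measurable sphere_measure \<and>
     (if p = \<infinity> then (\<exists>C::real. AE w in sphere_measure. norm (f w) \<le> C)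
      else (\<integral>\<^sup>+ w. ennreal (norm (f w) powr real_of_ereal p) \<partial>sphere_measure) < \<infinity>)}"

definition lame_beta :: "real \<Rightarrow> real \<Rightarrow> real" where
  "lame_beta lam mu = (lam + mu) / (2 * lam + 6 * mu)"

definition lame_alpha :: "real \<Rightarrow> real \<Rightarrow> real" where
  "lame_alpha lam mu = (lam + 2 * mu) / (lam + 3 * mu)"

definition poissonK :: "R3 \<Rightarrow> R3 \<Rightarrow> real" where
  "poissonK x \<eta> = 1 / (4 * pi) * (1 - norm x ^ 2) / norm (x - \<eta>) ^ 3"

definition PhiK :: "real \<Rightarrow> real \<Rightarrow> R3 \<Rightarrow> R3 \<Rightarrow> real" where
  "PhiK lam mu x \<eta> = 1 / (4 * pi) * integral {0..1} (\<lambda>t.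
      ((1 - t^2 * norm x ^ 2) / (1 - 2 * t * (x \<bullet> \<eta>) + t^2 * norm x ^ 2) powr (3/2)
        - 1 - 3 * t * (x \<bullet> \<eta>)) / t powr (1 + lame_alpha lam mu))"

definition LK :: "real \<Rightarrow> real \<Rightarrow> R3 \<Rightarrow> R3 \<Rightarrow> real ^ 3 ^ 3" where
  "LK lam mu x \<eta> = (\<chi> i j. lame_beta lam mu * (1 - norm x ^ 2)
        * pd i (pd j (\<lambda>y. PhiK lam mu y \<eta>)) x)"

definition elastic_poisson_kernel :: "real \<Rightarrow> real \<Rightarrow> R3 \<Rightarrow> R3 \<Rightarrow> real ^ 3 ^ 3" where
  "elastic_poisson_kernel lam mu x \<eta> = poissonK x \<eta> *\<^sub>R mat 1 + LK lam mu x \<eta>"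

definition Pe :: "real \<Rightarrow> real \<Rightarrow> (R3 \<Rightarrow> R3) \<Rightarrow> R3 \<Rightarrow> R3" where
  "Pe lam mu f x = (\<integral>\<eta>. elastic_poisson_kernel lam mu x \<eta> *v f \<eta> \<partial>sphere_measure)"

text \<open>An R^3-valued finite signed Borel measure on S is represented by the Jordan-type
  decomposition mu_i = pos i - neg i of each component into two finite Borel measures on S
  (every finite signed measure has such a decomposition).\<close>
definition vec_measure_on_sphere :: "(3 \<Rightarrow> R3 measure) \<Rightarrow> (3 \<Rightarrow> R3 measure) \<Rightarrow> bool" where
  "vec_measure_on_sphere pos neg \<longleftrightarrow>
     (\<forall>i. sets (pos i) = sets sphere_measure \<and> finite_measure (pos i)
        \<and> sets (neg i) = sets sphere_measure \<and> finite_measure (neg i))"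

definition Pe_meas :: "real \<Rightarrow> real \<Rightarrow> (3 \<Rightarrow> R3 measure) \<Rightarrow> (3 \<Rightarrow> R3 measure) \<Rightarrow> R3 \<Rightarrow> R3" where
  "Pe_meas lam mu pos neg x = (\<chi> j. \<Sum>i\<in>UNIV.
      (\<integral>\<eta>. elastic_poisson_kernel lam mu x \<eta> $ j $ i \<partial>pos i)
    - (\<integral>\<eta>. elastic_poisson_kernel lam mu x \<eta> $ j $ i \<partial>neg i))"

end

theory Submission
  imports Defs "HOL-Probability.Probability"
begin

text \<open>For \<open>p\<close> harmonic, \<open>\<beta>\<close> and \<open>\<alpha>\<close> are such that
  \<open>p e\<^sub>i + \<beta> (1 - norm x ^ 2) grad f\<close> solves the Lame system whenever
  \<open>(euler + 1 - \<alpha>) f = \<partial>\<^sub>i p\<close>; the solution \<open>f\<close> is the dilation integral of \<open>t powr - \<alpha>\<close> times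
  \<open>\<partial>\<^sub>i p (t x)\<close>, and the elastic Poisson kernel is what this construction yields for the Poisson kernel.
  Its entries are dominated by a multiple of the Poisson kernel, so the \<open>L\<^sup>p\<close> bounds follow from Jensen's
  inequality and Tonelli's theorem. Conversely, undoing the construction for a solution near the closed
  ball reduces the representation by boundary values to the scalar Poisson formula, hence to the maximum
  principle. Applied to dilations \<open>u (r x)\<close>, \<open>r \<longrightarrow> 1\<close>, this leaves a compactness argument for the
  boundary functions: midpoint combinations converging almost everywhere for \<open>p > 1\<close>, weak limits of
  measures for \<open>p = 1\<close>.\<close>

section \<open>Functions of class Ck on balls, depending on a parameter\<close>

text \<open>Three obstacles shape the proof. The integral defining \<open>PhiK\<close> has the
  weight t^(-1-\<alpha>), which is not integrable; subtracting the first-order Taylor polynomial of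
  the Poisson kernel at 0 makes it converge, and integration by parts leads to weights t^(-a) with a
  < 1, under which differentiation is safe. Next, undoing the construction asks for four derivatives
  of a solution, while the Hardy space grants only C2: averaging over short segments supplies the
  other two, because the system has constant coefficients. Finally, boundary values come as bounded
  families only. For p > 1, L1 convergence is forced by minimising the integral of the strictly
  convex sqrt(1 + |v|^2) over midpoint combinations of tails; p = \<infinity> is run with exponent 2
  and boundedness recovered afterwards. For p = 1, masses are carried to the real line by a Borel
  code of the sphere with a continuous left inverse, so that Helly's theorem applies. The Lame
  conditions enter through 0 < \<alpha> < 1, two identities for \<alpha> and \<beta>, and
  \<open>2 * mu + lam > 0\<close>, which makes the divergence harmonic.\<close>

definition has_pd :: "3 \<Rightarrow> (R3 \<Rightarrow> real) \<Rightarrow> real \<Rightarrow> R3 \<Rightarrow> bool" where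
  "has_pd i f D x \<longleftrightarrow> ((\<lambda>t. f (x + t *\<^sub>R axis i 1)) has_real_derivative D) (at 0)"

lemma has_pd_imp_pd: "has_pd i f D x \<Longrightarrow> pd i f x = D"
  unfolding has_pd_def pd_def has_real_derivative_iff_has_vector_derivative
  by (rule vector_derivative_at)

lemma eventually_line:
  fixes x :: R3
  assumes "open U" "x \<in> U"
  shows "eventually (\<lambda>t. x + t *\<^sub>R axis i 1 \<in> U) (at (0::real))"
    "eventually (\<lambda>t. x + t *\<^sub>R axis i 1 \<in> U) (nhds (0::real))"
proof -
  have "((\<lambda>t. x + t *\<^sub>R axis i (1::real)) \<longlongrightarrow> x + 0 *\<^sub>R axis i 1) (nhds (0::real))"
    by (intro tendsto_intros filterlim_ident)
  from topological_tendstoD[OF this assms(1)] assms(2)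
  show "eventually (\<lambda>t. x + t *\<^sub>R axis i 1 \<in> U) (nhds (0::real))" by simp
  then show "eventually (\<lambda>t. x + t *\<^sub>R axis i 1 \<in> U) (at (0::real))"
    by (simp add: eventually_at_filter eventually_mono)
qed

lemma has_pd_cong:
  assumes "open U" "x \<in> U" "\<And>y. y \<in> U \<Longrightarrow> f y = g y"
  shows "has_pd i f D x \<longleftrightarrow> has_pd i g D x"
  unfolding has_pd_def
  by (rule DERIV_cong_ev[OF refl _ refl], rule eventually_mono[OF eventually_line(2)[OF assms(1,2)]])
     (rule assms(3))

lemma pd_cong:
  fixes f g :: "R3 \<Rightarrow> 'b::real_normed_vector"
  assumes "open U" "x \<in> U" "\<And>y. y \<in> U \<Longrightarrow> f y = g y"
  shows "pd i f x = pd i g x"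
  unfolding pd_def vector_derivative_def
proof (rule arg_cong[where f=Eps], rule ext)
  fix D
  have ev: "eventually (\<lambda>t. f (x + t *\<^sub>R axis i 1) = g (x + t *\<^sub>R axis i 1)) (nhds 0)"
    by (rule eventually_mono[OF eventually_line(2)[OF assms(1,2)]]) (rule assms(3))
  show "((\<lambda>t. f (x + t *\<^sub>R axis i 1)) has_vector_derivative D) (at 0) =
     ((\<lambda>t. g (x + t *\<^sub>R axis i 1)) has_vector_derivative D) (at 0)"
    by (rule has_vector_derivative_cong_ev[OF _ ]) (use ev assms(2,3) in \<open>auto elim: eventually_mono\<close>)
qed

lemma has_pd_const: "has_pd i (\<lambda>_. c) 0 x"
  unfolding has_pd_def by (auto intro!: derivative_eq_intros)

lemma has_pd_coord: "has_pd i (\<lambda>x. x $ j) (if i = j then 1 else 0) x"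
  unfolding has_pd_def by (auto intro!: derivative_eq_intros simp: axis_def)

lemma has_pd_add: "has_pd i f D x \<Longrightarrow> has_pd i g E x \<Longrightarrow> has_pd i (\<lambda>x. f x + g x) (D + E) x"
  unfolding has_pd_def by (auto intro!: derivative_eq_intros)

lemma has_pd_diff: "has_pd i f D x \<Longrightarrow> has_pd i g E x \<Longrightarrow> has_pd i (\<lambda>x. f x - g x) (D - E) x"
  unfolding has_pd_def by (auto intro!: derivative_eq_intros)

lemma has_pd_mult:
  "has_pd i f D x \<Longrightarrow> has_pd i g E x \<Longrightarrow> has_pd i (\<lambda>x. f x * g x) (f x * E + D * g x) x"
  unfolding has_pd_def by (auto intro!: derivative_eq_intros)

lemma has_pd_cmult: "has_pd i f D x \<Longrightarrow> has_pd i (\<lambda>x. c * f x) (c * D) x"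
  unfolding has_pd_def by (auto intro!: derivative_eq_intros)

lemma has_pd_sum:
  assumes "\<And>k. k \<in> A \<Longrightarrow> has_pd i (f k) (D k) x"
  shows "has_pd i (\<lambda>x. \<Sum>k\<in>A. f k x) (\<Sum>k\<in>A. D k) x"
  using assms unfolding has_pd_def by (intro DERIV_sum) auto

lemma has_pd_inverse:
  assumes "has_pd i f D x" "f x \<noteq> 0"
  shows "has_pd i (\<lambda>x. inverse (f x)) (- (inverse (f x) * D * inverse (f x))) x"
  using assms unfolding has_pd_def by (auto intro!: derivative_eq_intros)

lemma has_pd_sqrt:
  assumes "has_pd i f D x" "f x > 0"
  shows "has_pd i (\<lambda>x. sqrt (f x)) (1 / 2 * inverse (sqrt (f x)) * D) x"
  using assms unfolding has_pd_def by (auto intro!: derivative_eq_intros)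

lemma has_pd_affine:
  assumes "has_pd i f D (a *\<^sub>R x + b)"
  shows "has_pd i (\<lambda>x. f (a *\<^sub>R x + b)) (a * D) x"
proof -
  have "((\<lambda>t. f ((a *\<^sub>R x + b) + t *\<^sub>R axis i 1)) has_real_derivative D) (at (a * 0))"
    using assms by (simp add: has_pd_def)
  then have "((\<lambda>t. f ((a *\<^sub>R x + b) + (a * t) *\<^sub>R axis i 1)) has_real_derivative D * a) (at 0)"
    by (rule DERIV_chain2) (auto intro!: derivative_eq_intros)
  then show ?thesis unfolding has_pd_def by (simp add: algebra_simps)
qed

lemma has_pd_line:
  assumes "has_pd i f D (x + s *\<^sub>R axis i 1)"
  shows "((\<lambda>t. f (x + t *\<^sub>R axis i 1)) has_real_derivative D) (at s)"
proof -
  have "((\<lambda>t. f (x + s *\<^sub>R axis i 1 + t *\<^sub>R axis i 1)) has_real_derivative D) (at (s - s))"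
    using assms by (simp add: has_pd_def)
  then have "((\<lambda>t. f (x + s *\<^sub>R axis i 1 + (t - s) *\<^sub>R axis i 1)) has_real_derivative D * 1) (at s)"
    by (rule DERIV_chain2) (auto intro!: derivative_eq_intros)
  then show ?thesis by (simp add: algebra_simps)
qed

lemma continuous_on_slice:
  assumes "continuous_on (A \<times> Z) F" "z \<in> Z"
  shows "continuous_on A (\<lambda>x. F (x, z))"
proof -
  have "continuous_on A (\<lambda>x. (x, z))"
    by (intro continuous_intros)
  then show ?thesis
    by (rule continuous_on_compose2[OF assms(1)]) (use assms(2) in auto)
qed

text \<open>\<open>C\<^sup>k\<close> in the first argument on \<open>ball 0 R\<close>, with all derivatives continuous jointly in \<open>x\<close> and the
  parameter \<open>z\<close>: the form in which smoothness survives integration over \<open>z\<close>.\<close>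

fun CkP :: "nat \<Rightarrow> real \<Rightarrow> 'z::metric_space set \<Rightarrow> (R3 \<Rightarrow> 'z \<Rightarrow> real) \<Rightarrow> bool" where
  "CkP 0 R Z F \<longleftrightarrow> continuous_on (ball 0 R \<times> Z) (\<lambda>(x, z). F x z)"
| "CkP (Suc k) R Z F \<longleftrightarrow> continuous_on (ball 0 R \<times> Z) (\<lambda>(x, z). F x z) \<and>
     (\<forall>i. (\<forall>x\<in>ball 0 R. \<forall>z\<in>Z. has_pd i (\<lambda>y. F y z) (pd i (\<lambda>y. F y z) x) x) \<and>
          CkP k R Z (\<lambda>x z. pd i (\<lambda>y. F y z) x))"

lemma CkP_imp_continuous: "CkP k R Z F \<Longrightarrow> continuous_on (ball 0 R \<times> Z) (\<lambda>(x, z). F x z)"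
  by (cases k) auto

lemma CkP_has_pd:
  "CkP (Suc k) R Z F \<Longrightarrow> x \<in> ball 0 R \<Longrightarrow> z \<in> Z \<Longrightarrow> has_pd i (\<lambda>y. F y z) (pd i (\<lambda>y. F y z) x) x"
  by auto

lemma CkP_cong:
  assumes "\<And>x z. x \<in> ball 0 R \<Longrightarrow> z \<in> Z \<Longrightarrow> F x z = G x z"
  shows "CkP k R Z F \<longleftrightarrow> CkP k R Z G"
  using assms
proof (induction k arbitrary: F G)
  case 0
  show ?case using 0 by (auto intro!: continuous_on_cong)
next
  case (Suc k)
  have c: "continuous_on (ball 0 R \<times> Z) (\<lambda>(x, z). F x z) \<longleftrightarrow> continuous_on (ball 0 R \<times> Z) (\<lambda>(x, z). G x z)"
    using Suc.prems by (auto intro!: continuous_on_cong)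
  have p: "pd i (\<lambda>y. F y z) x = pd i (\<lambda>y. G y z) x" if "x \<in> ball 0 R" "z \<in> Z" for i x z
    by (rule pd_cong[OF open_ball that(1)]) (use Suc.prems that in auto)
  have h: "has_pd i (\<lambda>y. F y z) D x \<longleftrightarrow> has_pd i (\<lambda>y. G y z) D x" if "x \<in> ball 0 R" "z \<in> Z" for i x z D
    by (rule has_pd_cong[OF open_ball that(1)]) (use Suc.prems that in auto)
  have "CkP k R Z (\<lambda>x z. pd i (\<lambda>y. F y z) x) \<longleftrightarrow> CkP k R Z (\<lambda>x z. pd i (\<lambda>y. G y z) x)" for i
    by (rule Suc.IH) (rule p)
  then show ?case using c p h by simp
qed

text \<open>Exhibiting derivatives \<open>D\<close> by the calculus rules proves existence and
  identifies \<open>pd\<close>, which as a choice term carries no information by itself. The closure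
  rules below for arithmetic operations are inductions on \<open>k\<close> through this
  rule.\<close>

lemma CkP_SucI:
  assumes "continuous_on (ball 0 R \<times> Z) (\<lambda>(x, z). F x z)"
    and "\<And>i x z. x \<in> ball 0 R \<Longrightarrow> z \<in> Z \<Longrightarrow> has_pd i (\<lambda>y. F y z) (D i x z) x"
    and "\<And>i. CkP k R Z (D i)"
  shows "CkP (Suc k) R Z F"
proof -
  have p: "pd i (\<lambda>y. F y z) x = D i x z" if "x \<in> ball 0 R" "z \<in> Z" for i x z
    using has_pd_imp_pd[OF assms(2)[OF that]] .
  then have "CkP k R Z (\<lambda>x z. pd i (\<lambda>y. F y z) x)" for i
    using CkP_cong[of R Z "\<lambda>x z. pd i (\<lambda>y. F y z) x" "D i" k] assms(3) by auto
  then show ?thesis using assms p by simp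
qed

lemma CkP_Suc_lower: "CkP (Suc k) R Z F \<Longrightarrow> CkP k R Z F"
proof (induction k arbitrary: F)
  case (Suc k)
  then show ?case by (metis CkP.simps(2))
qed auto

lemma CkP_lower: "CkP k R Z F \<Longrightarrow> j \<le> k \<Longrightarrow> CkP j R Z F"
  by (induction k) (auto simp: le_Suc_eq simp del: CkP.simps dest: CkP_Suc_lower)

lemma CkP_subset:
  "CkP k R Z F \<Longrightarrow> R' \<le> R \<Longrightarrow> Z' \<subseteq> Z \<Longrightarrow> CkP k R' Z' F"
proof (induction k arbitrary: F)
  case 0
  then show ?case by (auto elim!: continuous_on_subset)
next
  case (Suc k)
  have "continuous_on (ball 0 R' \<times> Z') (\<lambda>(x, z). F x z)"
    using Suc.prems by (auto elim!: continuous_on_subset)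
  then show ?case using Suc by (auto dest: subsetD)
qed

lemma continuous_on_snd_param: "continuous_on Z c \<Longrightarrow> continuous_on (A \<times> Z) (\<lambda>(x, z). c z)"
  by (auto simp: case_prod_beta' intro!: continuous_intros elim: continuous_on_compose2)

lemma CkP_const: "continuous_on Z c \<Longrightarrow> CkP k R Z (\<lambda>x z. c z)"
proof (induction k arbitrary: c)
  case 0 then show ?case by (simp add: continuous_on_snd_param)
next
  case (Suc k)
  show ?case
  proof (rule CkP_SucI[where D="\<lambda>i x z. 0"])
    show "CkP k R Z (\<lambda>x z. 0)" using Suc.IH[of "\<lambda>_. 0"] by simp
  qed (use Suc in \<open>auto simp: continuous_on_snd_param has_pd_const\<close>)
qed

lemma CkP_coord: "CkP k R Z (\<lambda>x z. x $ j)"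
proof (cases k)
  case 0 then show ?thesis by (auto simp: case_prod_beta' intro!: continuous_intros)
next
  case (Suc k')
  show ?thesis unfolding Suc
    by (rule CkP_SucI[where D="\<lambda>i x z. if i = j then 1 else 0"])
       (auto simp: case_prod_beta' has_pd_coord intro!: continuous_intros CkP_const)
qed

lemma CkP_add: "CkP k R Z F \<Longrightarrow> CkP k R Z G \<Longrightarrow> CkP k R Z (\<lambda>x z. F x z + G x z)"
proof (induction k arbitrary: F G)
  case 0 then show ?case by (auto simp: case_prod_beta' intro!: continuous_intros)
next
  case (Suc k)
  note c = CkP_imp_continuous[OF Suc.prems(1)] CkP_imp_continuous[OF Suc.prems(2)]
  show ?case
    by (rule CkP_SucI[where D="\<lambda>i x z. pd i (\<lambda>y. F y z) x + pd i (\<lambda>y. G y z) x"])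
       (use Suc c in \<open>auto simp: case_prod_beta' intro!: continuous_intros has_pd_add\<close>)
qed

lemma CkP_mult: "CkP k R Z F \<Longrightarrow> CkP k R Z G \<Longrightarrow> CkP k R Z (\<lambda>x z. F x z * G x z)"
proof (induction k arbitrary: F G)
  case 0 then show ?case by (auto simp: case_prod_beta' intro!: continuous_intros)
next
  case (Suc k)
  note c = CkP_imp_continuous[OF Suc.prems(1)] CkP_imp_continuous[OF Suc.prems(2)]
  note l = CkP_Suc_lower[OF Suc.prems(1)] CkP_Suc_lower[OF Suc.prems(2)]
  show ?case
  proof (rule CkP_SucI[where D="\<lambda>i x z. F x z * pd i (\<lambda>y. G y z) x + pd i (\<lambda>y. F y z) x * G x z"])
    show "CkP k R Z (\<lambda>x z. F x z * pd i (\<lambda>y. G y z) x + pd i (\<lambda>y. F y z) x * G x z)" for i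
      by (intro CkP_add Suc.IH l) (use Suc.prems in auto)
  qed (use Suc c in \<open>auto simp: case_prod_beta' intro!: continuous_intros has_pd_mult\<close>)
qed

lemma CkP_cmult: "CkP k R Z F \<Longrightarrow> CkP k R Z (\<lambda>x z. c * F x z)"
  by (intro CkP_mult CkP_const continuous_intros)

lemma CkP_uminus: "CkP k R Z F \<Longrightarrow> CkP k R Z (\<lambda>x z. - F x z)"
  using CkP_cmult[of k R Z F "-1"] by simp

lemma CkP_diff: "CkP k R Z F \<Longrightarrow> CkP k R Z G \<Longrightarrow> CkP k R Z (\<lambda>x z. F x z - G x z)"
  using CkP_add[OF _ CkP_uminus, of k R Z F G] by simp

lemma CkP_sum: "(\<And>j. j \<in> A \<Longrightarrow> CkP k R Z (F j)) \<Longrightarrow> CkP k R Z (\<lambda>x z. \<Sum>j\<in>A. F j x z)"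
  by (induction A rule: infinite_finite_induct) (auto intro: CkP_add CkP_const continuous_intros)

lemma CkP_power: "CkP k R Z F \<Longrightarrow> CkP k R Z (\<lambda>x z. F x z ^ n)"
  by (induction n) (auto intro: CkP_mult CkP_const continuous_intros)

lemma CkP_inverse:
  "CkP k R Z F \<Longrightarrow> (\<And>x z. x \<in> ball 0 R \<Longrightarrow> z \<in> Z \<Longrightarrow> F x z \<noteq> 0) \<Longrightarrow> CkP k R Z (\<lambda>x z. inverse (F x z))"
proof (induction k arbitrary: F)
  case 0 then show ?case by (auto simp: case_prod_beta' intro!: continuous_intros)
next
  case (Suc k)
  note c = CkP_imp_continuous[OF Suc.prems(1)]
  note l = CkP_Suc_lower[OF Suc.prems(1)]
  show ?case
  proof (rule CkP_SucI[where D="\<lambda>i x z. - (inverse (F x z) * pd i (\<lambda>y. F y z) x * inverse (F x z))"])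
    show "CkP k R Z (\<lambda>x z. - (inverse (F x z) * pd i (\<lambda>y. F y z) x * inverse (F x z)))" for i
      by (intro CkP_uminus CkP_mult Suc.IH l) (use Suc.prems in auto)
  qed (use Suc c in \<open>auto simp: case_prod_beta' intro!: continuous_intros has_pd_inverse\<close>)
qed

lemma CkP_sqrt:
  "CkP k R Z F \<Longrightarrow> (\<And>x z. x \<in> ball 0 R \<Longrightarrow> z \<in> Z \<Longrightarrow> F x z > 0) \<Longrightarrow> CkP k R Z (\<lambda>x z. sqrt (F x z))"
proof (induction k arbitrary: F)
  case 0 then show ?case by (auto simp: case_prod_beta' intro!: continuous_intros)
next
  case (Suc k)
  note c = CkP_imp_continuous[OF Suc.prems(1)]
  note l = CkP_Suc_lower[OF Suc.prems(1)]
  show ?case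
  proof (rule CkP_SucI[where D="\<lambda>i x z. 1 / 2 * inverse (sqrt (F x z)) * pd i (\<lambda>y. F y z) x"])
    have nz: "sqrt (F x z) \<noteq> 0" if "x \<in> ball 0 R" "z \<in> Z" for x z
      using Suc.prems(2)[OF that] by simp
    show "CkP k R Z (\<lambda>x z. 1 / 2 * inverse (sqrt (F x z)) * pd i (\<lambda>y. F y z) x)" for i
      by (intro CkP_cmult CkP_mult CkP_inverse Suc.IH l nz) (use Suc.prems in auto)
    show "has_pd i (\<lambda>y. sqrt (F y z)) (1 / 2 * inverse (sqrt (F x z)) * pd i (\<lambda>y. F y z) x) x"
      if "x \<in> ball 0 R" "z \<in> Z" for i x z
      by (rule has_pd_sqrt[OF CkP_has_pd[OF Suc.prems(1) that] Suc.prems(2)[OF that]])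
  qed (use c in \<open>auto simp: case_prod_beta' intro!: continuous_intros\<close>)
qed

text \<open>Dilations \<open>t x\<close> and shifts of \<open>x\<close> along an axis are the two
  families averaged over the unit interval later; both are affine in \<open>x\<close> with
  coefficients continuous in \<open>z\<close>. A derivative of the composite is \<open>a z\<close>
  times a composite of the same shape, so the induction closes.\<close>

lemma CkP_affine:
  assumes "CkP k R Z0 (\<lambda>x _. f x)" "Z0 \<noteq> {}" "continuous_on Z a" "continuous_on Z b"
    and "\<And>x z. x \<in> ball 0 R' \<Longrightarrow> z \<in> Z \<Longrightarrow> a z *\<^sub>R x + b z \<in> ball 0 R"
  shows "CkP k R' Z (\<lambda>x z. f (a z *\<^sub>R x + b z))"
  using assms(1)
proof (induction k arbitrary: f)
  case (0 f)
  obtain z0 where z0: "z0 \<in> Z0" using assms(2) by auto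
  have f: "continuous_on (ball 0 R) f"
    using continuous_on_slice[OF CkP_imp_continuous[OF 0] z0] by simp
  have "continuous_on (ball 0 R' \<times> Z) (\<lambda>p. a (snd p) *\<^sub>R fst p + b (snd p))"
    by (intro continuous_intros continuous_on_compose2[OF assms(3)] continuous_on_compose2[OF assms(4)]) auto
  then have "continuous_on (ball 0 R' \<times> Z) (\<lambda>p. f (a (snd p) *\<^sub>R fst p + b (snd p)))"
    by (rule continuous_on_compose2[OF f]) (use assms(5) in auto)
  then show ?case by (simp add: case_prod_beta')
next
  case (Suc k f)
  show ?case
  proof (rule CkP_SucI[where D="\<lambda>i x z. a z * pd i f (a z *\<^sub>R x + b z)"])
    obtain z0 where z0: "z0 \<in> Z0" using assms(2) by auto
    have f: "continuous_on (ball 0 R) f"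
      using continuous_on_slice[OF CkP_imp_continuous[OF Suc.prems] z0] by simp
    have "continuous_on (ball 0 R' \<times> Z) (\<lambda>p. a (snd p) *\<^sub>R fst p + b (snd p))"
      by (intro continuous_intros continuous_on_compose2[OF assms(3)] continuous_on_compose2[OF assms(4)]) auto
    then have "continuous_on (ball 0 R' \<times> Z) (\<lambda>p. f (a (snd p) *\<^sub>R fst p + b (snd p)))"
      by (rule continuous_on_compose2[OF f]) (use assms(5) in auto)
    then show "continuous_on (ball 0 R' \<times> Z) (\<lambda>(x, z). f (a z *\<^sub>R x + b z))"
      by (simp add: case_prod_beta')
    show "has_pd i (\<lambda>y. f (a z *\<^sub>R y + b z)) (a z * pd i f (a z *\<^sub>R x + b z)) x"
      if "x \<in> ball 0 R'" "z \<in> Z" for i x z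
      by (rule has_pd_affine) (use CkP_has_pd[OF Suc.prems assms(5)[OF that] z0] in simp)
    show "CkP k R' Z (\<lambda>x z. a z * pd i f (a z *\<^sub>R x + b z))" for i
      using Suc by (intro CkP_mult CkP_const assms Suc.IH) auto
  qed
qed

text \<open>A one-point parameter set makes every rule for \<open>CkP\<close> a rule for functions
  of \<open>x\<close> alone.\<close>

definition Ck :: "nat \<Rightarrow> real \<Rightarrow> (R3 \<Rightarrow> real) \<Rightarrow> bool" where
  "Ck k R f \<longleftrightarrow> CkP k R {0::real} (\<lambda>x _. f x)"

lemma continuous_on_fst_param: "z0 \<in> Z \<Longrightarrow> continuous_on (A \<times> Z) (\<lambda>(x, z). f x) \<longleftrightarrow> continuous_on A f"
proof
  assume "z0 \<in> Z" "continuous_on (A \<times> Z) (\<lambda>(x, z). f x)"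
  from continuous_on_slice[OF this(2,1)] show "continuous_on A f" by simp
qed (auto simp: case_prod_beta' intro!: continuous_intros elim: continuous_on_compose2)

lemma Ck_0: "Ck 0 R f \<longleftrightarrow> continuous_on (ball 0 R) f"
  unfolding Ck_def by (simp add: continuous_on_fst_param)

lemma Ck_Suc: "Ck (Suc k) R f \<longleftrightarrow> continuous_on (ball 0 R) f \<and>
    (\<forall>i. (\<forall>x\<in>ball 0 R. has_pd i f (pd i f x) x) \<and> Ck k R (pd i f))"
  unfolding Ck_def by (simp add: continuous_on_fst_param)

lemma Ck_continuous: "Ck k R f \<Longrightarrow> continuous_on (ball 0 R) f"
  by (cases k) (auto simp: Ck_0 Ck_Suc)

lemma Ck_pd: "Ck (Suc k) R f \<Longrightarrow> Ck k R (pd i f)"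
  by (auto simp: Ck_Suc)

lemma Ck_has_pd: "Ck (Suc k) R f \<Longrightarrow> norm x < R \<Longrightarrow> has_pd i f (pd i f x) x"
  by (auto simp: Ck_Suc)

lemma Ck_lower: "Ck k R f \<Longrightarrow> j \<le> k \<Longrightarrow> Ck j R f"
  unfolding Ck_def by (rule CkP_lower)

lemma Ck_subset: "Ck k R f \<Longrightarrow> R' \<le> R \<Longrightarrow> Ck k R' f"
  unfolding Ck_def by (auto elim: CkP_subset)

lemma Ck_cong: "(\<And>x. norm x < R \<Longrightarrow> f x = g x) \<Longrightarrow> Ck k R f \<longleftrightarrow> Ck k R g"
  unfolding Ck_def by (rule CkP_cong) auto

lemma Ck_const: "Ck k R (\<lambda>_. c)"
  unfolding Ck_def by (rule CkP_const) (rule continuous_on_const)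

lemma Ck_coord: "Ck k R (\<lambda>x. x $ j)"
  unfolding Ck_def by (rule CkP_coord)

lemma Ck_add: "Ck k R f \<Longrightarrow> Ck k R g \<Longrightarrow> Ck k R (\<lambda>x. f x + g x)"
  unfolding Ck_def by (rule CkP_add)

lemma Ck_diff: "Ck k R f \<Longrightarrow> Ck k R g \<Longrightarrow> Ck k R (\<lambda>x. f x - g x)"
  unfolding Ck_def by (rule CkP_diff)

lemma Ck_mult: "Ck k R f \<Longrightarrow> Ck k R g \<Longrightarrow> Ck k R (\<lambda>x. f x * g x)"
  unfolding Ck_def by (rule CkP_mult)

lemma Ck_cmult: "Ck k R f \<Longrightarrow> Ck k R (\<lambda>x. c * f x)"
  unfolding Ck_def by (rule CkP_cmult)

lemma Ck_sum: "(\<And>j. j \<in> A \<Longrightarrow> Ck k R (f j)) \<Longrightarrow> Ck k R (\<lambda>x. \<Sum>j\<in>A. f j x)"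
  unfolding Ck_def by (rule CkP_sum)

lemma CkP_slice: "CkP k R Z F \<Longrightarrow> z \<in> Z \<Longrightarrow> Ck k R (\<lambda>x. F x z)"
proof (induction k arbitrary: F)
  case 0
  then show ?case using continuous_on_slice[OF CkP_imp_continuous[OF 0(1)] 0(2)] by (simp add: Ck_0)
next
  case (Suc k)
  have "continuous_on (ball 0 R) (\<lambda>x. F x z)"
    using continuous_on_slice[OF CkP_imp_continuous[OF Suc.prems(1)] Suc.prems(2)] by simp
  then show ?case using Suc by (auto simp: Ck_Suc)
qed

lemma Ck_affine:
  assumes "Ck k R f" "continuous_on Z a" "continuous_on Z b"
    and "\<And>x z. x \<in> ball 0 R' \<Longrightarrow> z \<in> Z \<Longrightarrow> a z *\<^sub>R x + b z \<in> ball 0 R"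
  shows "CkP k R' Z (\<lambda>x z. f (a z *\<^sub>R x + b z))"
  using assms unfolding Ck_def by (intro CkP_affine) auto

section \<open>Differentiation under the integral sign\<close>

lemma measurable_continuous_on_sets:
  fixes h :: "'z::metric_space \<Rightarrow> 'b::{metric_space,second_countable_topology}"
  assumes "continuous_on Z h" "sets M = sets (restrict_space borel Z)"
  shows "h \<in> borel_measurable M"
  using borel_measurable_continuous_on_restrict[OF assms(1)] assms(2) measurable_cong_sets by blast

lemma space_eq_of_sets_restrict: "sets M = sets (restrict_space borel Z) \<Longrightarrow> space M = Z"
  by (drule sets_eq_imp_space_eq) (simp add: space_restrict_space)

text \<open>The density \<open>g\<close> is merely integrable: this one form covers L^p boundary
  data, measures (\<open>g\<close> constant 1) and the weights \<open>t powr - a\<close>.\<close>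

lemma integrable_continuous_mult:
  fixes h g :: "'z::metric_space \<Rightarrow> real"
  assumes "continuous_on Z h" "compact Z" "sets M = sets (restrict_space borel Z)" "integrable M g"
  shows "integrable M (\<lambda>z. h z * g z)"
proof -
  note [measurable] = measurable_continuous_on_sets[OF assms(1,3)] borel_measurable_integrable[OF assms(4)]
  obtain B where B: "\<And>z. z \<in> Z \<Longrightarrow> \<bar>h z\<bar> \<le> B"
    using compact_imp_bounded[OF compact_continuous_image[OF assms(1,2)]] by (auto simp: bounded_iff)
  show ?thesis
  proof (rule Bochner_Integration.integrable_bound[of M "\<lambda>z. B * g z"])
    show "AE z in M. norm (h z * g z) \<le> norm (B * g z)"
    proof (rule AE_I2)
      fix z assume "z \<in> space M"
      then have "\<bar>h z\<bar> \<le> \<bar>B\<bar>" using B[of z] by (simp add: space_eq_of_sets_restrict[OF assms(3)])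
      then show "norm (h z * g z) \<le> norm (B * g z)" by (simp add: abs_mult mult_right_mono)
    qed
  qed (use assms in auto)
qed

lemma continuous_on_param_slice:
  "continuous_on (U \<times> Z) (\<lambda>(x, z). F x z) \<Longrightarrow> x \<in> U \<Longrightarrow> continuous_on Z (\<lambda>z. F x z)"
  by (rule continuous_on_compose2[where f="\<lambda>z. (x, z)" and s=Z and t="U \<times> Z", of "\<lambda>(x, z). F x z", simplified])
     (auto intro!: continuous_on_Pair)

lemma abs_integral_mult_le:
  fixes h g :: "'z::metric_space \<Rightarrow> real"
  assumes "continuous_on Z h" "compact Z" "sets M = sets (restrict_space borel Z)" "integrable M g"
    and "\<And>z. z \<in> Z \<Longrightarrow> \<bar>h z\<bar> \<le> e"
  shows "\<bar>\<integral>z. h z * g z \<partial>M\<bar> \<le> e * (\<integral>z. \<bar>g z\<bar> \<partial>M)"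
proof -
  have "\<bar>\<integral>z. h z * g z \<partial>M\<bar> \<le> (\<integral>z. e * \<bar>g z\<bar> \<partial>M)"
  proof (rule order_trans[OF integral_abs_bound integral_mono])
    show "\<bar>h z * g z\<bar> \<le> e * \<bar>g z\<bar>" if "z \<in> space M" for z
      using assms(5)[of z] that by (simp add: space_eq_of_sets_restrict[OF assms(3)] abs_mult mult_right_mono)
  qed (use assms in \<open>auto intro: integrable_continuous_mult\<close>)
  then show ?thesis by simp
qed

text \<open>Compactness of \<open>Z\<close> makes \<open>F\<close> near \<open>x0\<close> close to
  its values at \<open>x0\<close> uniformly in the parameter, so the two integrals differ by at most
  that closeness times the L1 norm \<open>G\<close> of the density.\<close>

lemma continuous_on_param_integral:
  fixes F :: "'a::metric_space \<Rightarrow> 'z::metric_space \<Rightarrow> real"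
  assumes F: "continuous_on (U \<times> Z) (\<lambda>(x, z). F x z)" and Z: "compact Z"
    and M: "sets M = sets (restrict_space borel Z)" and g: "integrable M g"
  shows "continuous_on U (\<lambda>x. \<integral>z. F x z * g z \<partial>M)"
  unfolding continuous_on_iff
proof (intro ballI allI impI)
  fix x0 and e :: real assume x0: "x0 \<in> U" and e: "e > 0"
  define G where "G = (\<integral>z. \<bar>g z\<bar> \<partial>M)"
  have G: "G \<ge> 0" unfolding G_def by simp
  \<comment> \<open>The \<open>+ 1\<close> covers a density of norm zero.\<close>
  define e' where "e' = e / (G + 1)"
  have e': "e' > 0" "e' * G < e" using e G by (auto simp: e'_def field_simps)
  obtain X0 where X0: "x0 \<in> X0" "open X0"
    "\<forall>x\<in>X0 \<inter> U. \<forall>t\<in>Z. dist ((\<lambda>(x, z). F x z) (x, t)) ((\<lambda>(x, z). F x z) (x0, t)) \<le> e'"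
    by (rule continuous_on_prod_compactE[OF F Z x0 e'(1)])
  obtain d where d: "d > 0" "ball x0 d \<subseteq> X0" using X0(1,2) open_contains_ball by blast
  show "\<exists>d>0. \<forall>x\<in>U. dist x x0 < d \<longrightarrow> dist (\<integral>z. F x z * g z \<partial>M) (\<integral>z. F x0 z * g z \<partial>M) < e"
  proof (intro exI[of _ d] conjI ballI impI d)
    fix x assume x: "x \<in> U" "dist x x0 < d"
    then have "x \<in> X0" using d by (auto simp: dist_commute)
    have c: "continuous_on Z (\<lambda>z. F x z)" "continuous_on Z (\<lambda>z. F x0 z)"
      using continuous_on_param_slice[OF F] x x0 by auto
    have "(\<integral>z. F x z * g z \<partial>M) - (\<integral>z. F x0 z * g z \<partial>M) = (\<integral>z. F x z * g z - F x0 z * g z \<partial>M)"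
      by (rule Bochner_Integration.integral_diff[symmetric])
         (rule integrable_continuous_mult[OF c(1) Z M g], rule integrable_continuous_mult[OF c(2) Z M g])
    also have "\<dots> = (\<integral>z. (F x z - F x0 z) * g z \<partial>M)" by (simp add: algebra_simps)
    finally have "\<bar>(\<integral>z. F x z * g z \<partial>M) - (\<integral>z. F x0 z * g z \<partial>M)\<bar> \<le> e' * G"
      unfolding G_def using X0(3) \<open>x \<in> X0\<close> x
      by (auto intro!: abs_integral_mult_le[of Z] continuous_intros c Z M g simp: dist_real_def)
    then show "dist (\<integral>z. F x z * g z \<partial>M) (\<integral>z. F x0 z * g z \<partial>M) < e"
      using e' by (simp add: dist_real_def)
  qed
qed

text \<open>By the mean value inequality and the joint continuity of the derivative, the difference
  quotient converges uniformly over the compact parameter set; uniform convergence passes through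
  integration against \<open>g\<close>.\<close>

lemma has_pd_param_integral:
  fixes F :: "R3 \<Rightarrow> 'z::metric_space \<Rightarrow> real"
  assumes F: "CkP (Suc k) R Z F" and Z: "compact Z"
    and M: "sets M = sets (restrict_space borel Z)" and g: "integrable M g" and x: "norm x < R"
  shows "has_pd i (\<lambda>x. \<integral>z. F x z * g z \<partial>M) (\<integral>z. pd i (\<lambda>y. F y z) x * g z \<partial>M) x"
proof -
  define F' where "F' = (\<lambda>x z. pd i (\<lambda>y. F y z) x)"
  have cF: "continuous_on (ball 0 R \<times> Z) (\<lambda>(x, z). F x z)" by (rule CkP_imp_continuous[OF F])
  have cF': "continuous_on (ball 0 R \<times> Z) (\<lambda>(x, z). F' x z)"
    using F CkP_imp_continuous[of k R Z "\<lambda>x z. pd i (\<lambda>y. F y z) x"] unfolding F'_def by auto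
  have xR: "x \<in> ball 0 R" using x by simp
  define I where "I = (\<lambda>x. \<integral>z. F x z * g z \<partial>M)"
  define D where "D = (\<integral>z. F' x z * g z \<partial>M)"
  define G where "G = (\<integral>z. \<bar>g z\<bar> \<partial>M)"
  have G: "G \<ge> 0" unfolding G_def by simp
  have "((\<lambda>h. (I (x + h *\<^sub>R axis i 1) - I x) / h) \<longlongrightarrow> D) (at 0)"
  proof (rule LIM_I)
    fix e :: real assume e: "e > 0"
    define e' where "e' = e / (G + 1)"
    have e': "e' > 0" "e' * G < e" using e G by (auto simp: e'_def field_simps)
    obtain X0 where X0: "x \<in> X0" "open X0"
      "\<forall>y\<in>X0 \<inter> ball 0 R. \<forall>t\<in>Z. dist ((\<lambda>(x, z). F' x z) (y, t)) ((\<lambda>(x, z). F' x z) (x, t)) \<le> e'"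
      by (rule continuous_on_prod_compactE[OF cF' Z xR e'(1)])
    have "open (X0 \<inter> ball 0 R)" "x \<in> X0 \<inter> ball 0 R" using X0 xR by auto
    then obtain d where d: "d > 0" "ball x d \<subseteq> X0 \<inter> ball 0 R" using open_contains_ball by blast
    show "\<exists>s>0. \<forall>h. h \<noteq> 0 \<and> norm (h - 0) < s \<longrightarrow> norm ((I (x + h *\<^sub>R axis i 1) - I x) / h - D) < e"
    proof (intro exI[of _ d] conjI allI impI d)
      fix h :: real assume h: "h \<noteq> 0 \<and> norm (h - 0) < d"
      have seg: "x + s *\<^sub>R axis i 1 \<in> X0 \<inter> ball 0 R" if "\<bar>s\<bar> \<le> \<bar>h\<bar>" for s
      proof (rule subsetD[OF d(2)])
        have "dist x (x + s *\<^sub>R axis i 1) = \<bar>s\<bar>" by (simp add: dist_norm)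
        then show "x + s *\<^sub>R axis i 1 \<in> ball x d" using h that by simp
      qed
      have q: "\<bar>(F (x + h *\<^sub>R axis i 1) z - F x z) / h - F' x z\<bar> \<le> e'" if z: "z \<in> Z" for z
      proof -
        \<comment> \<open>Removing the linear part leaves a function whose derivative is the
          variation of \<open>F'\<close> along the segment, at most \<open>e'\<close>.\<close>
        let ?\<phi> = "\<lambda>t. F (x + t *\<^sub>R axis i 1) z - t * F' x z"
        have "norm (?\<phi> h - ?\<phi> 0) \<le> e' * norm (h - 0)"
        proof (rule field_differentiable_bound[where S="{-\<bar>h\<bar>..\<bar>h\<bar>}" and f'="\<lambda>t. F' (x + t *\<^sub>R axis i 1) z - F' x z"])
          fix s assume s: "s \<in> {-\<bar>h\<bar>..\<bar>h\<bar>}"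
          then have s': "x + s *\<^sub>R axis i 1 \<in> X0 \<inter> ball 0 R" by (intro seg) auto
          have "has_pd i (\<lambda>y. F y z) (F' (x + s *\<^sub>R axis i 1) z) (x + s *\<^sub>R axis i 1)"
            unfolding F'_def by (rule CkP_has_pd[OF F _ z]) (use s' in blast)
          from has_pd_line[OF this]
          have "((\<lambda>t. F (x + t *\<^sub>R axis i 1) z) has_real_derivative F' (x + s *\<^sub>R axis i 1) z) (at s within {-\<bar>h\<bar>..\<bar>h\<bar>})"
            by (rule DERIV_subset) simp
          then show "(?\<phi> has_real_derivative F' (x + s *\<^sub>R axis i 1) z - F' x z) (at s within {-\<bar>h\<bar>..\<bar>h\<bar>})"
            by (auto intro!: derivative_eq_intros)
          show "norm (F' (x + s *\<^sub>R axis i 1) z - F' x z) \<le> e'"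
            using X0(3) s' z by (auto simp: dist_real_def)
        qed auto
        moreover have "?\<phi> h - ?\<phi> 0 = h * ((F (x + h *\<^sub>R axis i 1) z - F x z) / h - F' x z)"
          using h by (simp add: field_simps)
        ultimately show ?thesis using h by (simp add: abs_mult)
      qed
      have xh: "x + h *\<^sub>R axis i 1 \<in> ball 0 R" using seg[of h] by auto
      have c: "continuous_on Z (\<lambda>z. F (x + h *\<^sub>R axis i 1) z)" "continuous_on Z (\<lambda>z. F x z)"
        "continuous_on Z (\<lambda>z. F' x z)"
        using continuous_on_param_slice[OF cF] continuous_on_param_slice[OF cF'] xR xh by auto
      note int = integrable_continuous_mult[OF _ Z M g]
      have "(I (x + h *\<^sub>R axis i 1) - I x) / h - D =
         (\<integral>z. ((F (x + h *\<^sub>R axis i 1) z * g z - F x z * g z) / h) - F' x z * g z \<partial>M)"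
        unfolding I_def D_def by (simp add: int c)
      also have "\<dots> = (\<integral>z. ((F (x + h *\<^sub>R axis i 1) z - F x z) / h - F' x z) * g z \<partial>M)"
        by (rule Bochner_Integration.integral_cong) (auto simp: algebra_simps diff_divide_distrib)
      finally have "\<bar>(I (x + h *\<^sub>R axis i 1) - I x) / h - D\<bar> \<le> e' * G"
        unfolding G_def using h
        by (auto intro!: abs_integral_mult_le[of Z] continuous_intros c Z M g q)
      then show "norm ((I (x + h *\<^sub>R axis i 1) - I x) / h - D) < e" using e' by simp
    qed
  qed
  then show ?thesis
    unfolding has_pd_def DERIV_def I_def D_def F'_def by simp
qed

lemma pd_param_integral:
  fixes F :: "R3 \<Rightarrow> 'z::metric_space \<Rightarrow> real"
  assumes "CkP (Suc k) R Z F" "compact Z" "sets M = sets (restrict_space borel Z)" "integrable M g" "norm x < R"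
  shows "pd i (\<lambda>x. \<integral>z. F x z * g z \<partial>M) x = (\<integral>z. pd i (\<lambda>y. F y z) x * g z \<partial>M)"
  by (rule has_pd_imp_pd[OF has_pd_param_integral[OF assms]])

lemma Ck_param_integral:
  fixes F :: "R3 \<Rightarrow> 'z::metric_space \<Rightarrow> real"
  assumes "CkP k R Z F" "compact Z" "sets M = sets (restrict_space borel Z)" "integrable M g"
  shows "Ck k R (\<lambda>x. \<integral>z. F x z * g z \<partial>M)"
  using assms(1)
proof (induction k arbitrary: F)
  case 0
  then show ?case using assms by (auto simp: Ck_0 intro!: continuous_on_param_integral)
next
  case (Suc k)
  have "Ck k R (\<lambda>x. \<integral>z. pd i (\<lambda>y. F y z) x * g z \<partial>M)" for i
    by (rule Suc.IH) (use Suc.prems in auto)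
  then have "Ck k R (pd i (\<lambda>x. \<integral>z. F x z * g z \<partial>M))" for i
    by (rule Ck_cong[THEN iffD1, rotated]) (simp add: pd_param_integral[OF Suc.prems assms(2-)])
  moreover have "continuous_on (ball 0 R) (\<lambda>x. \<integral>z. F x z * g z \<partial>M)"
    by (rule continuous_on_param_integral[OF CkP_imp_continuous[OF Suc.prems] assms(2-)])
  ultimately show ?case unfolding Ck_Suc
    using has_pd_param_integral[OF Suc.prems assms(2-)] pd_param_integral[OF Suc.prems assms(2-)] by simp
qed

section \<open>Integration over the unit interval\<close>

definition I01 :: "real measure" where
  "I01 = restrict_space lborel {0..1}"

lemma sets_I01: "sets I01 = sets (restrict_space borel {0..1})"
  unfolding I01_def by (rule sets_restrict_space_cong) simp

lemma space_I01: "space I01 = {0..1}"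
  by (rule space_eq_of_sets_restrict[OF sets_I01])

lemma prob_space_I01: "prob_space I01"
  by (rule prob_spaceI) (simp add: space_I01, simp add: I01_def emeasure_restrict_space)

lemma integrable_I01_iff: "integrable I01 f \<longleftrightarrow> set_integrable lborel {0..1} (f :: real \<Rightarrow> real)"
  unfolding I01_def set_integrable_def by (rule integrable_restrict_space) auto

lemma integral_I01: "(\<integral>t. f t \<partial>I01) = (LINT t:{0..1}|lborel. (f :: real \<Rightarrow> real) t)"
  unfolding I01_def set_lebesgue_integral_def by (rule integral_restrict_space) auto

lemma integral_I01_eq_integral:
  fixes f :: "real \<Rightarrow> real"
  shows
  "integrable I01 f \<Longrightarrow> integral {0..1} f = (\<integral>t. f t \<partial>I01)" "integrable I01 f \<Longrightarrow> f integrable_on {0..1}"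
  using set_borel_integral_eq_integral[of "{0..1}" f] by (auto simp: integrable_I01_iff integral_I01)

lemma integrable_I01_const: "integrable I01 (\<lambda>_. c :: real)"
  using prob_space_I01 by (intro finite_measure.integrable_const prob_space.finite_measure)

lemma measure_I01 [simp]: "measure I01 (space I01) = 1"
  by (rule prob_space.prob_space[OF prob_space_I01])

lemma integrable_I01_continuous: "continuous_on {0..1} f \<Longrightarrow> integrable I01 (f :: real \<Rightarrow> real)"
  using integrable_continuous_mult[OF _ compact_Icc sets_I01 integrable_I01_const[of 1], of f] by simp

lemma integrable_I01_powr:
  assumes "a < 1" shows "integrable I01 (\<lambda>t. t powr - a)"
proof -
  have "(\<lambda>t. t powr - a) integrable_on {0..1}"
    by (rule integrable_on_powr_from_0) (use assms in auto)
  then have "set_integrable lebesgue {0..1} (\<lambda>t. t powr - a)"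
    by (rule nonnegative_absolutely_integrable_1) auto
  then show ?thesis
    unfolding integrable_I01_iff set_integrable_def by (subst (asm) integrable_completion) auto
qed

lemma integral_I01_FTC:
  assumes "continuous_on {0..1} f" "\<And>t. t \<in> {0<..<1} \<Longrightarrow> (f has_real_derivative f' t) (at t)"
    and "integrable I01 f'"
  shows "(\<integral>t. f' t \<partial>I01) = f 1 - f 0"
proof -
  have "(f' has_integral (f 1 - f 0)) {0..1}"
    by (rule fundamental_theorem_of_calculus_interior)
       (use assms in \<open>auto simp: has_real_derivative_iff_has_vector_derivative\<close>)
  then show ?thesis using integral_I01_eq_integral[OF assms(3)] by (simp add: integral_unique)
qed

lemma norm_axis_shift: "norm (x + t *\<^sub>R axis i 1 :: R3) \<le> norm x + \<bar>t\<bar>"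
  using norm_triangle_ineq[of x "t *\<^sub>R axis i 1"] by simp

text \<open>The fundamental theorem along a segment: read backwards, the derivative of an average is
  a difference quotient. Both the symmetry of second derivatives and the smoothing effect of
  averages rest on this.\<close>

lemma integral_pd_segment:
  assumes f: "Ck (Suc k) R f" and e: "norm x + \<bar>e\<bar> < R"
  shows "f (x + e *\<^sub>R axis j 1) - f x = e * (\<integral>s. pd j f (x + (e * s) *\<^sub>R axis j 1) \<partial>I01)"
proof -
  have inR: "norm (x + (e * s) *\<^sub>R axis j 1) < R" if "0 \<le> s" "s \<le> 1" for s
    using norm_axis_shift[of x "e * s" j] e mult_left_mono[of "\<bar>s\<bar>" 1 "\<bar>e\<bar>"] that by (simp add: abs_mult)
  let ?f = "\<lambda>s. f (x + (e * s) *\<^sub>R axis j 1)"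
  have d: "(?f has_real_derivative e * pd j f (x + (e * s) *\<^sub>R axis j 1)) (at s)" if "0 \<le> s" "s \<le> 1" for s
  proof -
    have "((\<lambda>t. f (x + t *\<^sub>R axis j 1)) has_real_derivative pd j f (x + (e * s) *\<^sub>R axis j 1)) (at (e * s))"
      by (rule has_pd_line[OF Ck_has_pd[OF f inR[OF that]]])
    then have "(?f has_real_derivative pd j f (x + (e * s) *\<^sub>R axis j 1) * e) (at s)"
      by (rule DERIV_chain2) (auto intro!: derivative_eq_intros)
    then show ?thesis by (simp add: mult.commute)
  qed
  have c: "continuous_on {0..1} (\<lambda>s. pd j f (x + (e * s) *\<^sub>R axis j 1))"
    by (rule continuous_on_compose2[OF Ck_continuous[OF Ck_pd[OF f]]]) (auto intro!: continuous_intros inR)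
  have "(\<integral>s. e * pd j f (x + (e * s) *\<^sub>R axis j 1) \<partial>I01) = ?f 1 - ?f 0"
  proof (rule integral_I01_FTC)
    show "continuous_on {0..1} ?f"
      by (auto intro!: continuous_at_imp_continuous_on DERIV_isCont d)
  qed (auto intro!: d integrable_I01_continuous continuous_intros c)
  then show ?thesis by simp
qed

text \<open>A Steklov average: it gains one derivative in the direction of averaging and commutes with
  partial derivatives, so iterating it regularises without any bump functions.\<close>

definition stek :: "real \<Rightarrow> 3 \<Rightarrow> (R3 \<Rightarrow> real) \<Rightarrow> R3 \<Rightarrow> real" where
  "stek e i f x = (\<integral>s. f (x + (e * s) *\<^sub>R axis i 1) \<partial>I01)"

lemma CkP_shift:
  assumes "Ck k R f" "e \<ge> 0"
  shows "CkP k (R - e) {0..1} (\<lambda>x s. f (x + (e * s) *\<^sub>R axis i 1))"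
proof -
  have "CkP k (R - e) {0..1} (\<lambda>x s. f (1 *\<^sub>R x + (e * s) *\<^sub>R axis i 1))"
  proof (rule Ck_affine[OF assms(1)])
    fix x :: R3 and s :: real assume "x \<in> ball 0 (R - e)" "s \<in> {0..1}"
    then show "1 *\<^sub>R x + (e * s) *\<^sub>R axis i 1 \<in> ball 0 R"
      using norm_axis_shift[of x "e * s" i] mult_left_mono[of "\<bar>s\<bar>" 1 e] assms(2) by (simp add: abs_mult)
  qed (auto intro!: continuous_intros)
  then show ?thesis by simp
qed

lemma Ck_stek: "Ck k R f \<Longrightarrow> e \<ge> 0 \<Longrightarrow> Ck k (R - e) (stek e i f)"
  unfolding stek_def
  using Ck_param_integral[OF CkP_shift compact_Icc sets_I01 integrable_I01_const[of 1], of k R f e] by simp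

lemma pd_shift:
  fixes x :: R3
  shows "pd j (\<lambda>y. f (y + b)) x = pd j f (x + b)"
  by (simp add: pd_def algebra_simps)

lemma pd_stek:
  assumes "Ck (Suc k) R f" "e \<ge> 0" "norm x < R - e"
  shows "pd j (stek e i f) x = stek e i (pd j f) x"
  unfolding stek_def
  using pd_param_integral[OF CkP_shift[OF assms(1,2)] compact_Icc sets_I01 integrable_I01_const[of 1] assms(3)]
  by (simp add: pd_shift)

lemma has_pd_unique: "has_pd i f D x \<Longrightarrow> has_pd i f E x \<Longrightarrow> D = E"
  using has_pd_imp_pd by blast

text \<open>The increment of \<open>f\<close> over a step \<open>e\<close> in direction
  \<open>j\<close> is \<open>e\<close> times an average of \<open>pd j f\<close>. Differentiating
  both expressions in direction \<open>i\<close> shows that the quotient of \<open>pd i f\<close> in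
  direction \<open>j\<close> is an average of \<open>pd i (pd j f)\<close> over the step, and
  \<open>e\<close> tends to 0 from the right.\<close>

lemma pd_commute:
  assumes f: "Ck (Suc (Suc k)) R f" and x: "norm x < R"
  shows "pd i (pd j f) x = pd j (pd i f) x"
proof -
  define e0 where "e0 = (R - norm x) / 2"
  have e0: "e0 > 0" "norm x + e0 < R" using x by (auto simp: e0_def field_simps)
  let ?I = "\<lambda>e. \<integral>s. pd i (pd j f) (x + (e * s) *\<^sub>R axis j 1) \<partial>I01"
  have quot: "(pd i f (x + e *\<^sub>R axis j 1) - pd i f x) / e = ?I e" if e: "e > 0" "e < e0" for e
  proof -
    let ?g = "\<lambda>y. f (y + e *\<^sub>R axis j 1) - f y"
    let ?J = "\<lambda>y. \<integral>s. pd j f (y + (e * s) *\<^sub>R axis j 1) \<partial>I01"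
    have xe: "norm x < R - e" using e e0 by simp
    have gJ: "?g y = e * ?J y" if "y \<in> ball 0 (R - e)" for y
      by (rule integral_pd_segment[OF f]) (use that e in auto)
    have "has_pd i f (pd i f (x + e *\<^sub>R axis j 1)) (x + e *\<^sub>R axis j 1)"
      by (rule Ck_has_pd[OF f]) (use norm_axis_shift[of x e j] e e0 in auto)
    then have "has_pd i (\<lambda>y. f (1 *\<^sub>R y + e *\<^sub>R axis j 1)) (1 * pd i f (x + e *\<^sub>R axis j 1)) x"
      by (intro has_pd_affine) simp
    then have "has_pd i ?g (pd i f (x + e *\<^sub>R axis j 1) - pd i f x) x"
      using Ck_has_pd[OF f x] by (intro has_pd_diff) simp_all
    then have "has_pd i (\<lambda>y. e * ?J y) (pd i f (x + e *\<^sub>R axis j 1) - pd i f x) x"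
      using has_pd_cong[of "ball 0 (R - e)" x ?g "\<lambda>y. e * ?J y" i, OF open_ball _ gJ] xe by simp
    moreover have "has_pd i (\<lambda>y. e * ?J y) (e * ?I e) x"
      using has_pd_param_integral[OF CkP_shift[OF Ck_pd[OF f]] compact_Icc sets_I01 integrable_I01_const[of 1] xe, of i j]
        e by (intro has_pd_cmult) (simp add: pd_shift)
    ultimately have "pd i f (x + e *\<^sub>R axis j 1) - pd i f x = e * ?I e"
      by (rule has_pd_unique)
    then show ?thesis using e by simp
  qed
  have "continuous_on ({0..e0} \<times> {0..1}) (\<lambda>p. pd i (pd j f) (x + (fst p * snd p) *\<^sub>R axis j 1))"
  proof (rule continuous_on_compose2[OF Ck_continuous[OF Ck_pd[OF Ck_pd[OF f]]]])
    show "(\<lambda>p. x + (fst p * snd p) *\<^sub>R axis j 1) ` ({0..e0} \<times> {0..1}) \<subseteq> ball 0 R"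
    proof safe
      fix a b :: real assume "a \<in> {0..e0}" "b \<in> {0..1}"
      then have "\<bar>a * b\<bar> \<le> e0 * 1" unfolding abs_mult by (intro mult_mono) auto
      then show "x + (fst (a, b) * snd (a, b)) *\<^sub>R axis j 1 \<in> ball 0 R"
        using norm_axis_shift[of x "a * b" j] e0 by simp
    qed
  qed (intro continuous_intros)
  then have "continuous_on {0..e0} (\<lambda>e. ?I e * 1)"
    using continuous_on_param_integral[OF _ compact_Icc sets_I01 integrable_I01_const[of 1],
        of "{0..e0}" "\<lambda>e s. pd i (pd j f) (x + (e * s) *\<^sub>R axis j 1)"]
    by (simp add: case_prod_beta')
  then have c: "continuous_on {0..e0} ?I" by simp
  have "(?I \<longlongrightarrow> ?I 0) (at 0 within {0..e0})"
    by (rule bspec[OF c[unfolded continuous_on]]) (use e0 in simp)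
  moreover have "?I 0 = pd i (pd j f) x" by simp
  ultimately have "(?I \<longlongrightarrow> pd i (pd j f) x) (at_right 0)"
    using e0 at_within_Icc_at_right[of 0 e0] by simp
  then have lim1: "((\<lambda>e. (pd i f (x + e *\<^sub>R axis j 1) - pd i f x) / e) \<longlongrightarrow> pd i (pd j f) x) (at_right 0)"
    by (rule Lim_transform_eventually)
       (use quot e0 in \<open>auto simp: eventually_at_right[of 0 e0] intro!: exI[of _ e0]\<close>)
  have "((\<lambda>e. (pd i f (x + e *\<^sub>R axis j 1) - pd i f x) / e) \<longlongrightarrow> pd j (pd i f) x) (at 0)"
    using Ck_has_pd[OF Ck_pd[OF f] x, of j] unfolding has_pd_def DERIV_def by simp
  then have "((\<lambda>e. (pd i f (x + e *\<^sub>R axis j 1) - pd i f x) / e) \<longlongrightarrow> pd j (pd i f) x) (at_right 0)"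
    by (rule filterlim_mono) (auto simp: at_within_le_at)
  with lim1 show ?thesis using tendsto_unique[OF trivial_limit_at_right_real] by blast
qed

section \<open>The Euler operator and dilation integrals\<close>

text \<open>Walk from \<open>x\<close> to \<open>y\<close> along the three axes: each leg changes
  one coordinate, and the mean value inequality compares its increment with
  \<open>h $ i * pd i f x\<close>. The total derivative serves the chain rule along rays.\<close>

lemma Ck_has_derivative:
  assumes f: "Ck (Suc k) R f" and x: "norm x < R"
  shows "(f has_derivative (\<lambda>h. \<Sum>i\<in>UNIV. h $ i * pd i f x)) (at x)"
proof (rule has_derivativeI_sandwich[where e=1 and H="\<lambda>y. norm (f y - f x - (\<Sum>i\<in>UNIV. (y - x) $ i * pd i f x)) / norm (y - x)"])
  show "bounded_linear (\<lambda>h. \<Sum>i\<in>UNIV. h $ i * pd i f x)"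
    by (intro bounded_linear_sum bounded_linear_mult_const bounded_linear_vec_nth)
  have "\<exists>d>0. \<forall>y. y \<noteq> x \<and> norm (y - x) < d \<longrightarrow>
      norm (norm (f y - f x - (\<Sum>i\<in>UNIV. (y - x) $ i * pd i f x)) / norm (y - x) - 0) < e" if e: "e > 0" for e :: real
  proof -
    \<comment> \<open>Three legs contribute at most three times \<open>e'\<close>, strictly below
      \<open>e\<close>.\<close>
    define e' where "e' = e / 4"
    have e': "e' > 0" using e by (simp add: e'_def)
    have "\<exists>d>0. \<forall>y. norm (y - x) < d \<longrightarrow> norm y < R \<and> \<bar>pd i f y - pd i f x\<bar> \<le> e'" for i
    proof -
      have "isCont (pd i f) x"
        using Ck_continuous[OF Ck_pd[OF f, of i]] x by (simp add: continuous_on_eq_continuous_at)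
      then obtain d1 where d1: "d1 > 0" "\<And>y. dist y x < d1 \<Longrightarrow> dist (pd i f y) (pd i f x) < e'"
        using e' by (auto simp: continuous_at_eps_delta dist_norm)
      show ?thesis
      proof (intro exI[of _ "min d1 (R - norm x)"] conjI allI impI)
        fix y assume y: "norm (y - x) < min d1 (R - norm x)"
        then show "norm y < R" using norm_triangle_ineq2[of y x] by simp
        show "\<bar>pd i f y - pd i f x\<bar> \<le> e'" using d1(2)[of y] y by (simp add: dist_norm)
      qed (use d1 x in auto)
    qed
    then obtain d where d: "\<And>i. d i > 0"
      "\<And>i y. norm (y - x) < d i \<Longrightarrow> norm y < R \<and> \<bar>pd i f y - pd i f x\<bar> \<le> e'" by metis
    define d0 where "d0 = Min (range d)"
    have d0: "d0 > 0" "\<And>i. d0 \<le> d i" using d(1) by (auto simp: d0_def)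
    have near: "norm y < R" "\<bar>pd i f y - pd i f x\<bar> \<le> e'" if "norm (y - x) < d0" for i y
      using d(2)[of y i] d0(2)[of i] that by auto
    \<comment> \<open>The condition \<open>0 \<le> s * h\<close> confines \<open>s\<close> to the
      segment between 0 and \<open>h\<close> for either sign of \<open>h\<close>.\<close>
    have step: "\<bar>f (p + h *\<^sub>R axis i 1) - f p - h * pd i f x\<bar> \<le> e' * \<bar>h\<bar>"
      if seg: "\<And>s. \<bar>s\<bar> \<le> \<bar>h\<bar> \<Longrightarrow> 0 \<le> s * h \<Longrightarrow> norm (p + s *\<^sub>R axis i 1 - x) < d0" for p h i
    proof -
      let ?\<phi> = "\<lambda>t. f (p + t *\<^sub>R axis i 1) - t * pd i f x"
      let ?S = "closed_segment 0 h"
      have inS: "\<bar>s\<bar> \<le> \<bar>h\<bar> \<and> 0 \<le> s * h" if "s \<in> ?S" for s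
      proof -
        obtain u where u: "0 \<le> u" "u \<le> 1" "s = u * h" using \<open>s \<in> ?S\<close> by (auto simp: closed_segment_def)
        then show ?thesis by (simp add: abs_mult mult_left_le_one_le mult.assoc)
      qed
      have "norm (?\<phi> h - ?\<phi> 0) \<le> e' * norm (h - 0)"
      proof (rule field_differentiable_bound[where S="?S" and f'="\<lambda>t. pd i f (p + t *\<^sub>R axis i 1) - pd i f x"])
        fix s assume s: "s \<in> ?S"
        have n: "norm (p + s *\<^sub>R axis i 1 - x) < d0" using seg inS[OF s] by blast
        have "((\<lambda>t. f (p + t *\<^sub>R axis i 1)) has_real_derivative pd i f (p + s *\<^sub>R axis i 1)) (at s within ?S)"
          by (rule DERIV_subset[OF has_pd_line[OF Ck_has_pd[OF f near(1)[OF n]]]]) simp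
        then show "(?\<phi> has_real_derivative pd i f (p + s *\<^sub>R axis i 1) - pd i f x) (at s within ?S)"
          by (auto intro!: derivative_eq_intros)
        show "norm (pd i f (p + s *\<^sub>R axis i 1) - pd i f x) \<le> e'" using near(2)[OF n] by simp
      qed auto
      then show ?thesis by simp
    qed
    show ?thesis
    proof (intro exI[of _ d0] conjI allI impI d0(1))
      fix y assume y: "y \<noteq> x \<and> norm (y - x) < d0"
      define h where "h = y - x"
      define p1 where "p1 = x + (h $ 1) *\<^sub>R axis 1 (1::real)"
      define p2 where "p2 = p1 + (h $ 2) *\<^sub>R axis 2 (1::real)"
      have y3: "y = p2 + (h $ 3) *\<^sub>R axis 3 (1::real)"
        unfolding p2_def p1_def by (simp add: vec_eq_iff forall_3 h_def axis_def)
      have small: "norm (v :: R3) < d0" if "\<And>i. \<bar>v $ i\<bar> \<le> \<bar>h $ i\<bar>" for v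
      proof -
        have "norm v \<le> norm h" by (rule norm_le_componentwise_cart) (use that in simp)
        then show ?thesis using y by (simp add: h_def)
      qed
      have "\<bar>f p1 - f x - h $ 1 * pd 1 f x\<bar> \<le> e' * \<bar>h $ 1\<bar>"
        unfolding p1_def by (rule step, rule small) (auto simp: forall_3 axis_def)
      moreover have "\<bar>f p2 - f p1 - h $ 2 * pd 2 f x\<bar> \<le> e' * \<bar>h $ 2\<bar>"
        unfolding p2_def by (rule step, rule small) (auto simp: forall_3 axis_def p1_def)
      moreover have "\<bar>f y - f p2 - h $ 3 * pd 3 f x\<bar> \<le> e' * \<bar>h $ 3\<bar>"
        unfolding y3 by (rule step, rule small) (auto simp: forall_3 axis_def p1_def p2_def)
      moreover have "e' * \<bar>h $ i\<bar> \<le> e' * norm h" for i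
        using component_le_norm_cart[of h i] e' by (simp add: mult_left_mono)
      ultimately have "\<bar>f y - f x - (\<Sum>i\<in>UNIV. h $ i * pd i f x)\<bar> \<le> 3 * (e' * norm h)"
        unfolding sum_3 by (smt (verit))
      also have "\<dots> < e * norm h" using e y by (simp add: e'_def h_def)
      finally have "\<bar>f y - f x - (\<Sum>i\<in>UNIV. h $ i * pd i f x)\<bar> / norm h < e"
        using y by (simp add: h_def divide_less_eq)
      then show "norm (norm (f y - f x - (\<Sum>i\<in>UNIV. (y - x) $ i * pd i f x)) / norm (y - x) - 0) < e"
        by (simp add: h_def)
    qed
  qed
  then show "((\<lambda>y. norm (f y - f x - (\<Sum>i\<in>UNIV. (y - x) $ i * pd i f x)) / norm (y - x)) \<longlongrightarrow> 0) (at x)"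
    by (intro LIM_I) blast
qed auto

definition euler :: "(R3 \<Rightarrow> real) \<Rightarrow> R3 \<Rightarrow> real" where
  "euler f x = (\<Sum>k\<in>UNIV. x $ k * pd k f x)"

lemma radial_derivative:
  assumes f: "Ck (Suc k) R f" and x: "norm (t *\<^sub>R x) < R"
  shows "((\<lambda>t. f (t *\<^sub>R x)) has_real_derivative (\<Sum>i\<in>UNIV. x $ i * pd i f (t *\<^sub>R x))) (at t)"
proof -
  have "((\<lambda>t. f (t *\<^sub>R x)) has_derivative (\<lambda>s. \<Sum>i\<in>UNIV. (s *\<^sub>R x) $ i * pd i f (t *\<^sub>R x))) (at t)"
    by (rule has_derivative_compose[of "\<lambda>t. t *\<^sub>R x" "\<lambda>s. s *\<^sub>R x" t UNIV f, OF _ Ck_has_derivative[OF f x]])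
       (auto intro!: derivative_eq_intros)
  then show ?thesis
    by (rule has_derivative_imp_has_field_derivative) (simp add: sum_distrib_left mult_ac)
qed

text \<open>On a function homogeneous of degree m this acts as multiplication by 1 / (m + 1 -
  a).\<close>

definition Aop :: "real \<Rightarrow> (R3 \<Rightarrow> real) \<Rightarrow> R3 \<Rightarrow> real" where
  "Aop a f x = (\<integral>t. f (t *\<^sub>R x) * t powr (- a) \<partial>I01)"

lemma norm_scale_less: "norm x < R \<Longrightarrow> 0 \<le> t \<Longrightarrow> t \<le> 1 \<Longrightarrow> norm (t *\<^sub>R x) < R"
  for x :: "'a::real_normed_vector"
  by (metis abs_of_nonneg mult_left_le_one_le norm_ge_zero norm_scaleR order_le_less_trans)

lemma CkP_dilate: "Ck k R f \<Longrightarrow> CkP k R {0..1} (\<lambda>x t. f (t *\<^sub>R x))"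
  using Ck_affine[of k R f "{0..1}" "\<lambda>t. t" "\<lambda>_. 0" R] by (auto simp: norm_scale_less continuous_intros simp del: norm_scaleR)

lemma Ck_Aop: "Ck k R f \<Longrightarrow> a < 1 \<Longrightarrow> Ck k R (Aop a f)"
  unfolding Aop_def by (rule Ck_param_integral[OF CkP_dilate compact_Icc sets_I01 integrable_I01_powr])

text \<open>Differentiating the dilate \<open>f (t x)\<close> brings out a factor \<open>t\<close>,
  which lowers the exponent \<open>a\<close> of the weight by one.\<close>

lemma pd_Aop:
  assumes f: "Ck (Suc k) R f" and a: "a < 1" and x: "norm x < R"
  shows "pd i (Aop a f) x = Aop (a - 1) (pd i f) x"
proof -
  have "pd i (\<lambda>y. f (t *\<^sub>R y)) x * t powr - a = pd i f (t *\<^sub>R x) * t powr (- (a - 1))" if "t \<in> {0..1}" for t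
  proof -
    have "has_pd i (\<lambda>y. f (t *\<^sub>R y + 0)) (t * pd i f (t *\<^sub>R x)) x"
      by (rule has_pd_affine) (use Ck_has_pd[OF f norm_scale_less[OF x]] that in simp)
    from has_pd_imp_pd[OF this] have "pd i (\<lambda>y. f (t *\<^sub>R y)) x = t * pd i f (t *\<^sub>R x)" by simp
    \<comment> \<open>At \<open>t = 0\<close> both sides vanish, since \<open>powr\<close> has the
      value 0 at base 0.\<close>
    moreover have "t * t powr - a = t powr (- (a - 1))"
      using that powr_add[of t 1 "-a"] by (cases "t = 0") auto
    ultimately show ?thesis by (metis mult.commute mult.left_commute)
  qed
  then show ?thesis
    unfolding Aop_def pd_param_integral[OF CkP_dilate[OF f] compact_Icc sets_I01 integrable_I01_powr[OF a] x]
    by (intro Bochner_Integration.integral_cong) (auto simp: space_I01)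
qed

lemma integrable_Aop: "Ck k R f \<Longrightarrow> a < 1 \<Longrightarrow> norm x < R \<Longrightarrow> integrable I01 (\<lambda>t. f (t *\<^sub>R x) * t powr - a)"
  by (intro integrable_continuous_mult[OF _ compact_Icc sets_I01 integrable_I01_powr]
      continuous_on_compose2[OF Ck_continuous])
     (auto intro!: continuous_intros simp: norm_scale_less simp del: norm_scaleR)

lemma Aop_cong: "norm x < R \<Longrightarrow> (\<And>y. norm y < R \<Longrightarrow> f y = g y) \<Longrightarrow> Aop a f x = Aop a g x"
  unfolding Aop_def by (intro Bochner_Integration.integral_cong)
    (auto simp: space_I01 norm_scale_less simp del: norm_scaleR)

lemma Aop_add: "Ck k R f \<Longrightarrow> Ck l R g \<Longrightarrow> a < 1 \<Longrightarrow> norm x < R \<Longrightarrow>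
    Aop a (\<lambda>y. f y + g y) x = Aop a f x + Aop a g x"
  unfolding Aop_def by (simp add: distrib_right integrable_Aop)

lemma Aop_cmult: "Aop a (\<lambda>y. c * f y) x = c * Aop a f x"
  unfolding Aop_def by (simp add: mult.assoc)

lemma Aop_sum:
  "finite A \<Longrightarrow> (\<And>j. j \<in> A \<Longrightarrow> Ck k R (f j)) \<Longrightarrow> a < 1 \<Longrightarrow> norm x < R \<Longrightarrow>
    Aop a (\<lambda>y. \<Sum>j\<in>A. f j y) x = (\<Sum>j\<in>A. Aop a (f j) x)"
  unfolding Aop_def sum_distrib_right by (intro Bochner_Integration.integral_sum) (auto intro: integrable_Aop)

lemma Ck_euler: "Ck (Suc k) R f \<Longrightarrow> Ck k R (euler f)"
  unfolding euler_def by (intro Ck_sum Ck_mult Ck_coord) (rule Ck_pd)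

text \<open>Integrating \<open>d/dt (t powr (1 - a) * f (t x))\<close> over \<open>[0, 1]\<close> shows that \<open>Aop a\<close> inverts
  \<open>euler + (1 - a)\<close>.\<close>

lemma Aop_euler:
  assumes f: "Ck (Suc k) R f" and a: "a < 1" and x: "norm x < R"
  shows "Aop a (euler f) x + (1 - a) * Aop a f x = f x"
proof -
  let ?F = "\<lambda>t. t powr (1 - a) * f (t *\<^sub>R x)"
  let ?F' = "\<lambda>t. euler f (t *\<^sub>R x) * t powr - a + (1 - a) * (f (t *\<^sub>R x) * t powr - a)"
  note i1 = integrable_Aop[OF Ck_euler[OF f] a x] and i2 = integrable_Aop[OF f a x]
  have "(\<integral>t. ?F' t \<partial>I01) = ?F 1 - ?F 0"
  proof (rule integral_I01_FTC)
    have "continuous_on {0..1} (\<lambda>t. f (t *\<^sub>R x))"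
      by (rule continuous_on_compose2[OF Ck_continuous[OF f]])
         (auto intro!: continuous_intros simp: norm_scale_less[OF x] simp del: norm_scaleR)
    then show "continuous_on {0..1} ?F"
      using a by (intro continuous_intros continuous_on_powr') auto
    show "(?F has_real_derivative ?F' t) (at t)" if t: "t \<in> {0<..<1}" for t
    proof -
      have "((\<lambda>t. f (t *\<^sub>R x)) has_real_derivative (\<Sum>i\<in>UNIV. x $ i * pd i f (t *\<^sub>R x))) (at t)"
        by (rule radial_derivative[OF f]) (use t norm_scale_less[OF x] in auto)
      moreover have "((\<lambda>t. t powr (1 - a)) has_real_derivative (1 - a) * t powr (1 - a - 1)) (at t)"
        using t by (auto intro!: derivative_eq_intros)
      ultimately have "(?F has_real_derivative t powr (1 - a) * (\<Sum>i\<in>UNIV. x $ i * pd i f (t *\<^sub>R x)) +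
          (1 - a) * t powr (1 - a - 1) * f (t *\<^sub>R x)) (at t)"
        using DERIV_mult'[of "\<lambda>t. t powr (1 - a)"] by blast
      moreover have "t powr (1 - a) = t * t powr - a" using t powr_add[of t 1 "-a"] by simp
      moreover have "euler f (t *\<^sub>R x) = t * (\<Sum>i\<in>UNIV. x $ i * pd i f (t *\<^sub>R x))"
        unfolding euler_def by (simp add: sum_distrib_left mult.assoc)
      ultimately show ?thesis by (simp add: algebra_simps)
    qed
    show "integrable I01 ?F'" using i1 i2 by auto
  qed
  then show ?thesis unfolding Aop_def using i1 i2 by simp
qed

text \<open>The factor \<open>t\<close> produced by differentiation turns \<open>x $ k\<close> into
  the k-th coordinate of \<open>t x\<close>, so \<open>euler\<close> passes inside the integral and
  the preceding identity applies.\<close>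

lemma euler_Aop:
  assumes f: "Ck (Suc k) R f" and a: "a < 1" and x: "norm x < R"
  shows "euler (Aop a f) x + (1 - a) * Aop a f x = f x"
proof -
  have "euler (Aop a f) x = (\<Sum>k\<in>UNIV. x $ k * Aop (a - 1) (pd k f) x)"
    unfolding euler_def using pd_Aop[OF assms] by simp
  also have "\<dots> = (\<Sum>k\<in>UNIV. \<integral>t. (t *\<^sub>R x) $ k * pd k f (t *\<^sub>R x) * t powr - a \<partial>I01)"
  proof (rule sum.cong[OF refl])
    fix k
    have "x $ k * Aop (a - 1) (pd k f) x = (\<integral>t. x $ k * (pd k f (t *\<^sub>R x) * t powr - (a - 1)) \<partial>I01)"
      unfolding Aop_def by simp
    also have "\<dots> = (\<integral>t. (t *\<^sub>R x) $ k * pd k f (t *\<^sub>R x) * t powr - a \<partial>I01)"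
    proof (rule Bochner_Integration.integral_cong[OF refl])
      fix t assume "t \<in> space I01"
      then have "t powr - (a - 1) = t * t powr - a"
        using powr_add[of t 1 "-a"] by (cases "t = 0") (auto simp: space_I01)
      then show "x $ k * (pd k f (t *\<^sub>R x) * t powr - (a - 1)) = (t *\<^sub>R x) $ k * pd k f (t *\<^sub>R x) * t powr - a"
        by simp
    qed
    finally show "x $ k * Aop (a - 1) (pd k f) x = (\<integral>t. (t *\<^sub>R x) $ k * pd k f (t *\<^sub>R x) * t powr - a \<partial>I01)" .
  qed
  also have "\<dots> = Aop a (euler f) x"
    unfolding Aop_def euler_def sum_distrib_right
    by (intro Bochner_Integration.integral_sum[symmetric] integrable_Aop[OF Ck_mult[OF Ck_coord Ck_pd[OF f]] a x])
  finally show ?thesis using Aop_euler[OF assms] by simp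
qed

section \<open>The Laplacian and its commutation rules\<close>

definition lap :: "(R3 \<Rightarrow> real) \<Rightarrow> R3 \<Rightarrow> real" where
  "lap f x = (\<Sum>i\<in>UNIV. pd i (pd i f) x)"

lemma pd_cong_ball: "(\<And>y. norm y < R \<Longrightarrow> f y = g y) \<Longrightarrow> norm x < R \<Longrightarrow> pd i f x = pd i g x"
  for f g :: "R3 \<Rightarrow> 'b::real_normed_vector"
  by (rule pd_cong[of "ball 0 R"]) auto

lemma lap_cong: "(\<And>y. norm y < R \<Longrightarrow> f y = g y) \<Longrightarrow> norm x < R \<Longrightarrow> lap f x = lap g x"
  unfolding lap_def by (intro sum.cong refl pd_cong_ball[of R "pd _ f"] pd_cong_ball[of R f])

lemma pd_pd_Aop:
  assumes f: "Ck (Suc (Suc k)) R f" and a: "a < 1" and x: "norm x < R"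
  shows "pd i (pd j (Aop a f)) x = Aop (a - 2) (pd i (pd j f)) x"
proof -
  have "pd i (pd j (Aop a f)) x = pd i (Aop (a - 1) (pd j f)) x"
    by (rule pd_cong_ball[OF pd_Aop[OF f a] x])
  also have "\<dots> = Aop (a - 1 - 1) (pd i (pd j f)) x"
    by (rule pd_Aop[OF Ck_pd[OF f] _ x]) (use a in simp)
  finally show ?thesis by simp
qed

text \<open>In particular dilation integrals of harmonic functions are harmonic.\<close>

lemma lap_Aop:
  assumes f: "Ck (Suc (Suc k)) R f" and a: "a < 1" and x: "norm x < R"
  shows "lap (Aop a f) x = Aop (a - 2) (lap f) x"
  unfolding lap_def pd_pd_Aop[OF assms]
  using a by (intro Aop_sum[symmetric, of _ k R _ _ x] Ck_pd f x) auto

lemma pd_add: "Ck (Suc k) R f \<Longrightarrow> Ck (Suc l) R g \<Longrightarrow> norm x < R \<Longrightarrow> pd i (\<lambda>x. f x + g x) x = pd i f x + pd i g x"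
  by (intro has_pd_imp_pd has_pd_add Ck_has_pd)

lemma pd_cmult: "Ck (Suc k) R f \<Longrightarrow> norm x < R \<Longrightarrow> pd i (\<lambda>x. c * f x) x = c * pd i f x"
  by (intro has_pd_imp_pd has_pd_cmult Ck_has_pd)

lemma pd_sum: "(\<And>j. j \<in> A \<Longrightarrow> Ck (Suc k) R (f j)) \<Longrightarrow> norm x < R \<Longrightarrow>
    pd i (\<lambda>x. \<Sum>j\<in>A. f j x) x = (\<Sum>j\<in>A. pd i (f j) x)"
  by (intro has_pd_imp_pd has_pd_sum Ck_has_pd)

lemma lap_add:
  assumes f: "Ck (Suc (Suc k)) R f" and g: "Ck (Suc (Suc l)) R g" and x: "norm x < R"
  shows "lap (\<lambda>x. f x + g x) x = lap f x + lap g x"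
proof -
  have "pd i (pd i (\<lambda>x. f x + g x)) x = pd i (pd i f) x + pd i (pd i g) x" for i
    using pd_cong_ball[OF pd_add[OF f g] x] pd_add[OF Ck_pd[OF f] Ck_pd[OF g] x] by simp
  then show ?thesis by (simp add: lap_def sum.distrib)
qed

lemma lap_cmult:
  assumes f: "Ck (Suc (Suc k)) R f" and x: "norm x < R"
  shows "lap (\<lambda>x. c * f x) x = c * lap f x"
proof -
  have "pd i (pd i (\<lambda>x. c * f x)) x = c * pd i (pd i f) x" for i
    using pd_cong_ball[OF pd_cmult[OF f] x] pd_cmult[OF Ck_pd[OF f] x] by simp
  then show ?thesis by (simp add: lap_def sum_distrib_left)
qed

lemma lap_sum:
  assumes f: "\<And>j. j \<in> A \<Longrightarrow> Ck (Suc (Suc k)) R (f j)" and x: "norm x < R"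
  shows "lap (\<lambda>x. \<Sum>j\<in>A. f j x) x = (\<Sum>j\<in>A. lap (f j) x)"
proof -
  have "pd i (pd i (\<lambda>x. \<Sum>j\<in>A. f j x)) x = (\<Sum>j\<in>A. pd i (pd i (f j)) x)" for i
  proof -
    have "pd i (pd i (\<lambda>x. \<Sum>j\<in>A. f j x)) x = pd i (\<lambda>x. \<Sum>j\<in>A. pd i (f j) x) x"
      by (rule pd_cong_ball[OF _ x]) (rule pd_sum[OF f])
    also have "\<dots> = (\<Sum>j\<in>A. pd i (pd i (f j)) x)"
      by (rule pd_sum[OF Ck_pd[OF f] x])
    finally show ?thesis .
  qed
  then show ?thesis by (simp add: lap_def) (subst sum.swap, simp)
qed

lemma Ck_lap: "Ck (Suc (Suc k)) R f \<Longrightarrow> Ck k R (lap f)"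
  unfolding lap_def by (intro Ck_sum) (rule Ck_pd[OF Ck_pd])

lemma lap_pd:
  assumes f: "Ck (Suc (Suc (Suc k))) R f" and x: "norm x < R"
  shows "lap (pd j f) x = pd j (lap f) x"
proof -
  have "pd i (pd i (pd j f)) x = pd j (pd i (pd i f)) x" for i
  proof -
    have "pd i (pd i (pd j f)) x = pd i (pd j (pd i f)) x"
      by (rule pd_cong_ball[OF _ x]) (rule pd_commute[OF f])
    also have "\<dots> = pd j (pd i (pd i f)) x" by (rule pd_commute[OF Ck_pd[OF f] x])
    finally show ?thesis .
  qed
  moreover have "pd j (lap f) x = (\<Sum>i\<in>UNIV. pd j (pd i (pd i f)) x)"
    unfolding lap_def by (rule pd_sum[OF Ck_pd[OF Ck_pd[OF f]] x])
  ultimately show ?thesis by (simp add: lap_def)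
qed

lemma Ck_normsq: "Ck k R (\<lambda>x. 1 - norm x ^ 2)"
proof -
  have "norm x ^ 2 = (\<Sum>i\<in>UNIV. x $ i * x $ i)" for x :: R3
    by (simp add: power2_norm_eq_inner inner_vec_def)
  then show ?thesis by (auto intro!: Ck_diff Ck_const Ck_sum Ck_mult Ck_coord)
qed

lemma has_pd_normsq: "has_pd i (\<lambda>x. 1 - norm x ^ 2) (- 2 * x $ i) x"
proof -
  have e: "norm y ^ 2 = (\<Sum>i\<in>UNIV. y $ i * y $ i)" for y :: R3
    by (simp add: power2_norm_eq_inner inner_vec_def)
  have "has_pd i (\<lambda>x. 1 - norm x ^ 2) (0 - (\<Sum>k\<in>UNIV. x $ k * (if i = k then 1 else 0) + (if i = k then 1 else 0) * x $ k)) x"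
    unfolding e by (intro has_pd_diff has_pd_const has_pd_sum has_pd_mult has_pd_coord)
  moreover have "0 - (\<Sum>k\<in>UNIV. x $ k * (if i = k then 1 else 0) + (if i = k then 1 else 0) * x $ k) = - 2 * x $ i"
    using exhaust_3[of i] by (auto simp: sum_3)
  ultimately show ?thesis by metis
qed

lemma pd_normsq_mult:
  assumes h: "Ck (Suc k) R h" and x: "norm x < R"
  shows "pd i (\<lambda>x. (1 - norm x ^ 2) * h x) x = (1 - norm x ^ 2) * pd i h x - 2 * (x $ i * h x)"
  using has_pd_imp_pd[OF has_pd_mult[OF has_pd_normsq Ck_has_pd[OF h x]]] by simp

text \<open>The Leibniz terms are the Laplacian of the factor, -6 in dimension three, and twice the
  product of the gradients, which is -4 times the Euler operator.\<close>

lemma lap_normsq_mult: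
  assumes h: "Ck (Suc (Suc k)) R h" and x: "norm x < R"
  shows "lap (\<lambda>x. (1 - norm x ^ 2) * h x) x = (1 - norm x ^ 2) * lap h x - 6 * h x - 4 * euler h x"
proof -
  have "pd i (pd i (\<lambda>x. (1 - norm x ^ 2) * h x)) x =
     (1 - norm x ^ 2) * pd i (pd i h) x - 4 * (x $ i * pd i h x) - 2 * h x" for i
  proof -
    have "pd i (pd i (\<lambda>x. (1 - norm x ^ 2) * h x)) x =
       pd i (\<lambda>x. (1 - norm x ^ 2) * pd i h x - 2 * (x $ i * h x)) x"
      by (rule pd_cong_ball[OF pd_normsq_mult[OF h] x])
    also have "\<dots> = ((1 - norm x ^ 2) * pd i (pd i h) x + (- 2 * x $ i) * pd i h x)
        - 2 * (x $ i * pd i h x + (if i = i then 1 else 0) * h x)"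
      by (intro has_pd_imp_pd has_pd_diff has_pd_cmult has_pd_mult has_pd_normsq has_pd_coord
          Ck_has_pd[OF Ck_pd[OF h] x] Ck_has_pd[OF h x])
    finally show ?thesis by simp
  qed
  then show ?thesis
    by (simp only: lap_def euler_def sum_3) (simp add: algebra_simps)
qed

text \<open>Differentiating the coefficient \<open>x $ j\<close> of the Euler operator leaves one
  extra \<open>pd j h\<close>. This commutator turns \<open>2 * euler f + f\<close> into
  \<open>3 * pd j f + 2 * euler (pd j f)\<close> in the Lame computations.\<close>

lemma pd_euler:
  assumes h: "Ck (Suc (Suc k)) R h" and x: "norm x < R"
  shows "pd j (euler h) x = pd j h x + euler (pd j h) x"
proof -
  have "pd j (euler h) x = (\<Sum>k\<in>UNIV. x $ k * pd j (pd k h) x + (if j = k then 1 else 0) * pd k h x)"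
    unfolding euler_def
    by (intro has_pd_imp_pd has_pd_sum has_pd_mult has_pd_coord Ck_has_pd[OF Ck_pd[OF h] x])
  also have "\<dots> = pd j h x + (\<Sum>k\<in>UNIV. x $ k * pd j (pd k h) x)"
    by (simp add: sum.distrib if_distrib[of "\<lambda>c. c * _"] cong: if_cong)
  also have "\<dots> = pd j h x + euler (pd j h) x"
    unfolding euler_def using pd_commute[OF h x] by simp
  finally show ?thesis .
qed

section \<open>Maximum principle and surface measure\<close>

text \<open>A positive second derivative would make \<open>g'\<close> positive just to the right of
  the critical point 0, and the mean value theorem would then give a value above the
  maximum.\<close>

lemma second_derivative_nonpos_at_local_max:
  fixes g g' :: "real \<Rightarrow> real"
  assumes d: "d > 0" and g: "\<And>t. \<bar>t\<bar> < d \<Longrightarrow> (g has_real_derivative g' t) (at t)"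
    and g': "(g' has_real_derivative m) (at 0)" and le: "\<And>t. \<bar>t\<bar> < d \<Longrightarrow> g t \<le> g 0"
  shows "m \<le> 0"
proof (rule ccontr)
  assume "\<not> m \<le> 0"
  then obtain d' where d': "d' > 0" "\<And>h. h > 0 \<Longrightarrow> h < d' \<Longrightarrow> g' 0 < g' (0 + h)"
    using DERIV_pos_inc_right[OF g'] by auto
  have g0: "g' 0 = 0"
    by (rule DERIV_local_max[OF g d]) (use d le in auto)
  define h where "h = min d d' / 2"
  have h: "h > 0" "h < d" "h < d'" using d d'(1) by (auto simp: h_def)
  have "\<exists>z>0. z < h \<and> g h - g 0 = (h - 0) * g' z"
    by (rule MVT2[OF h(1)]) (use h g in auto)
  then obtain z where z: "0 < z" "z < h" "g h - g 0 = h * g' z" by auto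
  then have "g' z > 0" using d'(2)[of z] h g0 by auto
  then have "g h > g 0" using z(3) mult_pos_pos[OF h(1), of "g' z"] by linarith
  then show False using le[of h] h by simp
qed

lemma lap_nonpos_at_max:
  assumes f: "Ck (Suc (Suc k)) R f" and x: "norm x < R" and m: "\<And>y. norm y < R \<Longrightarrow> f y \<le> f x"
  shows "lap f x \<le> 0"
proof -
  have "pd i (pd i f) x \<le> 0" for i
  proof (rule second_derivative_nonpos_at_local_max)
    show "R - norm x > 0" using x by simp
    fix t assume "\<bar>t\<bar> < R - norm x"
    then have n: "norm (x + t *\<^sub>R axis i 1) < R" using norm_axis_shift[of x t i] by simp
    show "((\<lambda>t. f (x + t *\<^sub>R axis i 1)) has_real_derivative pd i f (x + t *\<^sub>R axis i 1)) (at t)"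
      by (rule has_pd_line[OF Ck_has_pd[OF f n]])
    show "f (x + t *\<^sub>R axis i 1) \<le> f (x + 0 *\<^sub>R axis i 1)" using m[OF n] by simp
  next
    show "((\<lambda>t. pd i f (x + t *\<^sub>R axis i 1)) has_real_derivative pd i (pd i f) x) (at 0)"
      using Ck_has_pd[OF Ck_pd[OF f] x, of i] unfolding has_pd_def by simp
  qed
  then show ?thesis unfolding lap_def by (simp add: sum_nonpos)
qed

text \<open>Adding \<open>e * (norm x ^ 2 - 1)\<close> makes the Laplacian equal to
  \<open>6 * e > 0\<close>, which excludes an interior maximum; for small \<open>e\<close> the
  perturbed function at \<open>x0\<close> still exceeds all its boundary values.\<close>

lemma weak_max_principle:
  assumes f: "Ck (Suc (Suc k)) R f" and c: "continuous_on (cball 0 R) f"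
    and lap: "\<And>x. norm x < R \<Longrightarrow> lap f x = 0" and bd: "\<And>x. norm x = R \<Longrightarrow> f x \<le> 0"
    and x0: "norm x0 \<le> R"
  shows "f x0 \<le> 0"
proof (rule ccontr)
  assume neg: "\<not> f x0 \<le> 0"
  \<comment> \<open>Chosen so that \<open>e * R^2 < f x0\<close>; the 1 added to \<open>R^2\<close>
    keeps the denominator positive for \<open>R = 0\<close>.\<close>
  define e where "e = f x0 / (2 * (R^2 + 1))"
  have e: "e > 0" "e * R^2 < f x0"
    using neg by (auto simp: e_def field_simps add_pos_nonneg)
  define w where "w = (\<lambda>x. f x + (1 - norm x ^ 2) * (- e))"
  have cw: "continuous_on (cball 0 R) w" unfolding w_def by (intro continuous_intros c)
  have "cball 0 R \<noteq> ({} :: R3 set)" using x0 norm_ge_zero[of x0] by (simp del: norm_ge_zero)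
  then obtain y where y: "y \<in> cball 0 R" "\<And>z. z \<in> cball 0 R \<Longrightarrow> w z \<le> w y"
    using continuous_attains_sup[OF compact_cball _ cw] by blast
  have "0 \<le> e * norm x0 ^ 2" using e by simp
  then have "w x0 > e * R^2 - e" using e(2) by (simp add: w_def algebra_simps)
  with y(2)[of x0] x0 have wy: "w y > e * R^2 - e" by simp
  have "norm y \<noteq> R"
  proof
    assume "norm y = R"
    then have "w y \<le> e * R^2 - e" using bd[of y] by (simp add: w_def algebra_simps)
    then show False using wy by simp
  qed
  then have yR: "norm y < R" using y(1) by simp
  note Cc = Ck_const[of "Suc (Suc k)" R "-e"]
  have Cw: "Ck (Suc (Suc k)) R w" unfolding w_def by (intro Ck_add f Ck_mult Ck_normsq Ck_const)
  have "lap w y = lap f y + lap (\<lambda>x. (1 - norm x ^ 2) * (- e)) y"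
    unfolding w_def by (intro lap_add[OF f _ yR] Ck_mult Ck_normsq Ck_const)
  also have "lap (\<lambda>x. (1 - norm x ^ 2) * (- e)) y = 6 * e"
  proof -
    have z: "pd i (\<lambda>_. c) = (\<lambda>_. 0::real)" for i and c :: real
      using has_pd_imp_pd[OF has_pd_const] by (intro ext) simp
    show ?thesis
      by (subst lap_normsq_mult[OF Cc yR]) (simp add: lap_def euler_def z)
  qed
  finally have "lap w y > 0" using lap[OF yR] e by simp
  moreover have "lap w y \<le> 0"
    by (rule lap_nonpos_at_max[OF Cw yR]) (use y(2) in auto)
  ultimately show False by simp
qed

lemma harmonic_unique:
  assumes f: "Ck (Suc (Suc k)) R f" "continuous_on (cball 0 R) f" "\<And>x. norm x < R \<Longrightarrow> lap f x = 0"
    and g: "Ck (Suc (Suc k)) R g" "continuous_on (cball 0 R) g" "\<And>x. norm x < R \<Longrightarrow> lap g x = 0"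
    and eq: "\<And>x. norm x = R \<Longrightarrow> f x = g x" and x: "norm x \<le> R"
  shows "f x = g x"
proof -
  have *: "f x - g x \<le> 0" if f: "Ck (Suc (Suc k)) R f" "continuous_on (cball 0 R) f" "\<And>x. norm x < R \<Longrightarrow> lap f x = 0"
    and g: "Ck (Suc (Suc k)) R g" "continuous_on (cball 0 R) g" "\<And>x. norm x < R \<Longrightarrow> lap g x = 0"
    and eq: "\<And>x. norm x = R \<Longrightarrow> f x = g x" for f g
  proof -
    have "f x + (- 1) * g x \<le> 0"
    proof (rule weak_max_principle[OF _ _ _ _ x, of k "\<lambda>x. f x + (- 1) * g x"])
      show "Ck (Suc (Suc k)) R (\<lambda>x. f x + (- 1) * g x)" by (intro Ck_add Ck_cmult f g)
      show "continuous_on (cball 0 R) (\<lambda>x. f x + (- 1) * g x)" by (intro continuous_intros f g)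
      show "lap (\<lambda>x. f x + (- 1) * g x) x = 0" if "norm x < R" for x
        using lap_add[OF f(1) Ck_cmult[OF g(1), of "-1"] that] lap_cmult[OF g(1) that, of "-1"] f(3)[OF that] g(3)[OF that]
        by simp
    qed (use eq in auto)
    then show ?thesis by simp
  qed
  show ?thesis using *[OF f g eq] *[OF g f eq[symmetric]] by simp
qed

section \<open>Surface measure and its invariance under rotations\<close>

definition solid_cone :: "R3 set \<Rightarrow> R3 set" where
  "solid_cone A = {r *\<^sub>R w | r w. r \<in> {0<..1} \<and> w \<in> A}"

abbreviation "S2 \<equiv> sphere (0::R3) 1"

lemma mem_cone_iff:
  assumes "A \<subseteq> S2" shows "x \<in> solid_cone A \<longleftrightarrow> x \<noteq> 0 \<and> norm x \<le> 1 \<and> x /\<^sub>R norm x \<in> A"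
proof
  assume "x \<in> solid_cone A"
  then obtain r w where rw: "x = r *\<^sub>R w" "0 < r" "r \<le> 1" "w \<in> A" by (auto simp: solid_cone_def)
  then have "norm w = 1" using assms by auto
  then show "x \<noteq> 0 \<and> norm x \<le> 1 \<and> x /\<^sub>R norm x \<in> A" using rw by auto
next
  assume "x \<noteq> 0 \<and> norm x \<le> 1 \<and> x /\<^sub>R norm x \<in> A"
  then show "x \<in> solid_cone A" unfolding solid_cone_def
    by (intro CollectI exI[of _ "norm x"] exI[of _ "x /\<^sub>R norm x"]) auto
qed

lemma cone_subset: "A \<subseteq> S2 \<Longrightarrow> solid_cone A \<subseteq> cball 0 1 - {0}"
  using mem_cone_iff by fastforce

lemma vimage_normalise:
  assumes "A \<subseteq> S2"
  shows "(\<lambda>x. x /\<^sub>R norm x) -` A \<inter> space (restrict_space lborel (cball 0 1 - {0})) = solid_cone A"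
proof (rule set_eqI)
  fix x :: R3
  show "x \<in> (\<lambda>x. x /\<^sub>R norm x) -` A \<inter> space (restrict_space lborel (cball 0 1 - {0})) \<longleftrightarrow> x \<in> solid_cone A"
    unfolding mem_cone_iff[OF assms] by (simp add: space_restrict_space) blast
qed

lemma emeasure_restrict_solid_cone:
  assumes "A \<subseteq> S2"
  shows "emeasure (restrict_space lborel (cball 0 1 - {0})) (solid_cone A) = emeasure lborel (solid_cone A)"
  by (rule emeasure_restrict_space[OF _ cone_subset[OF assms]]) simp

lemma measurable_normalise:
  "(\<lambda>x. x /\<^sub>R norm x) \<in> measurable (restrict_space lborel (cball (0::R3) 1 - {0})) (restrict_space borel S2)"
proof (rule measurable_restrict_space2)
  have "(\<lambda>x::R3. x /\<^sub>R norm x) \<in> measurable lborel borel" by measurable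
  then show "(\<lambda>x::R3. x /\<^sub>R norm x) \<in> measurable (restrict_space lborel (cball (0::R3) 1 - {0})) borel"
    by (rule measurable_restrict_space1)
qed (auto simp: space_restrict_space)

text \<open>\<open>measure_of\<close> yields the zero measure unless its weight is countably
  additive. Writing the cone volume as an image of Lebesgue measure on the punctured ball under
  normalisation supplies the additivity.\<close>

lemma sphere_measure_eq:
  "sphere_measure = scale_measure 3 (distr (restrict_space lborel (cball 0 1 - {0})) (restrict_space borel S2)
     (\<lambda>x. x /\<^sub>R norm x))" (is "_ = ?N")
proof -
  note m = measurable_normalise
  have "?N = measure_of (space ?N) (sets ?N) (emeasure ?N)" by (rule measure_of_of_measure[symmetric])
  also have "space ?N = S2" by (rule space_eq_of_sets_restrict) simp
  also have "sets ?N = sets (restrict_space borel S2)" by simp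
  also have "measure_of S2 (sets (restrict_space borel S2)) (emeasure ?N) = sphere_measure"
    unfolding sphere_measure_def
  proof (rule measure_of_eq)
    show sub: "sets (restrict_space borel S2) \<subseteq> Pow S2"
      using sets.space_closed[of "restrict_space borel S2"] by (simp add: space_restrict_space)
    fix A assume "A \<in> sigma_sets S2 (sets (restrict_space borel S2))"
    then have A: "A \<in> sets (restrict_space borel S2)"
      using sets.sigma_sets_eq[of "restrict_space borel S2"] by (simp add: space_restrict_space)
    then have AS: "A \<subseteq> S2" using sub by auto
    have "emeasure ?N A = 3 * emeasure lborel (solid_cone A)"
      using emeasure_distr[OF m A] by (simp only: emeasure_scale_measure vimage_normalise[OF AS] emeasure_restrict_solid_cone[OF AS])
    then show "emeasure ?N A = 3 * emeasure lborel {r *\<^sub>R w | r w. r \<in> {0<..1} \<and> w \<in> A}"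
      by (simp add: solid_cone_def)
  qed
  finally show ?thesis by simp
qed

lemma sets_sphere_measure: "sets sphere_measure = sets (restrict_space borel S2)"
  unfolding sphere_measure_eq by simp

lemma space_sphere_measure: "space sphere_measure = S2"
  by (rule space_eq_of_sets_restrict[OF sets_sphere_measure])

lemma cone_measurable:
  assumes A: "A \<in> sets sphere_measure"
  shows "solid_cone A \<in> sets borel"
proof -
  have AS: "A \<subseteq> S2" using sets.sets_into_space[OF A] by (simp add: space_sphere_measure)
  have "(\<lambda>x. x /\<^sub>R norm x) -` A \<inter> space (restrict_space lborel (cball 0 1 - {0})) \<in> sets (restrict_space lborel (cball (0::R3) 1 - {0}))"
    by (rule measurable_sets[OF measurable_normalise]) (use A in \<open>simp add: sets_sphere_measure\<close>)
  then show ?thesis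
    unfolding vimage_normalise[OF AS]
    using sets_restrict_space_iff[of "cball (0::R3) 1 - {0}" lborel "solid_cone A"] by simp
qed

lemma emeasure_sphere_measure:
  assumes A: "A \<in> sets sphere_measure"
  shows "emeasure sphere_measure A = 3 * emeasure lborel (solid_cone A)"
proof -
  have AS: "A \<subseteq> S2" using sets.sets_into_space[OF A] by (simp add: space_sphere_measure)
  have "A \<in> sets (restrict_space borel S2)" using A by (simp add: sets_sphere_measure)
  from emeasure_distr[OF measurable_normalise this] show ?thesis
    unfolding sphere_measure_eq by (simp only: emeasure_scale_measure vimage_normalise[OF AS] emeasure_restrict_solid_cone[OF AS])
qed

lemma emeasure_sphere_measure_space: "emeasure sphere_measure S2 = ennreal (4 * pi)"
proof -
  have "S2 \<in> sets sphere_measure" using sets.top[of sphere_measure] by (simp add: space_sphere_measure)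
  then have "emeasure sphere_measure S2 = 3 * emeasure lborel (solid_cone S2)"
    by (rule emeasure_sphere_measure)
  also have "solid_cone S2 = cball 0 1 - {0}"
    by (auto simp: mem_cone_iff) (metis left_inverse norm_eq_zero)
  also have "emeasure lborel (cball 0 1 - {0::R3}) = emeasure lborel (cball (0::R3) 1)"
    by (rule emeasure_Diff_null_set) auto
  also have "emeasure lborel (cball (0::R3) 1) = ennreal (4 / 3 * pi)"
    by (simp add: emeasure_cball unit_ball_vol_3)
  also have "3 * ennreal (4 / 3 * pi) = ennreal (4 * pi)"
    using ennreal_mult[of 3 "4 / 3 * pi"] by simp
  finally show ?thesis .
qed

lemma finite_sphere_measure: "finite_measure sphere_measure"
  by (rule finite_measureI) (simp add: space_sphere_measure emeasure_sphere_measure_space)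

lemma measure_sphere_measure: "measure sphere_measure (space sphere_measure) = 4 * pi"
  by (simp add: measure_def space_sphere_measure emeasure_sphere_measure_space)

lemma integrable_sphere_const: "integrable sphere_measure (\<lambda>_. c :: real)"
  by (rule finite_measure.integrable_const[OF finite_sphere_measure])

lemma integrable_sphere_continuous:
  "continuous_on S2 f \<Longrightarrow> integrable sphere_measure (f :: R3 \<Rightarrow> real)"
  using integrable_continuous_mult[OF _ compact_sphere sets_sphere_measure integrable_sphere_const[of 1], of f] by simp

lemma measurable_continuous_sphere:
  fixes f :: "R3 \<Rightarrow> 'b::{metric_space,second_countable_topology}"
  shows "continuous_on S2 f \<Longrightarrow> f \<in> borel_measurable sphere_measure"
  by (rule measurable_continuous_on_sets[OF _ sets_sphere_measure])

text \<open>The solid cone over a preimage is the preimage of the solid cone, so the claim reduces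
  to the orthogonal invariance of Lebesgue volume.\<close>

lemma distr_sphere_measure_orthogonal:
  assumes T: "orthogonal_transformation (T :: R3 \<Rightarrow> R3)"
  shows "distr sphere_measure sphere_measure T = sphere_measure"
proof (rule measure_eqI)
  have lin: "linear T" using T by (rule orthogonal_transformation_linear)
  have nT: "norm (T x) = norm x" for x using T by (rule orthogonal_transformation_norm)
  have mT: "T \<in> borel_measurable borel"
    by (intro borel_measurable_continuous_onI linear_continuous_on linear_conv_bounded_linear[THEN iffD1] lin)
  have mS: "T \<in> measurable sphere_measure sphere_measure"
  proof -
    have "T \<in> measurable (restrict_space borel S2) (restrict_space borel S2)"
      by (intro measurable_restrict_space2 measurable_restrict_space1 mT) (auto simp: space_restrict_space nT)
    then show ?thesis using measurable_cong_sets[OF sets_sphere_measure sets_sphere_measure] by blast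
  qed
  fix A assume "A \<in> sets (distr sphere_measure sphere_measure T)"
  then have A: "A \<in> sets sphere_measure" by simp
  have AS: "A \<subseteq> S2" using sets.sets_into_space[OF A] by (simp add: space_sphere_measure)
  let ?B = "T -` A \<inter> space sphere_measure"
  have B: "?B \<in> sets sphere_measure" by (rule measurable_sets[OF mS A])
  have BS: "?B \<subseteq> S2" by (simp add: space_sphere_measure)
  have bij: "bij T" by (rule orthogonal_transformation_bij[OF T])
  have ce: "solid_cone ?B = inv T ` solid_cone A"
  proof -
    have "solid_cone ?B = T -` solid_cone A"
    proof (rule set_eqI)
      fix x
      have "T x = 0 \<longleftrightarrow> x = 0" by (metis nT norm_eq_zero)
      moreover have "T (x /\<^sub>R norm x) = T x /\<^sub>R norm (T x)" by (simp only: nT linear_scale[OF lin])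
      moreover have "x /\<^sub>R norm x \<in> space sphere_measure" if "x \<noteq> 0"
        using that by (simp add: space_sphere_measure)
      ultimately show "x \<in> solid_cone ?B \<longleftrightarrow> x \<in> T -` solid_cone A"
        unfolding mem_cone_iff[OF BS] vimage_eq mem_cone_iff[OF AS] by (auto simp only: nT Int_iff vimage_eq)
    qed
    then show ?thesis using bij_vimage_eq_inv_image[OF bij] by simp
  qed
  have bC: "bounded (solid_cone A)"
    by (rule bounded_subset[OF bounded_cball[of 0 1]]) (auto simp: mem_cone_iff[OF AS])
  have lC: "solid_cone A \<in> lmeasurable"
    by (rule bounded_set_imp_lmeasurable[OF bC]) (use cone_measurable[OF A] in auto)
  have "measure lebesgue (inv T ` solid_cone A) = measure lebesgue (solid_cone A)"
    by (rule measure_orthogonal_image[OF orthogonal_transformation_inv[OF T] lC])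
  moreover have iC: "inv T ` solid_cone A \<in> lmeasurable"
    by (rule measurable_orthogonal_image[OF orthogonal_transformation_inv[OF T] lC])
  ultimately have "emeasure lebesgue (solid_cone ?B) = emeasure lebesgue (solid_cone A)"
    unfolding ce emeasure_eq_measure2[OF lC] emeasure_eq_measure2[OF iC] by simp
  then have "emeasure lborel (solid_cone ?B) = emeasure lborel (solid_cone A)"
    using emeasure_completion[of "solid_cone A" lborel] emeasure_completion[of "solid_cone ?B" lborel]
      cone_measurable[OF A] cone_measurable[OF B] by simp
  then show "emeasure (distr sphere_measure sphere_measure T) A = emeasure sphere_measure A"
    using emeasure_distr[OF mS A] emeasure_sphere_measure[OF A] emeasure_sphere_measure[OF B] by simp
qed simp

lemma integral_sphere_orthogonal:
  assumes T: "orthogonal_transformation (T :: R3 \<Rightarrow> R3)" and f: "continuous_on S2 (f :: R3 \<Rightarrow> real)"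
  shows "(\<integral>w. f (T w) \<partial>sphere_measure) = (\<integral>w. f w \<partial>sphere_measure)"
proof -
  have lin: "linear T" using T by (rule orthogonal_transformation_linear)
  have nT: "norm (T x) = norm x" for x using T by (rule orthogonal_transformation_norm)
  have mT: "T \<in> borel_measurable borel"
    by (intro borel_measurable_continuous_onI linear_continuous_on linear_conv_bounded_linear[THEN iffD1] lin)
  have mS: "T \<in> measurable sphere_measure sphere_measure"
  proof -
    have "T \<in> measurable (restrict_space borel S2) (restrict_space borel S2)"
      by (intro measurable_restrict_space2 measurable_restrict_space1 mT) (auto simp: space_restrict_space nT)
    then show ?thesis using measurable_cong_sets[OF sets_sphere_measure sets_sphere_measure] by blast
  qed
  have "(\<integral>w. f w \<partial>distr sphere_measure sphere_measure T) = (\<integral>w. f (T w) \<partial>sphere_measure)"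
    by (rule integral_distr[OF mS measurable_continuous_sphere[OF f]])
  then show ?thesis by (simp add: distr_sphere_measure_orthogonal[OF T])
qed

section \<open>The Poisson kernel\<close>

text \<open>In terms of the inverse distance, the Poisson kernel and its derivatives are polynomials
  in the coordinates and \<open>rinv\<close>; differentiating a power of \<open>rinv\<close> raises
  its exponent by two.\<close>

definition rinv :: "R3 \<Rightarrow> R3 \<Rightarrow> real" where
  "rinv x \<eta> = inverse (norm (x - \<eta>))"

lemma has_pd_eq: "has_pd i f D x \<Longrightarrow> D = E \<Longrightarrow> has_pd i f E x"
  by simp

lemma norm_R3: "norm (x :: R3) = sqrt (\<Sum>i\<in>UNIV. x $ i * x $ i)"
  by (simp add: norm_eq_sqrt_inner inner_vec_def)

lemma has_pd_rinv:
  assumes "x \<noteq> \<eta>"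
  shows "has_pd i (\<lambda>x. rinv x \<eta>) (- ((x - \<eta>) $ i * rinv x \<eta> ^ 3)) x"
proof -
  let ?q = "\<lambda>x. \<Sum>k\<in>UNIV. (x $ k - \<eta> $ k) * (x $ k - \<eta> $ k)"
  have n: "sqrt (?q x) = norm (x - \<eta>)" for x by (simp add: norm_R3)
  have "sqrt (?q x) > 0" unfolding n using assms by simp
  then have q0: "?q x > 0" by (simp only: real_sqrt_gt_0_iff)
  have "has_pd i ?q (\<Sum>k\<in>UNIV. (x $ k - \<eta> $ k) * ((if i = k then 1 else 0) - 0) + ((if i = k then 1 else 0) - 0) * (x $ k - \<eta> $ k)) x"
    by (intro has_pd_sum has_pd_mult has_pd_diff has_pd_coord has_pd_const)
  moreover have "(\<Sum>k\<in>UNIV. (x $ k - \<eta> $ k) * ((if i = k then 1 else 0) - 0) + ((if i = k then 1 else 0) - 0) * (x $ k - \<eta> $ k)) = 2 * (x - \<eta>) $ i"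
    using exhaust_3[of i] by (auto simp: sum_3)
  ultimately have "has_pd i ?q (2 * (x - \<eta>) $ i) x" by (rule has_pd_eq)
  then have "has_pd i (\<lambda>x. inverse (sqrt (?q x)))
     (- (inverse (sqrt (?q x)) * (1 / 2 * inverse (sqrt (?q x)) * (2 * (x - \<eta>) $ i)) * inverse (sqrt (?q x)))) x"
    using q0 by (intro has_pd_inverse has_pd_sqrt) auto
  moreover have "- (inverse (sqrt (?q x)) * (1 / 2 * inverse (sqrt (?q x)) * (2 * (x - \<eta>) $ i)) * inverse (sqrt (?q x)))
    = - ((x - \<eta>) $ i * rinv x \<eta> ^ 3)"
    unfolding n rinv_def by (simp add: power3_eq_cube)
  ultimately have "has_pd i (\<lambda>x. inverse (sqrt (?q x))) (- ((x - \<eta>) $ i * rinv x \<eta> ^ 3)) x"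
    by (rule has_pd_eq)
  moreover have "(\<lambda>x. rinv x \<eta>) = (\<lambda>x. inverse (sqrt (?q x)))"
    unfolding rinv_def n ..
  ultimately show ?thesis by simp
qed

lemma has_pd_power:
  assumes "has_pd i f D x"
  shows "has_pd i (\<lambda>x. f x ^ n) (real n * f x ^ (n - 1) * D) x"
  using assms unfolding has_pd_def by (auto intro!: derivative_eq_intros simp: mult_ac)

lemma has_pd_rinv_power:
  assumes "x \<noteq> \<eta>" "n > 0"
  shows "has_pd i (\<lambda>x. rinv x \<eta> ^ n) (- (real n * (x - \<eta>) $ i * rinv x \<eta> ^ (n + 2))) x"
proof -
  have "rinv x \<eta> ^ (n - 1) * rinv x \<eta> ^ 3 = rinv x \<eta> ^ (n + 2)"
    using assms(2) by (simp flip: power_add)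
  then show ?thesis using has_pd_power[OF has_pd_rinv[OF assms(1)], of i n] by (simp add: mult_ac)
qed

lemma poissonK_rinv: "poissonK x \<eta> = 1 / (4 * pi) * ((1 - norm x ^ 2) * rinv x \<eta> ^ 3)"
  unfolding poissonK_def rinv_def power_inverse by (simp only: divide_inverse mult.assoc)

text \<open>First derivative of the Poisson kernel in closed form; \<open>pk2 i j\<close> below is
  the derivative of \<open>pk1 i\<close> in direction \<open>j\<close>.\<close>

definition pk1 :: "3 \<Rightarrow> R3 \<Rightarrow> R3 \<Rightarrow> real" where
  "pk1 i x \<eta> = 1 / (4 * pi) * ((- 2) * (x $ i * rinv x \<eta> ^ 3) - 3 * ((1 - norm x ^ 2) * ((x - \<eta>) $ i * rinv x \<eta> ^ 5)))"

definition pk2 :: "3 \<Rightarrow> 3 \<Rightarrow> R3 \<Rightarrow> R3 \<Rightarrow> real" where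
  "pk2 i j x \<eta> = 1 / (4 * pi) * (6 * (x $ i * (x - \<eta>) $ j + x $ j * (x - \<eta>) $ i) * rinv x \<eta> ^ 5
     + 15 * (1 - norm x ^ 2) * ((x - \<eta>) $ i * (x - \<eta>) $ j) * rinv x \<eta> ^ 7
     - (if i = j then 2 * rinv x \<eta> ^ 3 + 3 * (1 - norm x ^ 2) * rinv x \<eta> ^ 5 else 0))"

lemma has_pd_poissonK:
  assumes "x \<noteq> \<eta>"
  shows "has_pd i (\<lambda>x. poissonK x \<eta>) (pk1 i x \<eta>) x"
proof -
  have "has_pd i (\<lambda>x. 1 / (4 * pi) * ((1 - norm x ^ 2) * rinv x \<eta> ^ 3))
    (1 / (4 * pi) * ((1 - norm x ^ 2) * (- (real 3 * (x - \<eta>) $ i * rinv x \<eta> ^ (3 + 2))) + (- 2 * x $ i) * rinv x \<eta> ^ 3)) x"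
    by (intro has_pd_cmult has_pd_mult has_pd_normsq has_pd_rinv_power[OF assms]) simp
  then show ?thesis unfolding poissonK_rinv pk1_def by (simp add: algebra_simps)
qed

lemma has_pd_pk1:
  assumes "x \<noteq> \<eta>"
  shows "has_pd j (\<lambda>x. pk1 i x \<eta>) (pk2 i j x \<eta>) x"
proof -
  let ?d = "if j = i then 1 else 0 :: real"
  have "has_pd j (\<lambda>x. x $ i - \<eta> $ i) (?d - 0) x" by (intro has_pd_diff has_pd_coord has_pd_const)
  then have e: "has_pd j (\<lambda>x. (x - \<eta>) $ i) ?d x" by simp
  have "has_pd j (\<lambda>x. pk1 i x \<eta>)
    (1 / (4 * pi) * ((- 2) * (x $ i * (- (real 3 * (x - \<eta>) $ j * rinv x \<eta> ^ (3 + 2))) + ?d * rinv x \<eta> ^ 3)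
     - 3 * ((1 - norm x ^ 2) * ((x - \<eta>) $ i * (- (real 5 * (x - \<eta>) $ j * rinv x \<eta> ^ (5 + 2))) + ?d * rinv x \<eta> ^ 5)
           + (- 2 * x $ j) * ((x - \<eta>) $ i * rinv x \<eta> ^ 5)))) x"
    unfolding pk1_def
    by (intro has_pd_cmult has_pd_diff has_pd_mult e has_pd_coord has_pd_normsq has_pd_rinv_power[OF assms]) simp_all
  moreover have "(1 / (4 * pi) * ((- 2) * (x $ i * (- (real 3 * (x - \<eta>) $ j * rinv x \<eta> ^ (3 + 2))) + ?d * rinv x \<eta> ^ 3)
     - 3 * ((1 - norm x ^ 2) * ((x - \<eta>) $ i * (- (real 5 * (x - \<eta>) $ j * rinv x \<eta> ^ (5 + 2))) + ?d * rinv x \<eta> ^ 5)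
           + (- 2 * x $ j) * ((x - \<eta>) $ i * rinv x \<eta> ^ 5)))) = pk2 i j x \<eta>"
    unfolding pk2_def by (simp, simp only: algebra_simps) simp
  ultimately show ?thesis by (rule has_pd_eq)
qed

lemma ball_neq_sphere: "norm x < 1 \<Longrightarrow> norm \<eta> = 1 \<Longrightarrow> x \<noteq> \<eta>" by auto

lemma pd_poissonK: "norm x < 1 \<Longrightarrow> norm \<eta> = 1 \<Longrightarrow> pd i (\<lambda>y. poissonK y \<eta>) x = pk1 i x \<eta>"
  by (rule has_pd_imp_pd[OF has_pd_poissonK]) auto

lemma pd_pd_poissonK:
  assumes "norm x < 1" "norm \<eta> = 1"
  shows "pd j (pd i (\<lambda>y. poissonK y \<eta>)) x = pk2 i j x \<eta>"
proof -
  have "pd j (pd i (\<lambda>y. poissonK y \<eta>)) x = pd j (\<lambda>x. pk1 i x \<eta>) x"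
    by (rule pd_cong_ball[OF pd_poissonK assms(1)]) (simp_all add: assms)
  also have "\<dots> = pk2 i j x \<eta>" by (rule has_pd_imp_pd[OF has_pd_pk1]) (use assms in auto)
  finally show ?thesis .
qed

lemma CkP_rinv: "CkP k 1 S2 rinv"
proof -
  have n: "norm (x - \<eta>) = sqrt (\<Sum>i\<in>UNIV. (x $ i - \<eta> $ i) * (x $ i - \<eta> $ i))" for x \<eta> :: R3
    by (simp add: norm_R3)
  have pos: "(\<Sum>i\<in>UNIV. (x $ i - \<eta> $ i) * (x $ i - \<eta> $ i)) > 0" if "x \<in> ball 0 1" "\<eta> \<in> S2" for x \<eta> :: R3
  proof -
    have "x \<noteq> \<eta>" using that by auto
    then have "sqrt (\<Sum>i\<in>UNIV. (x $ i - \<eta> $ i) * (x $ i - \<eta> $ i)) > 0" unfolding n[symmetric] by simp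
    then show ?thesis by (simp only: real_sqrt_gt_0_iff)
  qed
  then have nz: "sqrt (\<Sum>i\<in>UNIV. (x $ i - \<eta> $ i) * (x $ i - \<eta> $ i)) \<noteq> 0" if "x \<in> ball 0 1" "\<eta> \<in> S2" for x \<eta> :: R3
    using that by fastforce
  have "CkP k 1 S2 (\<lambda>x \<eta>. inverse (sqrt (\<Sum>i\<in>UNIV. (x $ i - \<eta> $ i) * (x $ i - \<eta> $ i))))"
    by (intro CkP_inverse CkP_sqrt CkP_sum CkP_mult CkP_diff CkP_coord CkP_const continuous_intros pos nz)
  then show ?thesis unfolding rinv_def n .
qed

lemma CkP_normsq: "CkP k R Z (\<lambda>x z. 1 - norm x ^ 2)"
proof -
  have "norm x ^ 2 = (\<Sum>i\<in>UNIV. x $ i * x $ i)" for x :: R3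
    by (simp add: power2_norm_eq_inner inner_vec_def)
  then show ?thesis by (auto intro!: CkP_diff CkP_const CkP_sum CkP_mult CkP_coord continuous_intros)
qed

lemma CkP_poissonK: "CkP k 1 S2 poissonK"
proof -
  have "CkP k 1 S2 (\<lambda>x \<eta>. 1 / (4 * pi) * ((1 - norm x ^ 2) * rinv x \<eta> ^ 3))"
    by (intro CkP_cmult CkP_mult CkP_normsq CkP_power CkP_rinv)
  then show ?thesis by (simp add: poissonK_rinv[abs_def])
qed

text \<open>With \<open>r ^ 5\<close> factored out, harmonicity comes down to \<open>norm (x -
  \<eta>) ^ 2 = 2 * (x \<bullet> (x - \<eta>)) + 1 - norm x ^ 2\<close>, the expansion of the square
  for a unit vector \<eta>.\<close>

lemma pk2_trace:
  assumes "norm \<eta> = 1" "x \<noteq> \<eta>"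
  shows "(\<Sum>i\<in>UNIV. pk2 i i x \<eta>) = 0"
proof -
  define r where "r = rinv x \<eta>"
  have q: "(\<Sum>i\<in>UNIV. (x - \<eta>) $ i * (x - \<eta>) $ i) = norm (x - \<eta>) ^ 2"
    by (simp add: power2_norm_eq_inner inner_vec_def)
  have r: "norm (x - \<eta>) ^ 2 * r ^ 2 = 1"
    using assms(2) by (simp add: r_def rinv_def power_inverse)
  have xx: "norm x ^ 2 = x $ 1 * x $ 1 + x $ 2 * x $ 2 + x $ 3 * x $ 3"
    "1 = \<eta> $ 1 * \<eta> $ 1 + \<eta> $ 2 * \<eta> $ 2 + \<eta> $ 3 * \<eta> $ 3"
    using power2_norm_eq_inner[of x] power2_norm_eq_inner[of \<eta>] assms(1) by (simp_all add: inner_vec_def sum_3)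
  define s where "s = norm (x - \<eta>) ^ 2"
  have s: "s = (x $ 1 - \<eta> $ 1) * (x $ 1 - \<eta> $ 1) + (x $ 2 - \<eta> $ 2) * (x $ 2 - \<eta> $ 2) + (x $ 3 - \<eta> $ 3) * (x $ 3 - \<eta> $ 3)"
    using q by (simp add: s_def sum_3)
  have "4 * pi * (\<Sum>i\<in>UNIV. pk2 i i x \<eta>) =
     12 * (x $ 1 * (x $ 1 - \<eta> $ 1) + x $ 2 * (x $ 2 - \<eta> $ 2) + x $ 3 * (x $ 3 - \<eta> $ 3)) * r ^ 5
     + 15 * (1 - norm x ^ 2) * s * r ^ 7 - 6 * r ^ 3 - 9 * (1 - norm x ^ 2) * r ^ 5"
    unfolding s by (simp add: sum_3 pk2_def r_def[symmetric] field_simps)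
  also have "\<dots> = 12 * (x $ 1 * (x $ 1 - \<eta> $ 1) + x $ 2 * (x $ 2 - \<eta> $ 2) + x $ 3 * (x $ 3 - \<eta> $ 3)) * r ^ 5
     + 15 * (1 - norm x ^ 2) * r ^ 5 - 6 * s * r ^ 5 - 9 * (1 - norm x ^ 2) * r ^ 5"
  proof -
    have "s * r ^ 7 = s * r ^ 2 * r ^ 5" "s * r ^ 5 = s * r ^ 2 * r ^ 3"
      by (simp_all add: power_add[symmetric] mult.assoc)
    then have "s * r ^ 7 = r ^ 5" "s * r ^ 5 = r ^ 3" using r by (simp_all add: s_def)
    then show ?thesis by (simp add: mult.assoc)
  qed
  also have "\<dots> = 6 * r ^ 5 * (2 * (x $ 1 * (x $ 1 - \<eta> $ 1) + x $ 2 * (x $ 2 - \<eta> $ 2) + x $ 3 * (x $ 3 - \<eta> $ 3))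
     + (1 - norm x ^ 2) - s)" by (simp add: algebra_simps)
  also have "2 * (x $ 1 * (x $ 1 - \<eta> $ 1) + x $ 2 * (x $ 2 - \<eta> $ 2) + x $ 3 * (x $ 3 - \<eta> $ 3))
     + (1 - norm x ^ 2) - s = 0"
    unfolding s xx(1) by (subst xx(2)) (simp add: algebra_simps)
  finally show ?thesis by simp
qed

lemma poissonK_nonneg: "norm x < 1 \<Longrightarrow> poissonK x \<eta> \<ge> 0"
  unfolding poissonK_def by (auto intro!: divide_nonneg_nonneg mult_nonneg_nonneg simp: power_le_one)

lemma one_minus_normsq_le:
  assumes "norm x \<le> 1" "norm \<eta> = 1"
  shows "1 - norm x ^ 2 \<le> 2 * norm (x - \<eta>)"
proof -
  have "1 - norm x \<le> norm (x - \<eta>)" using norm_triangle_ineq2[of \<eta> x] assms by (simp add: norm_minus_commute)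
  moreover have "(1 - norm x) * (1 + norm x) \<le> norm (x - \<eta>) * 2"
    by (rule mult_mono) (use calculation assms in auto)
  ultimately show ?thesis by (simp add: algebra_simps power2_eq_square)
qed

text \<open>Since \<open>1 - norm x ^ 2\<close> is at most twice the distance to \<open>\<eta>\<close>, every term of the second
  derivative of the Poisson kernel is of order \<open>norm (x - \<eta>) powr - 4\<close>.\<close>

lemma pk2_bound:
  assumes x: "norm x < 1" and e: "norm \<eta> = 1"
  shows "\<bar>pk2 i j x \<eta>\<bar> \<le> 1 / (4 * pi) * (52 * rinv x \<eta> ^ 4)"
proof -
  define n where "n = norm (x - \<eta>)"
  define r where "r = rinv x \<eta>"
  have n: "n > 0" "n \<le> 2" using x e ball_neq_sphere[OF x e] norm_triangle_ineq4[of x \<eta>] by (auto simp: n_def)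
  have r: "r > 0" "n * r = 1" using n by (auto simp: r_def rinv_def n_def)
  have y: "\<bar>(x - \<eta>) $ k\<bar> \<le> n" for k unfolding n_def by (rule component_le_norm_cart)
  have xk: "\<bar>x $ k\<bar> \<le> 1" for k using component_le_norm_cart[of x k] x by simp
  have m: "0 \<le> 1 - norm x ^ 2" "1 - norm x ^ 2 \<le> 2 * n"
    using one_minus_normsq_le[of x \<eta>] x e by (auto simp: n_def power_le_one)
  have rp: "r ^ k \<ge> 0" for k using r by simp
  have n4: "n * r ^ 5 = r ^ 4" "n ^ 3 * r ^ 7 = r ^ 4" "r ^ 3 = n * r ^ 4"
  proof -
    have "n * r ^ 5 = (n * r) * r ^ 4" "n ^ 3 * r ^ 7 = (n * r) ^ 3 * r ^ 4" "n * r ^ 4 = (n * r) * r ^ 3"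
      by (simp_all add: power_mult_distrib power_add[symmetric] eval_nat_numeral)
    then show "n * r ^ 5 = r ^ 4" "n ^ 3 * r ^ 7 = r ^ 4" "r ^ 3 = n * r ^ 4" using r by simp_all
  qed
  have xy: "\<bar>x $ a * (x - \<eta>) $ b\<bar> \<le> n" for a b
    unfolding abs_mult using mult_mono[OF xk[of a] y[of b]] n by simp
  have "\<bar>6 * (x $ i * (x - \<eta>) $ j + x $ j * (x - \<eta>) $ i) * r ^ 5\<bar> = 6 * \<bar>x $ i * (x - \<eta>) $ j + x $ j * (x - \<eta>) $ i\<bar> * r ^ 5"
    using rp[of 5] by (simp only: abs_mult abs_of_nonneg abs_numeral)
  also have "\<dots> \<le> 6 * (2 * n) * r ^ 5"
    using xy[of i j] xy[of j i] r n by (intro mult_mono) auto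
  also have "\<dots> = 12 * r ^ 4" using n4(1) by simp
  finally have A: "\<bar>6 * (x $ i * (x - \<eta>) $ j + x $ j * (x - \<eta>) $ i) * r ^ 5\<bar> \<le> 12 * r ^ 4" .
  have "\<bar>15 * (1 - norm x ^ 2) * ((x - \<eta>) $ i * (x - \<eta>) $ j) * r ^ 7\<bar> =
      15 * (1 - norm x ^ 2) * (\<bar>(x - \<eta>) $ i\<bar> * \<bar>(x - \<eta>) $ j\<bar>) * r ^ 7"
    using rp[of 7] m by (simp add: abs_mult)
  also have "\<dots> \<le> 15 * (2 * n) * (n * n) * r ^ 7"
    using m y n r by (intro mult_mono) auto
  also have "\<dots> = 30 * r ^ 4" using n4(2) by (simp add: power3_eq_cube mult.assoc)
  finally have B: "\<bar>15 * (1 - norm x ^ 2) * ((x - \<eta>) $ i * (x - \<eta>) $ j) * r ^ 7\<bar> \<le> 30 * r ^ 4" .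
  have "2 * r ^ 3 \<le> 4 * r ^ 4" using n4(3) n mult_right_mono[OF n(2) rp[of 4]] by simp
  moreover have "3 * (1 - norm x ^ 2) * r ^ 5 \<le> 3 * (2 * n) * r ^ 5"
    using m r by (intro mult_mono) auto
  moreover have "3 * (2 * n) * r ^ 5 = 6 * r ^ 4" using n4(1) by simp
  moreover have "0 \<le> 3 * (1 - norm x ^ 2) * r ^ 5" "0 \<le> 2 * r ^ 3"
    by (intro mult_nonneg_nonneg m rp; simp)+
  ultimately have C: "\<bar>if i = j then 2 * r ^ 3 + 3 * (1 - norm x ^ 2) * r ^ 5 else 0\<bar> \<le> 10 * r ^ 4"
    using rp[of 4] by auto
  \<comment> \<open>The three groups contribute 12, 30 and 10: two mixed products of size at most
    \<open>n\<close>; a weight of at most \<open>2 * n\<close> times two coordinates; and, on the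
    diagonal, 4 (from \<open>n \<le> 2\<close>) plus 6.\<close>
  have "\<bar>6 * (x $ i * (x - \<eta>) $ j + x $ j * (x - \<eta>) $ i) * r ^ 5
     + 15 * (1 - norm x ^ 2) * ((x - \<eta>) $ i * (x - \<eta>) $ j) * r ^ 7
     - (if i = j then 2 * r ^ 3 + 3 * (1 - norm x ^ 2) * r ^ 5 else 0)\<bar> \<le> 52 * r ^ 4"
    using A B C by linarith
  then show ?thesis unfolding pk2_def r_def[symmetric] abs_mult
    by (intro mult_mono) auto
qed

text \<open>The pair of a measure and a density serves boundary functions (surface measure) and
  vector measures (density 1) alike.\<close>

definition poissonI :: "R3 measure \<Rightarrow> (R3 \<Rightarrow> real) \<Rightarrow> R3 \<Rightarrow> real" where
  "poissonI M g x = (\<integral>\<eta>. poissonK x \<eta> * g \<eta> \<partial>M)"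

lemma Ck_poissonI:
  "sets M = sets sphere_measure \<Longrightarrow> integrable M g \<Longrightarrow> Ck k 1 (poissonI M g)"
  unfolding poissonI_def sets_sphere_measure by (rule Ck_param_integral[OF CkP_poissonK compact_sphere])

lemma pd_pd_poissonI:
  assumes M: "sets M = sets sphere_measure" "integrable M g" and x: "norm x < 1"
  shows "pd j (pd i (poissonI M g)) x = (\<integral>\<eta>. pk2 i j x \<eta> * g \<eta> \<partial>M)"
proof -
  note M' = M(1)[unfolded sets_sphere_measure]
  have c: "CkP (Suc 0) 1 S2 (\<lambda>x \<eta>. pd i (\<lambda>y. poissonK y \<eta>) x)"
    using CkP_poissonK[of "Suc (Suc 0)"] by (simp only: CkP.simps) blast
  have "pd j (pd i (poissonI M g)) x = pd j (\<lambda>x. \<integral>\<eta>. pd i (\<lambda>y. poissonK y \<eta>) x * g \<eta> \<partial>M) x"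
    unfolding poissonI_def
    by (rule pd_cong_ball[OF _ x]) (rule pd_param_integral[OF CkP_poissonK compact_sphere M' M(2)])
  also have "\<dots> = (\<integral>\<eta>. pd j (pd i (\<lambda>y. poissonK y \<eta>)) x * g \<eta> \<partial>M)"
    by (rule pd_param_integral[OF c compact_sphere M' M(2) x])
  also have "\<dots> = (\<integral>\<eta>. pk2 i j x \<eta> * g \<eta> \<partial>M)"
    by (rule Bochner_Integration.integral_cong) (auto simp: pd_pd_poissonK x space_eq_of_sets_restrict[OF M'])
  finally show ?thesis .
qed

lemma continuous_on_pk2: "continuous_on (ball 0 1 \<times> S2) (\<lambda>(x, \<eta>). pk2 i j x \<eta>)"
proof -
  have "CkP 0 1 S2 (\<lambda>x \<eta>. pd j (\<lambda>y. pd i (\<lambda>y. poissonK y \<eta>) y) x)"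
    using CkP_poissonK[of "Suc (Suc 0)"] by (simp only: CkP.simps)
  then have "CkP 0 1 S2 (pk2 i j)"
    by (rule CkP_cong[THEN iffD1, rotated]) (simp add: pd_pd_poissonK)
  then show ?thesis by simp
qed

lemma lap_poissonI:
  assumes M: "sets M = sets sphere_measure" "integrable M g" and x: "norm x < 1"
  shows "lap (poissonI M g) x = 0"
proof -
  note M' = M(1)[unfolded sets_sphere_measure]
  have "lap (poissonI M g) x = (\<integral>\<eta>. (\<Sum>i\<in>UNIV. pk2 i i x \<eta> * g \<eta>) \<partial>M)"
    unfolding lap_def pd_pd_poissonI[OF M x]
    by (rule Bochner_Integration.integral_sum[symmetric])
       (use x in \<open>auto intro!: integrable_continuous_mult[OF continuous_on_param_slice[OF continuous_on_pk2] compact_sphere M' M(2)]\<close>)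
  also have "\<dots> = (\<integral>\<eta>. 0 \<partial>M)"
    by (rule Bochner_Integration.integral_cong)
       (use x in \<open>auto simp: sum_distrib_right[symmetric] space_eq_of_sets_restrict[OF M'] intro!: pk2_trace\<close>)
  finally show ?thesis by simp
qed

lemma continuous_on_poissonK: "norm x < 1 \<Longrightarrow> continuous_on S2 (poissonK x)"
  using continuous_on_param_slice[OF CkP_imp_continuous[OF CkP_poissonK]] by simp

text \<open>The total mass of the Poisson kernel is a rotation-invariant harmonic function of \<open>x\<close>; by
  uniqueness it agrees on every ball with its constant boundary value.\<close>

lemma integral_poissonK:
  assumes x: "norm x < 1"
  shows "(\<integral>\<eta>. poissonK x \<eta> \<partial>sphere_measure) = 1"
proof -
  define m where "m = poissonI sphere_measure (\<lambda>_. 1)"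
  have C: "Ck k 1 m" for k unfolding m_def by (rule Ck_poissonI[OF refl integrable_sphere_const])
  have l: "lap m y = 0" if "norm y < 1" for y
    unfolding m_def by (rule lap_poissonI[OF refl integrable_sphere_const that])
  have inv: "m y = m z" if n: "norm y = norm z" "norm z < 1" for y z
  proof -
    obtain T where T: "orthogonal_transformation T" "T y = z"
      using orthogonal_transformation_exists[OF n(1)] by blast
    have "norm (T (y - \<eta>)) = norm (y - \<eta>)" for \<eta> by (rule orthogonal_transformation_norm[OF T(1)])
    then have "norm (z - T \<eta>) = norm (y - \<eta>)" for \<eta>
      using T by (simp add: linear_diff[OF orthogonal_transformation_linear[OF T(1)]])
    then have "poissonK z (T \<eta>) = poissonK y \<eta>" for \<eta> by (simp add: poissonK_def n)
    then have "m y = (\<integral>\<eta>. poissonK z (T \<eta>) \<partial>sphere_measure)" by (simp add: m_def poissonI_def)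
    also have "\<dots> = m z"
      unfolding m_def poissonI_def by (simp add: integral_sphere_orthogonal[OF T(1) continuous_on_poissonK[OF n(2)]])
    finally show ?thesis .
  qed
  define R where "R = (1 + norm x) / 2"
  have R: "norm x < R" "R < 1" "0 < R" using x by (auto simp: R_def field_simps add_pos_nonneg)
  define c where "c = m (R *\<^sub>R axis 1 1)"
  have const: "m y = c" if "norm y \<le> R" for y
  proof (rule harmonic_unique[OF _ _ _ _ _ _ _ that, of 0 m "\<lambda>_. c"])
    show "Ck (Suc (Suc 0)) R m" "continuous_on (cball 0 R) m"
      using Ck_subset[OF C] R by (auto intro: continuous_on_subset[OF Ck_continuous[OF C]])
    show "lap (\<lambda>_. c) x = 0" for x
    proof -
      have "pd i (\<lambda>_. c) = (\<lambda>_. 0::real)" for i and c :: real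
        using has_pd_imp_pd[OF has_pd_const] by (intro ext) simp
      then show ?thesis by (simp add: lap_def)
    qed
    show "m x = c" if "norm x = R" for x unfolding c_def by (rule inv) (use that R in auto)
  qed (use l R in \<open>auto intro: Ck_const\<close>)
  \<comment> \<open>At the centre the kernel is the constant \<open>1 / (4 * pi)\<close>, the
    reciprocal of the total surface.\<close>
  have "m 0 = (\<integral>\<eta>. 1 / (4 * pi) \<partial>sphere_measure)"
    unfolding m_def poissonI_def
    by (rule Bochner_Integration.integral_cong) (auto simp: poissonK_def space_sphere_measure)
  also have "\<dots> = 1" by (simp add: measure_sphere_measure)
  finally have "m x = 1" using const[of 0] const[of x] R by simp
  then show ?thesis by (simp add: m_def poissonI_def)
qed

text \<open>The kernel is an approximate identity: it has mass one, points near \<open>x0\<close>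
  are controlled by continuity of \<open>f\<close>, and away from \<open>x0\<close> it is at most a
  constant times \<open>1 - norm x ^ 2\<close>, which tends to 0 at the sphere.\<close>

lemma poissonI_boundary:
  assumes f: "continuous_on S2 f" and x0: "norm x0 = 1" and e: "e > 0"
  shows "\<exists>d>0. \<forall>x. norm x < 1 \<longrightarrow> norm (x - x0) < d \<longrightarrow> \<bar>poissonI sphere_measure f x - f x0\<bar> < e"
proof -
  obtain B where "\<forall>y\<in>S2. \<bar>f y\<bar> \<le> B"
    using compact_imp_bounded[OF compact_continuous_image[OF f compact_sphere]] by (auto simp: bounded_iff)
  then have B: "\<And>y. y \<in> S2 \<Longrightarrow> \<bar>f y\<bar> \<le> B" by blast
  have B0: "B \<ge> 0" using B[of x0] x0 by auto
  obtain d where d: "d > 0" "\<And>y. y \<in> S2 \<Longrightarrow> dist y x0 < d \<Longrightarrow> dist (f y) (f x0) < e / 2"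
    using f x0 e unfolding continuous_on_iff by (metis half_gt_zero mem_sphere_0)
  \<comment> \<open>Points at distance at least \<open>d\<close> from \<open>x0\<close> stay at
    distance at least \<open>d / 2\<close> from \<open>x\<close>, whence \<open>8 / d ^ 3\<close>;
    the oscillation of \<open>f\<close> is at most \<open>2 * B\<close>.\<close>
  define K where "K = 2 * B * (1 / (4 * pi) * (8 / d ^ 3))"
  have K: "K \<ge> 0" unfolding K_def using B0 d(1) by (intro mult_nonneg_nonneg) auto
  \<comment> \<open>The surface \<open>4 * pi\<close> and \<open>1 - norm x ^ 2 \<le> 2 * d'\<close>
    bound the far part by \<open>8 * pi * K * d'\<close>, hence by \<open>e / 4\<close>; the near
    part takes \<open>e / 2\<close>.\<close>
  define d' where "d' = min (d / 2) (e / (4 * (8 * pi * K + 1)))"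
  have d': "d' > 0" using d e K by (auto simp: d'_def add_nonneg_pos)
  show ?thesis
  proof (intro exI[of _ d'] conjI allI impI d')
    fix x assume x: "norm x < 1" "norm (x - x0) < d'"
    note ic = integrable_sphere_continuous
    have pt: "\<bar>poissonK x y * (f y - f x0)\<bar> \<le> e / 2 * poissonK x y + K * (1 - norm x ^ 2)" if y: "y \<in> S2" for y
    proof (cases "dist y x0 < d")
      case True
      have "\<bar>poissonK x y * (f y - f x0)\<bar> \<le> poissonK x y * (e / 2)"
        unfolding abs_mult using poissonK_nonneg[OF x(1), of y] d(2)[OF y True]
        by (intro mult_mono) (auto simp: dist_real_def)
      moreover have "K * (1 - norm x ^ 2) \<ge> 0" using K x(1) by (intro mult_nonneg_nonneg) (auto simp: power_le_one)
      ultimately show ?thesis by (simp add: mult.commute)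
    next
      case False
      have "norm (y - x0) \<le> norm (x - y) + norm (x - x0)"
        using norm_triangle_ineq[of "y - x" "x - x0"] by (simp add: norm_minus_commute)
      then have n: "norm (x - y) \<ge> d / 2" using False x(2) d'_def by (simp add: dist_norm)
      have "(d / 2) ^ 3 \<le> norm (x - y) ^ 3" using n d(1) by (intro power_mono) auto
      then have "poissonK x y \<le> 1 / (4 * pi) * (1 - norm x ^ 2) / (d / 2) ^ 3"
        unfolding poissonK_def using d(1) x(1)
        by (intro divide_left_mono mult_nonneg_nonneg mult_pos_pos) (auto simp: power_le_one intro: less_le_trans)
      also have "\<dots> = (1 / (4 * pi) * (8 / d ^ 3)) * (1 - norm x ^ 2)"
      proof -
        have "1 / (4 * pi) * A / (d / 2) ^ 3 = (1 / (4 * pi) * (8 / d ^ 3)) * A" for A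
          by (simp add: power_divide)
        then show ?thesis .
      qed
      finally have "\<bar>poissonK x y * (f y - f x0)\<bar> \<le> ((1 / (4 * pi) * (8 / d ^ 3)) * (1 - norm x ^ 2)) * (2 * B)"
        unfolding abs_mult using poissonK_nonneg[OF x(1), of y] B[OF y] B[of x0] x0
        by (intro mult_mono) auto
      moreover have "((1 / (4 * pi) * (8 / d ^ 3)) * (1 - norm x ^ 2)) * (2 * B) = K * (1 - norm x ^ 2)"
        unfolding K_def by (simp only: mult_ac)
      moreover have "0 \<le> e / 2 * poissonK x y" using poissonK_nonneg[OF x(1), of y] e by simp
      ultimately show ?thesis by linarith
    qed
    have c: "continuous_on S2 (poissonK x)" by (rule continuous_on_poissonK[OF x(1)])
    have "poissonI sphere_measure f x - f x0 = (\<integral>y. poissonK x y * f y \<partial>sphere_measure) - (\<integral>y. poissonK x y * f x0 \<partial>sphere_measure)"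
      by (simp add: poissonI_def integral_poissonK[OF x(1)])
    also have "\<dots> = (\<integral>y. poissonK x y * f y - poissonK x y * f x0 \<partial>sphere_measure)"
      by (rule Bochner_Integration.integral_diff[symmetric]) (intro ic continuous_intros c f)+
    also have "\<dots> = (\<integral>y. poissonK x y * (f y - f x0) \<partial>sphere_measure)" by (simp add: algebra_simps)
    finally have "\<bar>poissonI sphere_measure f x - f x0\<bar> \<le> (\<integral>y. \<bar>poissonK x y * (f y - f x0)\<bar> \<partial>sphere_measure)"
      by (simp only: integral_abs_bound)
    also have "\<dots> \<le> (\<integral>y. e / 2 * poissonK x y + K * (1 - norm x ^ 2) \<partial>sphere_measure)"
      by (rule integral_mono) (use pt in \<open>auto intro!: ic continuous_intros c f simp: space_sphere_measure\<close>)
    also have "\<dots> = e / 2 + 4 * pi * (K * (1 - norm x ^ 2))"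
      using ic[OF c] integrable_sphere_const by (simp add: integral_poissonK[OF x(1)] measure_sphere_measure)
    also have "\<dots> < e"
    proof -
      have "1 - norm x ^ 2 \<le> 2 * d'" using one_minus_normsq_le[of x x0] x x0 by simp
      then have "4 * pi * (K * (1 - norm x ^ 2)) \<le> 4 * pi * (K * (2 * d'))"
        using K by (intro mult_left_mono) auto
      also have "\<dots> = (8 * pi * K) * d'" by simp
      also have "\<dots> \<le> (8 * pi * K + 1) * (e / (4 * (8 * pi * K + 1)))"
        using K d' by (intro mult_mono) (auto simp: d'_def)
      also have "\<dots> = e / 4" using K add_nonneg_pos[of "8 * pi * K" 1] by (simp add: field_simps)
      finally show ?thesis using e by simp
    qed
    finally show "\<bar>poissonI sphere_measure f x - f x0\<bar> < e" .
  qed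
qed

text \<open>The Poisson integral of the boundary values, continued by those values on the sphere, is
  continuous on the closed ball, so uniqueness identifies it with \<open>v\<close>.\<close>

lemma poisson_formula:
  assumes v: "Ck (Suc (Suc k)) 1 v" "continuous_on (cball 0 1) v" "\<And>x. norm x < 1 \<Longrightarrow> lap v x = 0"
    and x: "norm x < 1"
  shows "v x = poissonI sphere_measure v x"
proof -
  let ?p = "poissonI sphere_measure v"
  define h where "h = (\<lambda>x. if norm x < 1 then ?p x else v x)"
  have vS: "continuous_on S2 v" by (rule continuous_on_subset[OF v(2)]) auto
  note iv = integrable_sphere_continuous[OF vS]
  have C: "Ck k 1 ?p" for k by (rule Ck_poissonI[OF refl iv])
  have ch: "continuous_on (cball 0 1) h"
    unfolding continuous_on_iff
  proof (intro ballI allI impI)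
    fix x0 :: R3 and e :: real assume x0: "x0 \<in> cball 0 1" and e: "e > 0"
    show "\<exists>d>0. \<forall>x\<in>cball 0 1. dist x x0 < d \<longrightarrow> dist (h x) (h x0) < e"
    proof (cases "norm x0 < 1")
      case True
      have "isCont ?p x0" using Ck_continuous[OF C[of 0]] True by (simp add: continuous_on_eq_continuous_at)
      then obtain d where d: "d > 0" "\<And>y. dist y x0 < d \<Longrightarrow> dist (?p y) (?p x0) < e"
        using e by (auto simp: continuous_at_eps_delta dist_norm)
      show ?thesis
      proof (intro exI[of _ "min d (1 - norm x0)"] conjI ballI impI)
        fix y assume y: "y \<in> cball 0 1" "dist y x0 < min d (1 - norm x0)"
        then have "norm y < 1" using norm_triangle_ineq2[of y x0] by (simp add: dist_norm)
        then show "dist (h y) (h x0) < e" using d(2)[of y] y True by (simp add: h_def)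
      qed (use d True in auto)
    next
      case False
      then have n1: "norm x0 = 1" using x0 by simp
      obtain d1 where d1: "d1 > 0" "\<And>x. norm x < 1 \<Longrightarrow> norm (x - x0) < d1 \<Longrightarrow> \<bar>?p x - v x0\<bar> < e"
        using poissonI_boundary[OF vS n1 e] by blast
      obtain d2 where d2: "d2 > 0" "\<And>x. x \<in> S2 \<Longrightarrow> dist x x0 < d2 \<Longrightarrow> dist (v x) (v x0) < e"
        using vS n1 e unfolding continuous_on_iff by (metis mem_sphere_0)
      show ?thesis
      proof (intro exI[of _ "min d1 d2"] conjI ballI impI)
        fix y assume y: "y \<in> cball 0 1" "dist y x0 < min d1 d2"
        show "dist (h y) (h x0) < e"
        proof (cases "norm y < 1")
          case True
          then show ?thesis using d1(2)[of y] y n1 by (simp add: h_def dist_norm)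
        next
          case False
          then show ?thesis using d2(2)[of y] y n1 by (simp add: h_def)
        qed
      qed (use d1 d2 in auto)
    qed
  qed
  have "v x = h x"
  proof (rule harmonic_unique[OF v(1,2,3) _ ch])
    show "Ck (Suc (Suc k)) 1 h"
      by (rule Ck_cong[THEN iffD1, rotated, OF C]) (simp add: h_def)
    show "lap h y = 0" if "norm y < 1" for y
    proof -
      have "lap h y = lap ?p y" by (rule lap_cong[OF _ that]) (simp add: h_def)
      then show ?thesis using lap_poissonI[OF refl iv that] by simp
    qed
  qed (use x in \<open>auto simp: h_def\<close>)
  then show ?thesis using x by (simp add: h_def)
qed

section \<open>The Lame system and harmonic functions\<close>

lemma pd_eq_0_ball:
  fixes f :: "R3 \<Rightarrow> real"
  assumes "\<And>y. norm y < R \<Longrightarrow> f y = 0" "norm x < R"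
  shows "pd i f x = 0"
proof -
  have "pd i f x = pd i (\<lambda>_. 0) x" by (rule pd_cong_ball[OF assms])
  then show ?thesis using has_pd_imp_pd[OF has_pd_const] by simp
qed

locale lame =
  fixes lam mu :: real
  assumes mu_pos: "mu > 0" and lam_mu: "2 * mu + lam > 0"
begin

abbreviation "\<alpha> \<equiv> lame_alpha lam mu"
abbreviation "\<beta> \<equiv> lame_beta lam mu"

lemma denom_pos: "lam + 3 * mu > 0"
  using mu_pos lam_mu by linarith

lemma alpha_pos: "0 < \<alpha>"
  unfolding lame_alpha_def using denom_pos lam_mu by (intro divide_pos_pos) linarith+

lemma alpha_less: "\<alpha> < 1"
  unfolding lame_alpha_def using denom_pos mu_pos by (simp add: divide_less_eq)

text \<open>This and the next identity tie \<alpha> and \<beta> to each other and to the Lame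
  constants: the first shapes the divergence, the second makes the two terms of the system
  cancel.\<close>

lemma beta_eq: "2 * \<beta> = 2 * \<alpha> - 1"
  unfolding lame_alpha_def lame_beta_def using denom_pos by (simp add: field_simps)

lemma beta_mu: "(lam + mu) * (1 - \<alpha>) = 2 * mu * \<beta>"
  unfolding lame_alpha_def lame_beta_def using denom_pos by (simp add: field_simps)

text \<open>The radius is free because averaging shrinks the ball, while a dilation by r < 1
  enlarges it.\<close>

definition lame_solution :: "real \<Rightarrow> (3 \<Rightarrow> R3 \<Rightarrow> real) \<Rightarrow> bool" where
  "lame_solution R u \<longleftrightarrow> (\<forall>x j. norm x < R \<longrightarrow>
     mu * lap (u j) x + (lam + mu) * pd j (\<lambda>y. \<Sum>i\<in>UNIV. pd i (u i) y) x = 0)"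

lemma lap_normsq_pd:
  assumes f: "Ck (Suc (Suc (Suc k))) R f" and l: "\<And>x. norm x < R \<Longrightarrow> lap f x = 0" and x: "norm x < R"
  shows "lap (\<lambda>x. (1 - norm x ^ 2) * pd j f x) x = - 2 * (3 * pd j f x + 2 * euler (pd j f) x)"
proof -
  have "lap (pd j f) x = pd j (lap f) x" by (rule lap_pd[OF f x])
  also have "\<dots> = 0" by (rule pd_eq_0_ball[OF l x])
  finally show ?thesis using lap_normsq_mult[OF Ck_pd[OF f] x, of j] by simp
qed

lemma div_normsq_pd:
  assumes f: "Ck (Suc (Suc k)) R f" and l: "lap f x = 0" and x: "norm x < R"
  shows "(\<Sum>j\<in>UNIV. pd j (\<lambda>x. (1 - norm x ^ 2) * pd j f x) x) = - 2 * euler f x"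
proof -
  have "(\<Sum>j\<in>UNIV. pd j (\<lambda>x. (1 - norm x ^ 2) * pd j f x) x) = (1 - norm x ^ 2) * lap f x - 2 * euler f x"
    unfolding pd_normsq_mult[OF Ck_pd[OF f] x] lap_def euler_def
    by (simp add: sum_subtractf sum_distrib_left)
  then show ?thesis using l by simp
qed

text \<open>With the Poisson integral of the i-th boundary component as \<open>p\<close>, this is
  the j-th component of what the i-th column of the elastic kernel produces from that datum.\<close>

definition kernel_column :: "3 \<Rightarrow> (R3 \<Rightarrow> real) \<Rightarrow> 3 \<Rightarrow> R3 \<Rightarrow> real" where
  "kernel_column i p j x = (if i = j then p x else 0) + \<beta> * ((1 - norm x ^ 2) * pd j (Aop \<alpha> (pd i p)) x)"

lemma Ck_column: "Ck (Suc (Suc k)) R p \<Longrightarrow> Ck k R (kernel_column i p j)"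
  unfolding kernel_column_def
  by (intro Ck_add Ck_cmult Ck_mult Ck_normsq Ck_pd[OF Ck_Aop] alpha_less Ck_pd)
     (cases "i = j"; auto intro: Ck_const elim: Ck_lower)

text \<open>With \<open>f = Aop \<alpha> (pd i p)\<close>, the Laplacian and the gradient of the
  divergence are both multiples of \<open>3 * pd j f + 2 * euler (pd j f)\<close>: the former by the
  product rule, the latter because \<open>euler f + (1 - \<alpha>) * f = pd i p\<close> and
  \<open>beta_eq\<close> reduce the divergence to \<open>(1 - \<alpha>) * (2 * euler f + f)\<close>.
  The multiples cancel by \<open>beta_mu\<close>.\<close>

lemma lame_solution_column:
  assumes p: "Ck (Suc (Suc (Suc (Suc k)))) R p" and l: "\<And>x. norm x < R \<Longrightarrow> lap p x = 0"
  shows "lame_solution R (kernel_column i p)"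
  unfolding lame_solution_def
proof (intro allI impI)
  fix x :: R3 and j assume x: "norm x < R"
  define f where "f = Aop \<alpha> (pd i p)"
  note z = has_pd_imp_pd[OF has_pd_const]
  have Cf: "Ck (Suc (Suc (Suc k))) R f" unfolding f_def by (rule Ck_Aop[OF Ck_pd[OF p] alpha_less])
  have lf: "lap f y = 0" if y: "norm y < R" for y
  proof -
    have "lap (pd i p) w = 0" if w: "norm w < R" for w
      unfolding lap_pd[OF p w] by (rule pd_eq_0_ball[OF l w])
    then have "Aop (\<alpha> - 2) (lap (pd i p)) y = Aop (\<alpha> - 2) (\<lambda>_. 0) y" by (rule Aop_cong[OF y])
    then show ?thesis unfolding f_def lap_Aop[OF Ck_pd[OF p] alpha_less y] by (simp add: Aop_def)
  qed
  have ef: "euler f y + (1 - \<alpha>) * f y = pd i p y" if "norm y < R" for y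
    unfolding f_def by (rule euler_Aop[OF Ck_pd[OF p] alpha_less that])
  let ?w = "\<lambda>j x. (1 - norm x ^ 2) * pd j f x"
  have Cw: "Ck (Suc (Suc k)) R (?w j)" for j by (intro Ck_mult Ck_normsq Ck_pd[OF Cf])
  have Cd: "Ck (Suc (Suc k)) R (\<lambda>x. if i = j then p x else 0)" for j
    by (cases "i = j") (simp_all add: Ck_const Ck_lower[OF p])
  have u: "kernel_column i p j = (\<lambda>x. (if i = j then p x else 0) + \<beta> * ?w j x)" for j
    by (simp add: kernel_column_def f_def fun_eq_iff)
  have "lap (kernel_column i p j) x = lap (\<lambda>x. if i = j then p x else 0) x + \<beta> * lap (?w j) x"
    unfolding u lap_add[OF Cd Ck_cmult[OF Cw] x] lap_cmult[OF Cw x] ..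
  moreover have "lap (\<lambda>x. if i = j then p x else 0) x = 0"
    using l[OF x] z by (cases "i = j") (simp_all add: lap_def z[abs_def])
  ultimately have L: "lap (kernel_column i p j) x = \<beta> * (- 2 * (3 * pd j f x + 2 * euler (pd j f) x))"
    using lap_normsq_pd[OF Cf lf x] by simp
  have D: "(\<Sum>j\<in>UNIV. pd j (kernel_column i p j) y) = (1 - \<alpha>) * (2 * euler f y + f y)" if y: "norm y < R" for y
  proof -
    have "pd j (kernel_column i p j) y = (if i = j then pd i p y else 0) + \<beta> * pd j (?w j) y" for j
      unfolding u pd_add[OF Cd Ck_cmult[OF Cw] y] pd_cmult[OF Cw y] using z by auto
    then have "(\<Sum>j\<in>UNIV. pd j (kernel_column i p j) y) = pd i p y + \<beta> * (\<Sum>j\<in>UNIV. pd j (?w j) y)"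
      by (simp add: sum.distrib sum_distrib_left)
    also have "\<dots> = pd i p y - (2 * \<beta>) * euler f y"
      using div_normsq_pd[OF Cf lf[OF y] y] by simp
    also have "\<dots> = (1 - \<alpha>) * (2 * euler f y + f y)"
      unfolding beta_eq using ef[OF y, symmetric] by (simp add: algebra_simps)
    finally show ?thesis .
  qed
  have "pd j (\<lambda>y. \<Sum>i'\<in>UNIV. pd i' (kernel_column i p i') y) x = pd j (\<lambda>y. (1 - \<alpha>) * (2 * euler f y + f y)) x"
    by (rule pd_cong_ball[OF D x])
  also have "\<dots> = (1 - \<alpha>) * (2 * pd j (euler f) x + pd j f x)"
    by (intro has_pd_imp_pd has_pd_cmult has_pd_add Ck_has_pd[OF Ck_euler[OF Cf] x] Ck_has_pd[OF Cf x])
  also have "\<dots> = (1 - \<alpha>) * (3 * pd j f x + 2 * euler (pd j f) x)"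
    unfolding pd_euler[OF Cf x] by simp
  finally have P: "pd j (\<lambda>y. \<Sum>i'\<in>UNIV. pd i' (kernel_column i p i') y) x = (1 - \<alpha>) * (3 * pd j f x + 2 * euler (pd j f) x)" .
  have "mu * lap (kernel_column i p j) x + (lam + mu) * pd j (\<lambda>y. \<Sum>i'\<in>UNIV. pd i' (kernel_column i p i') y) x
    = ((lam + mu) * (1 - \<alpha>) - 2 * mu * \<beta>) * (3 * pd j f x + 2 * euler (pd j f) x)"
    unfolding L P by (simp add: algebra_simps)
  then show "mu * lap (kernel_column i p j) x + (lam + mu) * pd j (\<lambda>y. \<Sum>i'\<in>UNIV. pd i' (kernel_column i p i') y) x = 0"
    unfolding beta_mu by simp
qed

text \<open>Conversely, a solution \<open>W\<close> splits as \<open>W = v + \<beta> (1 - norm x ^ 2) grad f\<close> with \<open>v\<close> and \<open>f\<close>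
  harmonic: \<open>f\<close> is recovered from the harmonic function \<open>div W\<close> by \<open>(1 - \<alpha>) (2 euler f + f) = div W\<close>,
  and then \<open>div v = euler f + (1 - \<alpha>) f\<close> expresses \<open>f\<close> through \<open>v\<close>, hence through the boundary
  values of \<open>W\<close>.\<close>

lemma lame_solution_representation:
  assumes W: "\<And>j. Ck (Suc (Suc (Suc (Suc k)))) R (W j)" and R: "R > 1" and sol: "lame_solution R W" and x: "norm x < 1"
  shows "W j x = (\<Sum>i\<in>UNIV. kernel_column i (poissonI sphere_measure (W i)) j x)"
proof -
  note z = has_pd_imp_pd[OF has_pd_const]
  define d where "d = (\<lambda>y. \<Sum>i\<in>UNIV. pd i (W i) y)"
  have Cd: "Ck (Suc (Suc (Suc k))) R d" unfolding d_def by (intro Ck_sum Ck_pd[OF W])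
  have eq: "mu * lap (W j) y + (lam + mu) * pd j d y = 0" if "norm y < R" for y j
    using sol that unfolding lame_solution_def d_def by blast
  \<comment> \<open>Taking the divergence of the system gives \<open>2 * mu + lam\<close> times the
    Laplacian of \<open>d\<close>.\<close>
  have ld: "lap d y = 0" if y: "norm y < R" for y
  proof -
    have "lap d y = (\<Sum>i\<in>UNIV. lap (pd i (W i)) y)"
      unfolding d_def by (rule lap_sum[OF Ck_pd[OF W] y])
    also have "\<dots> = (\<Sum>i\<in>UNIV. pd i (lap (W i)) y)" by (simp add: lap_pd[OF W y])
    finally have 1: "lap d y = (\<Sum>i\<in>UNIV. pd i (lap (W i)) y)" .
    have "mu * pd i (lap (W i)) y + (lam + mu) * pd i (pd i d) y = 0" for i
    proof -
      have "pd i (\<lambda>y. mu * lap (W i) y + (lam + mu) * pd i d y) y = pd i (\<lambda>_. 0::real) y"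
        by (rule pd_cong_ball[OF eq y])
      moreover have "pd i (\<lambda>y. mu * lap (W i) y + (lam + mu) * pd i d y) y = mu * pd i (lap (W i)) y + (lam + mu) * pd i (pd i d) y"
        by (intro has_pd_imp_pd has_pd_add has_pd_cmult Ck_has_pd[OF Ck_lap[OF W] y] Ck_has_pd[OF Ck_pd[OF Cd] y])
      ultimately show ?thesis using z by simp
    qed
    then have "(\<Sum>i\<in>UNIV. mu * pd i (lap (W i)) y + (lam + mu) * pd i (pd i d) y) = 0" by simp
    then have "mu * (\<Sum>i\<in>UNIV. pd i (lap (W i)) y) + (lam + mu) * (\<Sum>i\<in>UNIV. pd i (pd i d) y) = 0"
      by (simp only: sum.distrib sum_distrib_left[symmetric])
    then have "mu * lap d y + (lam + mu) * lap d y = 0"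
      unfolding 1[symmetric] lap_def[of d, symmetric] .
    then have "(2 * mu + lam) * lap d y = 0" by (simp add: algebra_simps)
    then show ?thesis using lam_mu by simp
  qed
  define c where "c = 1 / (2 * (1 - \<alpha>))"
  have c: "2 * (1 - \<alpha>) * c = 1" using alpha_less by (simp add: c_def)
  \<comment> \<open>Dividing \<open>(1 - \<alpha>) * (2 * euler f + f) = d\<close> by
    \<open>2 * (1 - \<alpha>)\<close> leaves \<open>euler f + f / 2\<close>, and the operator
    \<open>euler + 1 / 2\<close> is inverted by \<open>Aop (1 / 2)\<close>.\<close>
  define f where "f = (\<lambda>x. c * Aop (1 / 2) d x)"
  have Cf: "Ck (Suc (Suc (Suc k))) R f" unfolding f_def by (intro Ck_cmult Ck_Aop Cd) simp
  have lf: "lap f y = 0" if y: "norm y < R" for y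
  proof -
    have "Aop (1 / 2 - 2) (lap d) y = Aop (1 / 2 - 2) (\<lambda>_. 0) y" by (rule Aop_cong[OF y ld])
    then show ?thesis unfolding f_def
      using lap_cmult[OF Ck_Aop[OF Cd, of "1/2"] y, of c] lap_Aop[OF Cd _ y, of "1/2"] by (simp add: Aop_def)
  qed
  have ef: "(1 - \<alpha>) * (2 * euler f y + f y) = d y" if y: "norm y < R" for y
  proof -
    have "euler f y = c * euler (Aop (1 / 2) d) y"
      unfolding f_def euler_def pd_cmult[OF Ck_Aop[OF Cd] y, of "1/2", simplified]
      by (simp add: sum_distrib_left mult_ac)
    moreover have dd: "d y = euler (Aop (1 / 2) d) y + Aop (1 / 2) d y / 2"
      using euler_Aop[OF Cd _ y, of "1 / 2"] by simp
    ultimately have "(1 - \<alpha>) * (2 * euler f y + f y) = (2 * (1 - \<alpha>) * c) * d y"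
      by (simp add: f_def dd algebra_simps)
    then show ?thesis using c by simp
  qed
  let ?w = "\<lambda>j x. (1 - norm x ^ 2) * pd j f x"
  have Cw: "Ck (Suc (Suc k)) R (?w j)" for j by (intro Ck_mult Ck_normsq Ck_pd[OF Cf])
  have W2: "Ck (Suc (Suc k)) R (W j)" for j by (rule Ck_lower[OF W]) simp
  define v where "v = (\<lambda>j x. W j x + (- \<beta>) * ?w j x)"
  have Cv: "Ck (Suc (Suc k)) R (v j)" for j unfolding v_def by (intro Ck_add Ck_cmult W2 Cw)
  have lv: "lap (v j) y = 0" if y: "norm y < R" for y j
  proof -
    have "pd j d y = pd j (\<lambda>y. (1 - \<alpha>) * (2 * euler f y + f y)) y"
      by (rule pd_cong_ball[OF ef[symmetric] y])
    also have "\<dots> = (1 - \<alpha>) * (2 * pd j (euler f) y + pd j f y)"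
      by (intro has_pd_imp_pd has_pd_cmult has_pd_add Ck_has_pd[OF Ck_euler[OF Cf] y] Ck_has_pd[OF Cf y])
    also have "\<dots> = (1 - \<alpha>) * (3 * pd j f y + 2 * euler (pd j f) y)"
      unfolding pd_euler[OF Cf y] by simp
    finally have "(lam + mu) * pd j d y = ((lam + mu) * (1 - \<alpha>)) * (3 * pd j f y + 2 * euler (pd j f) y)" by simp
    then have "mu * lap (W j) y = - (2 * mu * \<beta>) * (3 * pd j f y + 2 * euler (pd j f) y)"
      using eq[OF y, of j] unfolding beta_mu by simp
    then have "mu * (lap (W j) y + 2 * \<beta> * (3 * pd j f y + 2 * euler (pd j f) y)) = 0" by (simp add: algebra_simps)
    then have "lap (W j) y + 2 * \<beta> * (3 * pd j f y + 2 * euler (pd j f) y) = 0" using mu_pos by simp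
    moreover have "lap (v j) y = lap (W j) y + (- \<beta>) * (- 2 * (3 * pd j f y + 2 * euler (pd j f) y))"
    proof -
      have "lap (?w j) y = - 2 * (3 * pd j f y + 2 * euler (pd j f) y)"
        by (rule lap_normsq_pd[OF Cf _ y]) (rule lf)
      then show ?thesis
        unfolding v_def lap_add[OF W2 Ck_cmult[OF Cw] y] lap_cmult[OF Cw y] by simp
    qed
    ultimately show ?thesis by (simp add: algebra_simps)
  qed
  let ?p = "\<lambda>i. poissonI sphere_measure (W i)"
  have vp: "v j y = ?p j y" if y: "norm y < 1" for y j
  proof -
    have "v j y = poissonI sphere_measure (v j) y"
    proof (rule poisson_formula[OF _ _ _ y])
      show "Ck (Suc (Suc k)) 1 (v j)" using Ck_subset[OF Cv] R by simp
      show "continuous_on (cball 0 1) (v j)" by (rule continuous_on_subset[OF Ck_continuous[OF Cv]]) (use R in auto)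
    qed (use lv R in auto)
    \<comment> \<open>On the sphere the factor \<open>1 - norm x ^ 2\<close> vanishes, so
      \<open>v j\<close> and \<open>W j\<close> have the same boundary values.\<close>
    also have "\<dots> = ?p j y"
      unfolding poissonI_def v_def
      by (rule Bochner_Integration.integral_cong) (auto simp: space_sphere_measure)
    finally show ?thesis .
  qed
  have dv: "(\<Sum>i\<in>UNIV. pd i (v i) y) = euler f y + (1 - \<alpha>) * f y" if y: "norm y < R" for y
  proof -
    have "pd i (v i) y = pd i (W i) y + (- \<beta>) * pd i (?w i) y" for i
      unfolding v_def pd_add[OF W2 Ck_cmult[OF Cw] y] pd_cmult[OF Cw y] ..
    then have "(\<Sum>i\<in>UNIV. pd i (v i) y) = d y + (- \<beta>) * (\<Sum>i\<in>UNIV. pd i (?w i) y)"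
      by (simp add: d_def sum_subtractf sum_distrib_left sum_negf)
    also have "\<dots> = d y + (2 * \<beta>) * euler f y"
      using div_normsq_pd[OF Cf lf[OF y] y] by simp
    finally show ?thesis unfolding beta_eq ef[OF y, symmetric] by (simp add: algebra_simps)
  qed
  have iW: "integrable sphere_measure (W i)" for i
    by (rule integrable_sphere_continuous, rule continuous_on_subset[OF Ck_continuous[OF W]]) (use R in auto)
  have Cp: "Ck k 1 (?p i)" for k i by (rule Ck_poissonI[OF refl iW])
  \<comment> \<open>\<open>Aop \<alpha>\<close> inverts \<open>euler + (1 - \<alpha>)\<close>, so
    applying it to the divergence of \<open>v\<close> recovers \<open>f\<close>.\<close>
  have fA: "f y = (\<Sum>i\<in>UNIV. Aop \<alpha> (pd i (?p i)) y)" if y: "norm y < 1" for y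
  proof -
    have yR: "norm y < R" using y R by simp
    have "f y = Aop \<alpha> (euler f) y + (1 - \<alpha>) * Aop \<alpha> f y" by (rule Aop_euler[OF Cf alpha_less yR, symmetric])
    also have "\<dots> = Aop \<alpha> (\<lambda>y. euler f y + (1 - \<alpha>) * f y) y"
      unfolding Aop_cmult[symmetric] by (rule Aop_add[OF Ck_euler[OF Cf] Ck_cmult[OF Cf] alpha_less yR, symmetric])
    also have "\<dots> = Aop \<alpha> (\<lambda>y. \<Sum>i\<in>UNIV. pd i (v i) y) y"
      by (rule Aop_cong[OF yR]) (simp add: dv)
    also have "\<dots> = Aop \<alpha> (\<lambda>y. \<Sum>i\<in>UNIV. pd i (?p i) y) y"
      by (rule Aop_cong[OF y], rule sum.cong[OF refl], rule pd_cong_ball[OF vp])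
    also have "\<dots> = (\<Sum>i\<in>UNIV. Aop \<alpha> (pd i (?p i)) y)"
      by (rule Aop_sum[OF finite_class.finite_UNIV Ck_pd[OF Cp[of "Suc 0"]] alpha_less y])
    finally show ?thesis .
  qed
  have "pd j f x = pd j (\<lambda>y. \<Sum>i\<in>UNIV. Aop \<alpha> (pd i (?p i)) y) x" by (rule pd_cong_ball[OF fA x])
  also have "\<dots> = (\<Sum>i\<in>UNIV. pd j (Aop \<alpha> (pd i (?p i))) x)"
    by (rule pd_sum[OF Ck_Aop[OF Ck_pd[OF Cp[of "Suc (Suc 0)"]] alpha_less] x])
  finally have pf: "pd j f x = (\<Sum>i\<in>UNIV. pd j (Aop \<alpha> (pd i (?p i))) x)" .
  have "W j x = v j x + \<beta> * ?w j x" by (simp add: v_def)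
  also have "\<dots> = ?p j x + \<beta> * ((1 - norm x ^ 2) * (\<Sum>i\<in>UNIV. pd j (Aop \<alpha> (pd i (?p i))) x))"
    unfolding vp[OF x] pf ..
  also have "\<dots> = (\<Sum>i\<in>UNIV. kernel_column i (?p i) j x)"
    unfolding kernel_column_def by (simp add: sum.distrib sum_distrib_left)
  finally show ?thesis .
qed

end

section \<open>The elastic Poisson kernel\<close>

lemma measurable_continuous_pair:
  fixes F :: "'a::{metric_space,second_countable_topology} \<times> 'b::{metric_space,second_countable_topology} \<Rightarrow> real"
  assumes F: "continuous_on (A \<times> B) F" and M: "sets M = sets (restrict_space borel A)"
    and N: "sets N = sets (restrict_space borel B)"
  shows "F \<in> borel_measurable (M \<Otimes>\<^sub>M N)"
proof -
  have "(\<lambda>p. p) \<in> measurable (M \<Otimes>\<^sub>M N) (restrict_space borel (A \<times> B))"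
  proof (rule measurable_restrict_space2)
    have f: "fst \<in> measurable (M \<Otimes>\<^sub>M N) borel"
      by (rule measurable_compose[OF measurable_fst measurable_continuous_on_sets[OF continuous_on_id M]])
    have s: "snd \<in> measurable (M \<Otimes>\<^sub>M N) borel"
      by (rule measurable_compose[OF measurable_snd measurable_continuous_on_sets[OF continuous_on_id N]])
    have "(\<lambda>p. (fst p, snd p)) \<in> measurable (M \<Otimes>\<^sub>M N) (borel \<Otimes>\<^sub>M borel)"
      by (rule measurable_Pair[OF f s])
    then show "(\<lambda>p. p) \<in> measurable (M \<Otimes>\<^sub>M N) borel" by (simp add: borel_prod)
    show "(\<lambda>p. p) \<in> space (M \<Otimes>\<^sub>M N) \<rightarrow> A \<times> B"
      using space_eq_of_sets_restrict[OF M] space_eq_of_sets_restrict[OF N] by (auto simp: space_pair_measure)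
  qed
  from measurable_compose[OF this borel_measurable_continuous_on_restrict[OF F]] show ?thesis .
qed

text \<open>A zero at the origin gains one power of \<open>t\<close> along each ray; this tames the
  boundary term with factor \<open>t powr - a\<close> at \<open>t = 0\<close> in the integration by
  parts below.\<close>

lemma dilate_linear_bound:
  assumes h: "Ck (Suc k) R h" and h0: "h 0 = 0" and x: "norm x < R"
  shows "\<exists>C. \<forall>t\<in>{0..1}. \<bar>h (t *\<^sub>R x)\<bar> \<le> C * t"
proof -
  let ?D = "\<lambda>t. \<Sum>i\<in>UNIV. x $ i * pd i h (t *\<^sub>R x)"
  have c: "continuous_on {0..1} ?D"
    by (intro continuous_intros continuous_on_compose2[OF Ck_continuous[OF Ck_pd[OF h]]])
       (auto simp: norm_scale_less[OF x] simp del: norm_scaleR)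
  obtain C where C: "\<forall>t\<in>{0..1}. \<bar>?D t\<bar> \<le> C"
    using compact_imp_bounded[OF compact_continuous_image[OF c compact_Icc]] by (auto simp: bounded_iff)
  have "\<bar>h (t *\<^sub>R x)\<bar> \<le> C * t" if t: "t \<in> {0..1}" for t
  proof -
    have "norm (h (t *\<^sub>R x) - h (0 *\<^sub>R x)) \<le> C * norm (t - 0)"
    proof (rule field_differentiable_bound[where S="{0..1}" and f'="?D"])
      fix s :: real assume s: "s \<in> {0..1}"
      have "((\<lambda>t. h (t *\<^sub>R x)) has_real_derivative ?D s) (at s)"
        by (rule radial_derivative[OF h]) (use s norm_scale_less[OF x] in auto)
      then show "((\<lambda>t. h (t *\<^sub>R x)) has_real_derivative ?D s) (at s within {0..1})"
        by (rule DERIV_subset) simp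
      show "norm (?D s) \<le> C" using C s by auto
    qed (use t in auto)
    then show ?thesis using h0 t by simp
  qed
  then show ?thesis by blast
qed

text \<open>Integration by parts in \<open>t\<close> removes the nonintegrable weight \<open>t powr - (1 + a)\<close> for functions
  vanishing at the origin.\<close>

lemma has_integral_powr_dilate:
  assumes h: "Ck (Suc k) R h" and h0: "h 0 = 0" and x: "norm x < R" and a: "0 < a" "a < 1"
  shows "((\<lambda>t. h (t *\<^sub>R x) / t powr (1 + a)) has_integral
     (1 / a) * ((\<Sum>k\<in>UNIV. x $ k * Aop a (pd k h) x) - h x)) {0..1}"
proof -
  let ?D = "\<lambda>t. \<Sum>i\<in>UNIV. x $ i * (pd i h (t *\<^sub>R x) * t powr - a)"
  let ?G = "\<lambda>t. t powr - a * h (t *\<^sub>R x)"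
  let ?G' = "\<lambda>t. (- a) * (h (t *\<^sub>R x) / t powr (1 + a)) + ?D t"
  have d: "(?G has_real_derivative ?G' t) (at t)" if t: "0 < t" "t \<le> 1" for t
  proof -
    have "((\<lambda>t. h (t *\<^sub>R x)) has_real_derivative (\<Sum>i\<in>UNIV. x $ i * pd i h (t *\<^sub>R x))) (at t)"
      by (rule radial_derivative[OF h]) (use t norm_scale_less[OF x] in auto)
    moreover have "((\<lambda>t. t powr - a) has_real_derivative (- a) * t powr (- a - 1)) (at t)"
      using t by (auto intro!: derivative_eq_intros)
    ultimately have "(?G has_real_derivative t powr - a * (\<Sum>i\<in>UNIV. x $ i * pd i h (t *\<^sub>R x)) +
        (- a) * t powr (- a - 1) * h (t *\<^sub>R x)) (at t)"
      using DERIV_mult'[of "\<lambda>t. t powr - a"] by blast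
    moreover have "t powr (- a - 1) = 1 / t powr (1 + a)"
    proof -
      have "- a - 1 = - (1 + a)" by simp
      then show ?thesis by (simp only: powr_minus_divide)
    qed
    ultimately show ?thesis by (simp add: sum_distrib_left mult_ac add.commute)
  qed
  obtain C where C: "\<forall>t\<in>{0..1}. \<bar>h (t *\<^sub>R x)\<bar> \<le> C * t"
    using dilate_linear_bound[OF h h0 x] by blast
  have cG: "continuous_on {0..1} ?G"
    unfolding continuous_on_eq_continuous_within
  proof
    fix t :: real assume t: "t \<in> {0..1}"
    show "continuous (at t within {0..1}) ?G"
    proof (cases "t = 0")
      case False
      then have "isCont ?G t" by (intro DERIV_isCont[OF d]) (use t in auto)
      then show ?thesis by (rule continuous_at_imp_continuous_at_within)
    next
      case True
      \<comment> \<open>At 0 the default value of \<open>powr\<close> gives \<open>?G\<close> the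
        value 0, which is also its limit by the bound \<open>C * t powr (1 - a)\<close>.\<close>
      have c: "continuous_on {0..1} (\<lambda>t. C * t powr (1 - a))"
        using a by (intro continuous_intros continuous_on_powr') auto
      have "((\<lambda>t. C * t powr (1 - a)) \<longlongrightarrow> C * 0 powr (1 - a)) (at 0 within {0..1})"
        by (rule bspec[OF c[unfolded continuous_on]]) simp
      then have l: "((\<lambda>t. C * t powr (1 - a)) \<longlongrightarrow> 0) (at 0 within {0..1})" using a by simp
      have "eventually (\<lambda>t. norm (?G t) \<le> C * t powr (1 - a)) (at 0 within {0..1})"
        unfolding eventually_at_filter
      proof (intro always_eventually allI impI)
        fix s :: real assume s: "s \<noteq> 0" "s \<in> {0..1}"
        have "norm (?G s) \<le> s powr - a * (C * s)"
          unfolding norm_mult using C s by (intro mult_mono) auto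
        also have "\<dots> = C * s powr (1 - a)" using s powr_add[of s 1 "-a"] by simp
        finally show "norm (?G s) \<le> C * s powr (1 - a)" .
      qed
      then have "(?G \<longlongrightarrow> 0) (at 0 within {0..1})" by (rule Lim_null_comparison[OF _ l])
      then show ?thesis using True by (simp add: continuous_within)
    qed
  qed
  have "(?G' has_integral (?G 1 - ?G 0)) {0..1}"
  proof (rule fundamental_theorem_of_calculus_interior[OF _ cG])
    show "(?G has_vector_derivative ?G' t) (at t)" if "t \<in> {0<..<1}" for t
      unfolding has_real_derivative_iff_has_vector_derivative[symmetric] by (rule d) (use that in auto)
  qed simp
  then have G: "(?G' has_integral h x) {0..1}" by simp
  have int: "integrable I01 (\<lambda>t. x $ i * (pd i h (t *\<^sub>R x) * t powr - a))" for i
    using integrable_Aop[OF Ck_pd[OF h, of i] a(2) x] by simp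
  have intD: "integrable I01 ?D" by (rule Bochner_Integration.integrable_sum) (rule int)
  have D1: "integral {0..1} ?D = (\<integral>t. ?D t \<partial>I01)" and D2: "?D integrable_on {0..1}"
    by (rule integral_I01_eq_integral[OF intD])+
  have D3: "(\<integral>t. ?D t \<partial>I01) = (\<Sum>k\<in>UNIV. x $ k * Aop a (pd k h) x)"
    unfolding Aop_def by (subst Bochner_Integration.integral_sum[OF int]) simp
  have D: "(?D has_integral (\<Sum>k\<in>UNIV. x $ k * Aop a (pd k h) x)) {0..1}"
    using integrable_integral[OF D2] unfolding D1 D3 .
  have "((\<lambda>t. (1 / a) * (?D t - ?G' t)) has_integral (1 / a) * ((\<Sum>k\<in>UNIV. x $ k * Aop a (pd k h) x) - h x)) {0..1}"
    by (intro has_integral_mult_right has_integral_diff D G)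
  moreover have "(\<lambda>t. (1 / a) * (?D t - ?G' t)) = (\<lambda>t. h (t *\<^sub>R x) / t powr (1 + a))"
    using a by (simp add: fun_eq_iff)
  ultimately show ?thesis by simp
qed

section \<open>The integral \<open>PhiK\<close> and its Hessian\<close>

context lame
begin

text \<open>The Poisson kernel minus its first-order Taylor polynomial at the origin. Up to the
  factor \<open>4 * pi\<close> this is the bracket in the integral defining \<open>PhiK\<close>; the
  affine part disappears from the second derivatives.\<close>

definition Pmod :: "R3 \<Rightarrow> R3 \<Rightarrow> real" where
  "Pmod \<eta> y = poissonK y \<eta> - (1 / (4 * pi) + 3 / (4 * pi) * (\<Sum>k\<in>UNIV. \<eta> $ k * y $ k))"

lemma Ck_poissonK: "norm \<eta> = 1 \<Longrightarrow> Ck k 1 (\<lambda>y. poissonK y \<eta>)"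
  by (rule CkP_slice[OF CkP_poissonK]) simp

lemma Ck_Pmod: "norm \<eta> = 1 \<Longrightarrow> Ck k 1 (Pmod \<eta>)"
  unfolding Pmod_def by (intro Ck_diff Ck_poissonK Ck_add Ck_const Ck_cmult Ck_sum Ck_coord)

lemma Pmod_0: "norm \<eta> = 1 \<Longrightarrow> Pmod \<eta> 0 = 0"
  by (simp add: Pmod_def poissonK_def)

lemma pd_Pmod:
  assumes "norm \<eta> = 1" "norm y < 1"
  shows "pd j (Pmod \<eta>) y = pd j (\<lambda>y. poissonK y \<eta>) y - 3 / (4 * pi) * \<eta> $ j"
proof -
  have "has_pd j (Pmod \<eta>) (pd j (\<lambda>y. poissonK y \<eta>) y - (0 + 3 / (4 * pi) * (\<Sum>k\<in>UNIV. \<eta> $ k * (if j = k then 1 else 0)))) y"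
    unfolding Pmod_def
    by (intro has_pd_diff Ck_has_pd[OF Ck_poissonK[OF assms(1)] assms(2)] has_pd_add has_pd_const has_pd_cmult has_pd_sum has_pd_coord)
  moreover have "(\<Sum>k\<in>UNIV. \<eta> $ k * (if j = k then 1 else 0)) = \<eta> $ j"
    using exhaust_3[of j] by (auto simp: sum_3)
  ultimately show ?thesis using has_pd_imp_pd by force
qed

lemma pd_pd_Pmod:
  assumes "norm \<eta> = 1" "norm y < 1"
  shows "pd i (pd j (Pmod \<eta>)) y = pk2 j i y \<eta>"
proof -
  have "pd i (pd j (Pmod \<eta>)) y = pd i (\<lambda>y. pd j (\<lambda>y. poissonK y \<eta>) y - 3 / (4 * pi) * \<eta> $ j) y"
    by (rule pd_cong_ball[OF pd_Pmod[OF assms(1)] assms(2)])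
  also have "\<dots> = pd i (pd j (\<lambda>y. poissonK y \<eta>)) y - 0"
    by (intro has_pd_imp_pd has_pd_diff has_pd_const Ck_has_pd[OF Ck_pd[OF Ck_poissonK[OF assms(1)]] assms(2)])
  also have "\<dots> = pk2 j i y \<eta>" using pd_pd_poissonK[OF assms(2,1)] by simp
  finally show ?thesis .
qed

text \<open>Integration by parts trades the singular weight of the defining integral for dilation
  integrals \<open>Aop \<alpha>\<close>, whose derivatives are known.\<close>

lemma PhiK_eq:
  assumes e: "norm \<eta> = 1" and y: "norm y < 1"
  shows "PhiK lam mu y \<eta> = (1 / \<alpha>) * ((\<Sum>k\<in>UNIV. y $ k * Aop \<alpha> (pd k (Pmod \<eta>)) y) - Pmod \<eta> y)"
proof -
  have eq: "((1 - t^2 * norm y ^ 2) / (1 - 2 * t * (y \<bullet> \<eta>) + t^2 * norm y ^ 2) powr (3/2)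
        - 1 - 3 * t * (y \<bullet> \<eta>)) / t powr (1 + \<alpha>) = 4 * pi * (Pmod \<eta> (t *\<^sub>R y) / t powr (1 + \<alpha>))"
    if t: "t \<in> {0..1}" for t
  proof -
    let ?n = "norm (t *\<^sub>R y - \<eta>)"
    have ty: "norm (t *\<^sub>R y) < 1" using norm_scale_less[OF y] t by auto
    then have n0: "?n > 0" using e by auto
    have "?n ^ 2 = 1 - 2 * t * (y \<bullet> \<eta>) + t^2 * norm y ^ 2"
      using e power2_norm_eq_inner[of "t *\<^sub>R y - \<eta>"] power2_norm_eq_inner[of \<eta>] power2_norm_eq_inner[of y]
      by (simp add: inner_diff_left inner_diff_right inner_commute power2_eq_square algebra_simps)
    then have "1 - 2 * t * (y \<bullet> \<eta>) + t^2 * norm y ^ 2 = ?n powr 2"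
      using powr_numeral[OF less_imp_le[OF n0], of "Num.Bit0 Num.One"] by (simp only:)
    then have "(1 - 2 * t * (y \<bullet> \<eta>) + t^2 * norm y ^ 2) powr (3/2) = (?n powr 2) powr (3/2)"
      by (simp only:)
    also have "\<dots> = ?n powr 3" by (simp only: powr_powr) simp
    also have "\<dots> = ?n ^ 3" using powr_numeral[OF less_imp_le[OF n0], of "Num.Bit1 Num.One"] by (simp only:)
    finally have p: "(1 - 2 * t * (y \<bullet> \<eta>) + t^2 * norm y ^ 2) powr (3/2) = ?n ^ 3" .
    have "4 * pi * Pmod \<eta> (t *\<^sub>R y) = (1 - t^2 * norm y ^ 2) / ?n ^ 3 - 1 - 3 * t * (y \<bullet> \<eta>)"
    proof -
      have "(y \<bullet> \<eta>) = (\<Sum>k\<in>UNIV. \<eta> $ k * y $ k)" by (simp add: inner_vec_def mult.commute)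
      then have s: "(\<Sum>k\<in>UNIV. \<eta> $ k * (t *\<^sub>R y) $ k) = t * (y \<bullet> \<eta>)" by (simp add: sum_distrib_left mult_ac)
      have "4 * pi * poissonK (t *\<^sub>R y) \<eta> = (1 - t^2 * norm y ^ 2) / ?n ^ 3"
        by (simp add: poissonK_def power_mult_distrib)
      then show ?thesis unfolding Pmod_def s by (simp add: right_diff_distrib distrib_left)
    qed
    then show ?thesis unfolding p by simp
  qed
  have "PhiK lam mu y \<eta> = 1 / (4 * pi) * integral {0..1} (\<lambda>t. 4 * pi * (Pmod \<eta> (t *\<^sub>R y) / t powr (1 + \<alpha>)))"
    unfolding PhiK_def by (subst integral_cong[OF eq]) simp_all
  also have "\<dots> = integral {0..1} (\<lambda>t. Pmod \<eta> (t *\<^sub>R y) / t powr (1 + \<alpha>))"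
    by (simp only: Henstock_Kurzweil_Integration.integral_mult_right) simp
  also have "\<dots> = (1 / \<alpha>) * ((\<Sum>k\<in>UNIV. y $ k * Aop \<alpha> (pd k (Pmod \<eta>)) y) - Pmod \<eta> y)"
    by (rule integral_unique[OF has_integral_powr_dilate[OF Ck_Pmod[OF e] Pmod_0[OF e] y alpha_pos alpha_less]])
  finally show ?thesis .
qed

text \<open>The boundary terms left by integration by parts cancel: with
  \<open>g = pd j (Pmod \<eta>)\<close>, differentiation gives \<open>(1 / \<alpha>) * (euler (Aop
  \<alpha> g) + Aop \<alpha> g - g)\<close>, and
  \<open>euler (Aop \<alpha> g) = g - (1 - \<alpha>) * Aop \<alpha> g\<close>.\<close>

lemma pd_PhiK:
  assumes e: "norm \<eta> = 1" and y: "norm y < 1"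
  shows "pd j (\<lambda>y. PhiK lam mu y \<eta>) y = Aop \<alpha> (pd j (Pmod \<eta>)) y"
proof -
  let ?h = "Pmod \<eta>"
  let ?g = "pd j ?h"
  note C = Ck_Pmod[OF e]
  have "pd j (\<lambda>y. PhiK lam mu y \<eta>) y = pd j (\<lambda>y. (1 / \<alpha>) * ((\<Sum>k\<in>UNIV. y $ k * Aop \<alpha> (pd k ?h) y) - ?h y)) y"
    by (rule pd_cong_ball[OF PhiK_eq[OF e] y])
  also have "\<dots> = (1 / \<alpha>) * ((\<Sum>k\<in>UNIV. y $ k * pd j (Aop \<alpha> (pd k ?h)) y + (if j = k then 1 else 0) * Aop \<alpha> (pd k ?h) y) - ?g y)"
    by (intro has_pd_imp_pd has_pd_cmult has_pd_diff has_pd_sum has_pd_mult has_pd_coord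
        Ck_has_pd[OF C y] Ck_has_pd[OF Ck_Aop[OF Ck_pd[OF C] alpha_less] y])
  also have "(\<Sum>k\<in>UNIV. y $ k * pd j (Aop \<alpha> (pd k ?h)) y + (if j = k then 1 else 0) * Aop \<alpha> (pd k ?h) y)
     = (\<Sum>k\<in>UNIV. y $ k * pd j (Aop \<alpha> (pd k ?h)) y) + Aop \<alpha> ?g y"
    by (simp add: sum.distrib if_distrib[of "\<lambda>c. c * _"] cong: if_cong)
  also have "(\<Sum>k\<in>UNIV. y $ k * pd j (Aop \<alpha> (pd k ?h)) y) = euler (Aop \<alpha> ?g) y"
    unfolding euler_def
  proof (rule sum.cong[OF refl])
    fix k
    have "pd j (Aop \<alpha> (pd k ?h)) y = Aop (\<alpha> - 1) (pd j (pd k ?h)) y"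
      by (rule pd_Aop[OF Ck_pd[OF C] alpha_less y])
    also have "\<dots> = Aop (\<alpha> - 1) (pd k ?g) y"
      by (rule Aop_cong[OF y pd_commute[OF C]])
    also have "\<dots> = pd k (Aop \<alpha> ?g) y"
      by (rule pd_Aop[OF Ck_pd[OF C] alpha_less y, symmetric])
    finally show "y $ k * pd j (Aop \<alpha> (pd k ?h)) y = y $ k * pd k (Aop \<alpha> ?g) y" by simp
  qed
  also have "euler (Aop \<alpha> ?g) y = ?g y - (1 - \<alpha>) * Aop \<alpha> ?g y"
    using euler_Aop[OF Ck_pd[OF C, of "Suc 0" j] alpha_less y] by simp
  finally show ?thesis using alpha_pos by (simp add: field_simps)
qed

lemma pd_pd_PhiK:
  assumes e: "norm \<eta> = 1" and y: "norm y < 1"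
  shows "pd i (pd j (\<lambda>y. PhiK lam mu y \<eta>)) y = Aop (\<alpha> - 1) (\<lambda>y. pk2 j i y \<eta>) y"
proof -
  have "pd i (pd j (\<lambda>y. PhiK lam mu y \<eta>)) y = pd i (Aop \<alpha> (pd j (Pmod \<eta>))) y"
    by (rule pd_cong_ball[OF pd_PhiK[OF e] y])
  also have "\<dots> = Aop (\<alpha> - 1) (pd i (pd j (Pmod \<eta>))) y"
    by (rule pd_Aop[OF Ck_pd[OF Ck_Pmod[OF e]] alpha_less y])
  also have "\<dots> = Aop (\<alpha> - 1) (\<lambda>y. pk2 j i y \<eta>) y"
    by (rule Aop_cong[OF y pd_pd_Pmod[OF e]])
  finally show ?thesis .
qed

text \<open>Entry (i, j) of the Hessian of \<open>PhiK\<close>. Two derivatives have turned the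
  weight into \<open>t powr (1 - \<alpha>)\<close>, bounded by 1 on the unit interval.\<close>

definition Psi :: "3 \<Rightarrow> 3 \<Rightarrow> R3 \<Rightarrow> R3 \<Rightarrow> real" where
  "Psi i j x \<eta> = Aop (\<alpha> - 1) (\<lambda>y. pk2 j i y \<eta>) x"

lemma kernel_entry:
  assumes "norm x < 1" "norm \<eta> = 1"
  shows "elastic_poisson_kernel lam mu x \<eta> $ j $ i =
    (if i = j then poissonK x \<eta> else 0) + \<beta> * ((1 - norm x ^ 2) * Psi j i x \<eta>)"
  unfolding elastic_poisson_kernel_def LK_def Psi_def
  using pd_pd_PhiK[OF assms(2,1)] by (simp add: mat_def)

lemma continuous_on_pk2_dilate:
  assumes x: "norm x < 1"
  shows "continuous_on (S2 \<times> {0..1}) (\<lambda>(\<eta>, t). pk2 i j (t *\<^sub>R x) \<eta>)"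
proof -
  have "continuous_on (S2 \<times> {0..1}) (\<lambda>p. (snd p *\<^sub>R x, fst p))" by (intro continuous_intros)
  then have "continuous_on (S2 \<times> {0..1}) (\<lambda>p. (\<lambda>(x, \<eta>). pk2 i j x \<eta>) (snd p *\<^sub>R x, fst p))"
    by (rule continuous_on_compose2[OF continuous_on_pk2])
       (auto simp: norm_scale_less[OF x] simp del: norm_scaleR)
  then show ?thesis by (simp add: case_prod_beta')
qed

lemma Psi_eq: "Psi i j x \<eta> = (\<integral>t. pk2 j i (t *\<^sub>R x) \<eta> * t powr (1 - \<alpha>) \<partial>I01)"
  by (simp add: Psi_def Aop_def)

lemma integrable_powr_alpha: "integrable I01 (\<lambda>t. t powr (1 - \<alpha>))"
  using integrable_I01_powr[of "\<alpha> - 1"] alpha_less by simp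

lemma continuous_on_Psi: "norm x < 1 \<Longrightarrow> continuous_on S2 (Psi i j x)"
  unfolding Psi_eq[abs_def]
  by (rule continuous_on_param_integral[OF continuous_on_pk2_dilate compact_Icc sets_I01 integrable_powr_alpha])

lemma continuous_on_kernel:
  assumes "norm x < 1" shows "continuous_on S2 (\<lambda>\<eta>. elastic_poisson_kernel lam mu x \<eta> $ j $ i)"
proof -
  have "continuous_on S2 (\<lambda>\<eta>. (if i = j then poissonK x \<eta> else 0) + \<beta> * ((1 - norm x ^ 2) * Psi j i x \<eta>))"
    using assms by (cases "i = j") (auto intro!: continuous_intros continuous_on_Psi continuous_on_poissonK)
  then show ?thesis
    by (rule continuous_on_eq) (simp add: kernel_entry[OF assms])
qed

text \<open>Fubini exchanges the boundary point \<eta> with the dilation parameter, so integrating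
  the explicit kernel amounts to applying the differential construction to a Poisson integral.
  Boundedness of \<open>pk2\<close> on the compact product gives the integrability.\<close>

lemma integral_Psi:
  assumes M: "sets M = sets sphere_measure" "finite_measure M" and g: "integrable M g" and x: "norm x < 1"
  shows "(\<integral>\<eta>. Psi j i x \<eta> * g \<eta> \<partial>M) = pd j (Aop \<alpha> (pd i (poissonI M g))) x"
proof -
  note M' = M(1)[unfolded sets_sphere_measure]
  have spM: "space M = S2" by (rule space_eq_of_sets_restrict[OF M'])
  interpret M: finite_measure M by (rule M(2))
  interpret I: prob_space I01 by (rule prob_space_I01)
  interpret P: pair_sigma_finite M I01 ..
  let ?F = "\<lambda>(\<eta>, t). pk2 i j (t *\<^sub>R x) \<eta>"
  let ?f = "\<lambda>(\<eta>, t). pk2 i j (t *\<^sub>R x) \<eta> * t powr (1 - \<alpha>) * g \<eta>"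
  have "compact (S2 \<times> {0..1::real})" by (intro compact_Times compact_sphere compact_Icc)
  from compact_imp_bounded[OF compact_continuous_image[OF continuous_on_pk2_dilate[OF x] this]]
  obtain C0 where "\<forall>q\<in>?F ` (S2 \<times> {0..1}). norm q \<le> C0" unfolding bounded_iff by blast
  then have C0: "\<forall>p\<in>S2 \<times> {0..1}. \<bar>?F p\<bar> \<le> C0" by (metis imageI real_norm_def)
  define C where "C = \<bar>C0\<bar>"
  have Cnn: "C \<ge> 0" and C: "\<forall>p\<in>S2 \<times> {0..1}. \<bar>?F p\<bar> \<le> C" using C0 abs_ge_self[of C0] order_trans unfolding C_def by (simp, blast)
  have mF: "?F \<in> borel_measurable (M \<Otimes>\<^sub>M I01)"
    by (rule measurable_continuous_pair[OF continuous_on_pk2_dilate[OF x] M' sets_I01])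
  have mg: "(\<lambda>p. g (fst p)) \<in> borel_measurable (M \<Otimes>\<^sub>M I01)"
    by (rule measurable_compose[OF measurable_fst borel_measurable_integrable[OF g]])
  have mt: "(\<lambda>p. snd p powr (1 - \<alpha>)) \<in> borel_measurable (M \<Otimes>\<^sub>M I01)"
    by (rule measurable_compose[OF measurable_snd borel_measurable_integrable[OF integrable_powr_alpha]])
  have mf: "?f \<in> borel_measurable (M \<Otimes>\<^sub>M I01)"
    using borel_measurable_times[OF borel_measurable_times[OF mF mt] mg] by (simp add: case_prod_beta')
  have int: "integrable (M \<Otimes>\<^sub>M I01) ?f"
  proof (rule P.Fubini_integrable[OF mf])
    have "integrable M (\<lambda>\<eta>. C * \<bar>g \<eta>\<bar>)" using g by simp
    then show "integrable M (\<lambda>\<eta>. \<integral>t. norm (?f (\<eta>, t)) \<partial>I01)"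
    proof (rule Bochner_Integration.integrable_bound)
      show "(\<lambda>\<eta>. \<integral>t. norm (?f (\<eta>, t)) \<partial>I01) \<in> borel_measurable M"
        using mf by (intro I.borel_measurable_lebesgue_integral) simp
      show "AE \<eta> in M. norm (\<integral>t. norm (?f (\<eta>, t)) \<partial>I01) \<le> norm (C * \<bar>g \<eta>\<bar>)"
      proof (rule AE_I2)
        fix \<eta> assume e: "\<eta> \<in> space M"
        have "(\<integral>t. norm (?f (\<eta>, t)) \<partial>I01) \<le> (\<integral>t. C * \<bar>g \<eta>\<bar> \<partial>I01)"
        proof (rule integral_mono_AE')
          show "AE t in I01. norm (?f (\<eta>, t)) \<le> C * \<bar>g \<eta>\<bar>"
          proof (rule AE_I2)
            fix t assume t: "t \<in> space I01"
            have b: "\<bar>pk2 i j (t *\<^sub>R x) \<eta>\<bar> \<le> C"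
              using C e t by (auto simp: spM space_I01)
            have "\<bar>pk2 i j (t *\<^sub>R x) \<eta>\<bar> * \<bar>t powr (1 - \<alpha>)\<bar> \<le> C * 1"
              using b t Cnn alpha_less by (intro mult_mono) (auto simp: spM space_I01 powr_le_one_le intro: powr_le1)
            then show "norm (?f (\<eta>, t)) \<le> C * \<bar>g \<eta>\<bar>"
              by (simp add: abs_mult mult_right_mono)
          qed
        qed (use Cnn in \<open>auto intro: integrable_I01_const\<close>)
        then show "norm (\<integral>t. norm (?f (\<eta>, t)) \<partial>I01) \<le> norm (C * \<bar>g \<eta>\<bar>)" by simp
      qed
    qed
    show "AE \<eta> in M. integrable I01 (\<lambda>t. ?f (\<eta>, t))"
    proof (rule AE_I2)
      fix \<eta> assume "\<eta> \<in> space M"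
      then have "\<eta> \<in> S2" by (simp add: spM)
      then have "integrable I01 (\<lambda>t. pk2 i j (t *\<^sub>R x) \<eta> * t powr (1 - \<alpha>))"
        by (intro integrable_continuous_mult[OF _ compact_Icc sets_I01 integrable_powr_alpha]
            continuous_on_param_slice[OF continuous_on_pk2_dilate[OF x]])
      then show "integrable I01 (\<lambda>t. ?f (\<eta>, t))" by simp
    qed
  qed
  have "(\<integral>\<eta>. Psi j i x \<eta> * g \<eta> \<partial>M) = (\<integral>\<eta>. (\<integral>t. ?f (\<eta>, t) \<partial>I01) \<partial>M)"
    unfolding Psi_eq by simp
  also have "\<dots> = (\<integral>t. (\<integral>\<eta>. ?f (\<eta>, t) \<partial>M) \<partial>I01)"
    using P.Fubini_integral[OF int] by simp
  also have "\<dots> = (\<integral>t. (\<integral>\<eta>. pk2 i j (t *\<^sub>R x) \<eta> * g \<eta> \<partial>M) * t powr - (\<alpha> - 1) \<partial>I01)"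
  proof (rule Bochner_Integration.integral_cong[OF refl])
    fix t
    have "(\<integral>\<eta>. ?f (\<eta>, t) \<partial>M) = (\<integral>\<eta>. (pk2 i j (t *\<^sub>R x) \<eta> * g \<eta>) * t powr (1 - \<alpha>) \<partial>M)"
      by (rule Bochner_Integration.integral_cong) simp_all
    then show "(\<integral>\<eta>. ?f (\<eta>, t) \<partial>M) = (\<integral>\<eta>. pk2 i j (t *\<^sub>R x) \<eta> * g \<eta> \<partial>M) * t powr - (\<alpha> - 1)"
      by simp
  qed
  also have "\<dots> = (\<integral>t. pd j (pd i (poissonI M g)) (t *\<^sub>R x) * t powr - (\<alpha> - 1) \<partial>I01)"
  proof (rule Bochner_Integration.integral_cong[OF refl])
    fix t assume "t \<in> space I01"
    then have "norm (t *\<^sub>R x) < 1" by (intro norm_scale_less[OF x]) (auto simp: space_I01)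
    then show "(\<integral>\<eta>. pk2 i j (t *\<^sub>R x) \<eta> * g \<eta> \<partial>M) * t powr - (\<alpha> - 1) =
      pd j (pd i (poissonI M g)) (t *\<^sub>R x) * t powr - (\<alpha> - 1)"
      by (simp only: pd_pd_poissonI[OF M(1) g])
  qed
  also have "\<dots> = pd j (Aop \<alpha> (pd i (poissonI M g))) x"
    unfolding Aop_def[symmetric]
    by (rule pd_Aop[OF Ck_pd[OF Ck_poissonI[OF M(1) g]] alpha_less x, symmetric])
  finally show ?thesis .
qed

text \<open>Bridge between two descriptions of the elastic Poisson integral: estimates use the
  kernel on the left, differential equations the column on the right.\<close>

lemma integral_kernel:
  assumes M: "sets M = sets sphere_measure" "finite_measure M" and g: "integrable M g" and x: "norm x < 1"
  shows "(\<integral>\<eta>. elastic_poisson_kernel lam mu x \<eta> $ j $ i * g \<eta> \<partial>M) = kernel_column i (poissonI M g) j x"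
proof -
  note M' = M(1)[unfolded sets_sphere_measure]
  have sp: "space M = S2" by (rule space_eq_of_sets_restrict[OF M'])
  have i1: "integrable M (\<lambda>\<eta>. (if i = j then poissonK x \<eta> else 0) * g \<eta>)"
    by (rule integrable_continuous_mult[OF _ compact_sphere M' g])
       (cases "i = j", auto intro: continuous_on_poissonK[OF x])
  have i2: "integrable M (\<lambda>\<eta>. Psi j i x \<eta> * g \<eta>)"
    by (rule integrable_continuous_mult[OF continuous_on_Psi[OF x] compact_sphere M' g])
  have "(\<integral>\<eta>. elastic_poisson_kernel lam mu x \<eta> $ j $ i * g \<eta> \<partial>M) =
     (\<integral>\<eta>. (if i = j then poissonK x \<eta> else 0) * g \<eta> + (\<beta> * (1 - norm x ^ 2)) * (Psi j i x \<eta> * g \<eta>) \<partial>M)"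
    by (rule Bochner_Integration.integral_cong) (auto simp: kernel_entry[OF x] sp algebra_simps)
  also have "\<dots> = (\<integral>\<eta>. (if i = j then poissonK x \<eta> else 0) * g \<eta> \<partial>M) + (\<beta> * (1 - norm x ^ 2)) * (\<integral>\<eta>. Psi j i x \<eta> * g \<eta> \<partial>M)"
    using i1 i2 by simp
  also have "\<dots> = kernel_column i (poissonI M g) j x"
    unfolding integral_Psi[OF assms] kernel_column_def by (auto simp: poissonI_def)
  finally show ?thesis .
qed

end

section \<open>Kernel bound and components of vector fields\<close>

text \<open>The distance from \<open>t x\<close> to \<eta> is at least \<open>1 - t\<close> and at
  least \<open>norm (x - \<eta>) - (1 - t)\<close>; the claim combines these bounds with weights 3/4
  and 1/4.\<close>

lemma norm_dilate_lower:
  fixes x \<eta> :: R3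
  assumes x: "norm x < 1" and e: "norm \<eta> = 1" and t: "0 \<le> t" "t \<le> 1"
  shows "norm (t *\<^sub>R x - \<eta>) \<ge> ((1 - t) + norm (x - \<eta>) / 2) / 2"
proof -
  have "t * norm x \<le> t * 1" using x t by (intro mult_left_mono) auto
  moreover have "norm (t *\<^sub>R x - \<eta>) \<ge> 1 - t * norm x"
    using norm_triangle_ineq2[of \<eta> "t *\<^sub>R x"] e t by (simp add: norm_minus_commute)
  ultimately have 1: "norm (t *\<^sub>R x - \<eta>) \<ge> 1 - t" by simp
  have "norm (x - \<eta>) \<le> norm (t *\<^sub>R x - \<eta>) + norm ((1 - t) *\<^sub>R x)"
    using norm_triangle_ineq[of "t *\<^sub>R x - \<eta>" "(1 - t) *\<^sub>R x"] by (simp add: algebra_simps)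
  moreover have "norm ((1 - t) *\<^sub>R x) \<le> 1 - t"
    using mult_left_mono[of "norm x" 1 "1 - t"] x t by simp
  ultimately show ?thesis using 1 by simp
qed

text \<open>Integrating the fourth inverse power of the distance along the ray gains one power,
  leaving the third inverse power that occurs in the Poisson kernel.\<close>

lemma integral_pk2_bound:
  assumes x: "norm x < 1" and e: "norm \<eta> = 1" and w: "\<And>t. t \<in> {0..1} \<Longrightarrow> \<bar>w t\<bar> \<le> 1" "integrable I01 w"
  shows "\<bar>\<integral>t. pk2 i j (t *\<^sub>R x) \<eta> * w t \<partial>I01\<bar> \<le> 2219 * (1 / (4 * pi) * rinv x \<eta> ^ 3)"
proof -
  define d where "d = norm (x - \<eta>) / 2"
  have d: "d > 0" using ball_neq_sphere[OF x e] by (simp add: d_def)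
  \<comment> \<open>832 is 52 times 16: 52 from \<open>pk2_bound\<close>, 16 from the fourth power
    of the factor 2 lost in \<open>norm_dilate_lower\<close>.\<close>
  let ?b = "\<lambda>t. 1 / (4 * pi) * 832 * (1 / ((1 - t) + d) ^ 4)"
  have b: "\<bar>pk2 i j (t *\<^sub>R x) \<eta> * w t\<bar> \<le> ?b t" if t: "t \<in> {0..1}" for t
  proof -
    have tx: "norm (t *\<^sub>R x) < 1" by (rule norm_scale_less[OF x]) (use t in auto)
    have p: "(1 - t) + d > 0" using t d by (simp add: add_nonneg_pos)
    have "((1 - t) + d) / 2 \<le> norm (t *\<^sub>R x - \<eta>)" unfolding d_def by (rule norm_dilate_lower[OF x e]) (use t in auto)
    then have "rinv (t *\<^sub>R x) \<eta> \<le> 2 / ((1 - t) + d)"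
      unfolding rinv_def using p le_imp_inverse_le[of "((1 - t) + d) / 2"] by (simp add: inverse_eq_divide)
    moreover have "0 \<le> rinv (t *\<^sub>R x) \<eta>" by (simp add: rinv_def)
    ultimately have "rinv (t *\<^sub>R x) \<eta> ^ 4 \<le> (2 / ((1 - t) + d)) ^ 4" by (rule power_mono)
    also have "\<dots> = 16 * (1 / ((1 - t) + d) ^ 4)" by (simp add: power_divide)
    finally have r: "52 * rinv (t *\<^sub>R x) \<eta> ^ 4 \<le> 832 * (1 / ((1 - t) + d) ^ 4)" by simp
    have "\<bar>pk2 i j (t *\<^sub>R x) \<eta> * w t\<bar> \<le> \<bar>pk2 i j (t *\<^sub>R x) \<eta>\<bar> * 1"
      unfolding abs_mult using w(1)[OF t] by (intro mult_left_mono) auto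
    also have "\<dots> \<le> 1 / (4 * pi) * (52 * rinv (t *\<^sub>R x) \<eta> ^ 4)" using pk2_bound[OF tx e] by simp
    also have "\<dots> \<le> 1 / (4 * pi) * (832 * (1 / ((1 - t) + d) ^ 4))" using r by (intro mult_left_mono) auto
    finally show ?thesis by (simp add: mult.assoc)
  qed
  have cb: "continuous_on {0..1} (\<lambda>t. 1 / ((1 - t) + d) ^ 4)"
    using d by (intro continuous_intros) (auto simp: add_nonneg_eq_0_iff)
  have "continuous_on {0..1} (\<lambda>t. pk2 i j (t *\<^sub>R x) \<eta>)"
  proof -
    have "continuous_on {0..1} (\<lambda>t. (t *\<^sub>R x, \<eta>))" by (intro continuous_intros)
    then have "continuous_on {0..1} (\<lambda>t. (\<lambda>(x, \<eta>). pk2 i j x \<eta>) (t *\<^sub>R x, \<eta>))"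
      by (rule continuous_on_compose2[OF continuous_on_pk2])
         (use e in \<open>auto simp: norm_scale_less[OF x] simp del: norm_scaleR\<close>)
    then show ?thesis by simp
  qed
  then have i1: "integrable I01 (\<lambda>t. pk2 i j (t *\<^sub>R x) \<eta> * w t)"
    by (rule integrable_continuous_mult[OF _ compact_Icc sets_I01 w(2)])
  have ib: "integrable I01 (\<lambda>t. 1 / ((1 - t) + d) ^ 4)" by (rule integrable_I01_continuous[OF cb])
  have "\<bar>\<integral>t. pk2 i j (t *\<^sub>R x) \<eta> * w t \<partial>I01\<bar> \<le> (\<integral>t. ?b t \<partial>I01)"
  proof (rule order_trans[OF integral_abs_bound integral_mono])
    show "integrable I01 ?b" by (rule integrable_I01_continuous[OF continuous_on_mult_left[OF cb]])
  qed (use i1 b in \<open>auto simp: space_I01\<close>)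
  also have "\<dots> = 1 / (4 * pi) * 832 * (\<integral>t. 1 / ((1 - t) + d) ^ 4 \<partial>I01)"
    by (simp only: integral_mult_right_zero)
  also have "(\<integral>t. 1 / ((1 - t) + d) ^ 4 \<partial>I01) = 1 / (3 * ((1 - 1) + d) ^ 3) - 1 / (3 * ((1 - 0) + d) ^ 3)"
  proof (rule integral_I01_FTC[OF _ _ ib])
    show "continuous_on {0..1} (\<lambda>t. 1 / (3 * ((1 - t) + d) ^ 3))"
      using d by (intro continuous_intros) (auto simp: add_nonneg_eq_0_iff)
    show "((\<lambda>t. 1 / (3 * ((1 - t) + d) ^ 3)) has_real_derivative 1 / ((1 - t) + d) ^ 4) (at t)"
      if "t \<in> {0<..<1}" for t
    proof -
      have s: "(1 - t) + d > 0" using that d by auto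
      have "((\<lambda>t. 1 / (3 * ((1 - t) + d) ^ 3)) has_real_derivative
         (0 * (3 * ((1 - t) + d) ^ 3) - 1 * (3 * (3 * ((1 - t) + d) ^ 2 * (- 1)))) / ((3 * ((1 - t) + d) ^ 3) * (3 * ((1 - t) + d) ^ 3))) (at t)"
        using s by (auto intro!: derivative_eq_intros)
      moreover have "(0 * (3 * s ^ 3) - 1 * (3 * (3 * s ^ 2 * (- 1)))) / ((3 * s ^ 3) * (3 * s ^ 3)) = 1 / s ^ 4"
        if "s > 0" for s :: real
        using that by (simp add: divide_simps eval_nat_numeral)
      ultimately show ?thesis using s by simp
    qed
  qed
  also have "1 / (4 * pi) * 832 * (1 / (3 * ((1 - 1) + d) ^ 3) - 1 / (3 * ((1 - 0) + d) ^ 3)) \<le> 1 / (4 * pi) * 832 * (1 / (3 * d ^ 3))"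
    using d by (intro mult_left_mono) auto
  \<comment> \<open>Undoing \<open>d = norm (x - \<eta>) / 2\<close> gives 832 times 8/3, that is
    6656/3, rounded up to 2219.\<close>
  also have "\<dots> = 6656 / 3 * (1 / (4 * pi) * rinv x \<eta> ^ 3)"
    by (simp add: d_def rinv_def power_divide power_inverse divide_simps)
  also have "\<dots> \<le> 2219 * (1 / (4 * pi) * rinv x \<eta> ^ 3)"
    by (intro mult_right_mono) (auto simp: rinv_def)
  finally show ?thesis .
qed

context lame
begin

definition "kernel_const = 1 + \<bar>\<beta>\<bar> * 2219"

lemma kernel_const_pos: "kernel_const > 0"
  unfolding kernel_const_def by (simp add: add_pos_nonneg)

lemma kernel_bound:
  assumes x: "norm x < 1" and e: "norm \<eta> = 1"
  shows "\<bar>elastic_poisson_kernel lam mu x \<eta> $ j $ i\<bar> \<le> kernel_const * poissonK x \<eta>"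
proof -
  have n: "0 \<le> 1 - norm x ^ 2" using x by (simp add: power_le_one)
  have "\<bar>Psi j i x \<eta>\<bar> \<le> 2219 * (1 / (4 * pi) * rinv x \<eta> ^ 3)"
    unfolding Psi_eq using alpha_less
    by (intro integral_pk2_bound[OF x e _ integrable_powr_alpha]) (auto intro: powr_le1)
  then have "(1 - norm x ^ 2) * \<bar>Psi j i x \<eta>\<bar> \<le> (1 - norm x ^ 2) * (2219 * (1 / (4 * pi) * rinv x \<eta> ^ 3))"
    by (rule mult_left_mono[OF _ n])
  also have "\<dots> = 2219 * poissonK x \<eta>" by (simp add: poissonK_rinv)
  finally have "\<bar>\<beta>\<bar> * ((1 - norm x ^ 2) * \<bar>Psi j i x \<eta>\<bar>) \<le> \<bar>\<beta>\<bar> * (2219 * poissonK x \<eta>)"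
    by (rule mult_left_mono) simp
  moreover have "\<bar>\<beta> * ((1 - norm x ^ 2) * Psi j i x \<eta>)\<bar> = \<bar>\<beta>\<bar> * ((1 - norm x ^ 2) * \<bar>Psi j i x \<eta>\<bar>)"
    using n by (simp add: abs_mult)
  moreover have "\<bar>if i = j then poissonK x \<eta> else 0\<bar> \<le> poissonK x \<eta>" using poissonK_nonneg[OF x] by simp
  moreover have "kernel_const * poissonK x \<eta> = poissonK x \<eta> + \<bar>\<beta>\<bar> * (2219 * poissonK x \<eta>)"
    by (simp add: kernel_const_def algebra_simps)
  ultimately show ?thesis unfolding kernel_entry[OF x e]
    by (intro order_trans[OF abs_triangle_ineq]) linarith
qed

end

section \<open>Vector fields and their components\<close>

lemma has_vector_derivative_vec_iff:
  fixes f :: "real \<Rightarrow> real ^ 'n"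
  shows "(f has_vector_derivative D) (at t) \<longleftrightarrow> (\<forall>j. ((\<lambda>t. f t $ j) has_vector_derivative D $ j) (at t))"
  unfolding has_vector_derivative_def
  by (subst has_derivative_componentwise_within) (auto simp: Basis_vec_def inner_axis)

lemma has_vector_derivative_line_vec:
  fixes v :: "R3 \<Rightarrow> R3"
  assumes V: "\<And>j. Ck (Suc k) R (V j)" and x: "norm x < R" and eq: "\<And>y. norm y < R \<Longrightarrow> v y = (\<chi> j. V j y)"
  shows "((\<lambda>t. v (x + t *\<^sub>R axis i 1)) has_vector_derivative (\<chi> j. pd i (V j) x)) (at 0)"
proof (rule iffD1[OF has_vector_derivative_cong_ev])
  show "((\<lambda>t. (\<chi> j. V j (x + t *\<^sub>R axis i 1))) has_vector_derivative (\<chi> j. pd i (V j) x)) (at 0)"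
    unfolding has_vector_derivative_vec_iff
    using Ck_has_pd[OF V x] by (simp add: has_pd_def has_real_derivative_iff_has_vector_derivative)
  show "eventually (\<lambda>t. t \<in> UNIV \<longrightarrow> (\<chi> j. V j (x + t *\<^sub>R axis i 1)) = v (x + t *\<^sub>R axis i 1)) (nhds 0)"
    by (rule eventually_mono[OF eventually_line(2)[OF open_ball, of x 0 R i]]) (use x eq in auto)
  show "(\<chi> j. V j (x + 0 *\<^sub>R axis i 1)) = v (x + 0 *\<^sub>R axis i 1)"
    using eq[OF x] by simp
qed

lemma pd_vec:
  fixes v :: "R3 \<Rightarrow> R3"
  assumes V: "\<And>j. Ck (Suc k) R (V j)" and x: "norm x < R" and eq: "\<And>y. norm y < R \<Longrightarrow> v y = (\<chi> j. V j y)"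
  shows "pd i v x = (\<chi> j. pd i (V j) x)"
  unfolding pd_def[of i v] by (rule vector_derivative_at[OF has_vector_derivative_line_vec[OF assms]])

lemma continuous_on_ball_vec:
  fixes v :: "R3 \<Rightarrow> R3"
  assumes "\<And>j. Ck k R (V j)" "\<And>y. norm y < R \<Longrightarrow> v y = (\<chi> j. V j y)"
  shows "continuous_on (ball 0 R) v"
proof -
  have "continuous_on (ball 0 R) (\<lambda>y. \<chi> j. V j y)"
    by (intro continuous_on_vec_lambda Ck_continuous[OF assms(1)])
  then show ?thesis by (rule continuous_on_eq) (use assms(2) in auto)
qed

text \<open>A vector-valued derivative exists exactly when those of the components do, so the vector
  calculus of the problem reduces to the scalar classes \<open>Ck\<close>.\<close>

lemma C2_ball_iff: "C2_ball u \<longleftrightarrow> (\<forall>j. Ck (Suc (Suc 0)) 1 (\<lambda>x. u x $ j))"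
proof
  assume C: "\<forall>j. Ck (Suc (Suc 0)) 1 (\<lambda>x. u x $ j)"
  let ?U = "\<lambda>j x. u x $ j"
  have C2: "Ck (Suc (Suc 0)) 1 (?U j)" for j using C by blast
  have C1: "Ck (Suc 0) 1 (pd i (?U j))" for i j by (rule Ck_pd[OF C2])
  have u: "u y = (\<chi> j. ?U j y)" for y by simp
  have d: "pd i u x = (\<chi> j. pd i (?U j) x)" if "norm x < 1" for i x
    by (rule pd_vec[OF C2 that u])
  have dd: "pd i' (pd i u) x = (\<chi> j. pd i' (pd i (?U j)) x)" if "norm x < 1" for i i' x
    by (rule pd_vec[OF C1 that d])
  show "C2_ball u"
    unfolding C2_ball_def
  proof (intro conjI allI ballI)
    show "continuous_on (ball 0 1) u" by (rule continuous_on_ball_vec[OF C2 u])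
    show "continuous_on (ball 0 1) (pd i u)" for i by (rule continuous_on_ball_vec[OF C1 d])
    show "continuous_on (ball 0 1) (pd j (pd i u))" for i j by (rule continuous_on_ball_vec[OF Ck_pd[OF C1] dd])
    show "(\<lambda>t. u (x + t *\<^sub>R axis i 1)) differentiable at 0" if "x \<in> ball 0 1" for i x
      using has_vector_derivative_line_vec[OF C2 _ u, of x] that by (auto intro: differentiableI_vector)
    show "(\<lambda>t. pd i u (x + t *\<^sub>R axis j 1)) differentiable at 0" if "x \<in> ball 0 1" for i j x
      using has_vector_derivative_line_vec[OF C1 _ d, of x] that by (auto intro: differentiableI_vector)
  qed
next
  assume C: "C2_ball u"
  have h1: "has_pd i (\<lambda>y. u y $ j) (pd i u x $ j) x" if "norm x < 1" for i j x
  proof -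
    have "(\<lambda>t. u (x + t *\<^sub>R axis i 1)) differentiable at 0" using C that unfolding C2_ball_def by auto
    then have "((\<lambda>t. u (x + t *\<^sub>R axis i 1)) has_vector_derivative pd i u x) (at 0)"
      unfolding pd_def by (simp only: vector_derivative_works)
    then show ?thesis
      unfolding has_pd_def has_real_derivative_iff_has_vector_derivative has_vector_derivative_vec_iff by simp
  qed
  have h2: "has_pd i' (\<lambda>y. pd i u y $ j) (pd i' (pd i u) x $ j) x" if "norm x < 1" for i i' j x
  proof -
    have "(\<lambda>t. pd i u (x + t *\<^sub>R axis i' 1)) differentiable at 0" using C that unfolding C2_ball_def by auto
    then have "((\<lambda>t. pd i u (x + t *\<^sub>R axis i' 1)) has_vector_derivative pd i' (pd i u) x) (at 0)"
      unfolding pd_def[of i'] by (simp only: vector_derivative_works)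
    then show ?thesis
      unfolding has_pd_def has_real_derivative_iff_has_vector_derivative has_vector_derivative_vec_iff by simp
  qed
  have c: "continuous_on (ball 0 1) u" "\<And>i. continuous_on (ball 0 1) (pd i u)" "\<And>i j. continuous_on (ball 0 1) (pd j (pd i u))"
    using C unfolding C2_ball_def by auto
  have CC: "CkP (Suc 0) 1 {0::real} (\<lambda>x _. pd i u x $ j)" for i j
    by (rule CkP_SucI[where D="\<lambda>i' x _. pd i' (pd i u) x $ j"])
       (use c h2 in \<open>auto simp: continuous_on_fst_param intro!: continuous_on_component\<close>)
  have "CkP (Suc (Suc 0)) 1 {0::real} (\<lambda>x _. u x $ j)" for j
    by (rule CkP_SucI[where D="\<lambda>i x _. pd i u x $ j"])
       (use c h1 CC in \<open>auto simp: continuous_on_fst_param simp del: CkP.simps intro!: continuous_on_component\<close>)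
  then show "\<forall>j. Ck (Suc (Suc 0)) 1 (\<lambda>x. u x $ j)" unfolding Ck_def by blast
qed

context lame
begin

lemma elastic_harmonic_iff:
  "elastic_harmonic lam mu u \<longleftrightarrow>
     (\<forall>j. Ck (Suc (Suc 0)) 1 (\<lambda>x. u x $ j)) \<and> lame_solution 1 (\<lambda>j x. u x $ j)"
proof -
  have "(\<forall>x\<in>ball 0 1. lame_op lam mu u x = 0) \<longleftrightarrow> lame_solution 1 (\<lambda>j x. u x $ j)"
    if C: "\<forall>j. Ck (Suc (Suc 0)) 1 (\<lambda>x. u x $ j)"
  proof -
    let ?U = "\<lambda>j x. u x $ j"
    have C2: "Ck (Suc (Suc 0)) 1 (?U j)" for j using C by blast
    have C1: "Ck (Suc 0) 1 (pd i (?U j))" for i j by (rule Ck_pd[OF C2])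
    have u: "u y = (\<chi> j. ?U j y)" for y by simp
    have d: "pd i u x = (\<chi> j. pd i (?U j) x)" if "norm x < 1" for i x
      by (rule pd_vec[OF C2 that u])
    have dd: "pd i' (pd i u) x = (\<chi> j. pd i' (pd i (?U j)) x)" if "norm x < 1" for i i' x
      by (rule pd_vec[OF C1 that d])
    have "lame_op lam mu u x $ j = mu * lap (?U j) x + (lam + mu) * pd j (\<lambda>y. \<Sum>i\<in>UNIV. pd i (?U i) y) x"
      if x: "norm x < 1" for x j
    proof -
      have "pd j (divg u) x = pd j (\<lambda>y. \<Sum>i\<in>UNIV. pd i (?U i) y) x"
        by (rule pd_cong_ball[OF _ x]) (simp add: divg_def d)
      then show ?thesis by (simp add: lame_op_def lap_def dd[OF x])
    qed
    then show ?thesis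
      unfolding lame_solution_def vec_eq_iff by auto
  qed
  then show ?thesis unfolding elastic_harmonic_def C2_ball_iff by blast
qed

lemma lame_solution_sum:
  assumes "\<And>a j. a \<in> A \<Longrightarrow> Ck (Suc (Suc k)) R (w a j)" "\<And>a. a \<in> A \<Longrightarrow> lame_solution R (w a)"
  shows "lame_solution R (\<lambda>j x. \<Sum>a\<in>A. c a * w a j x)"
  unfolding lame_solution_def
proof (intro allI impI)
  fix x :: R3 and j assume x: "norm x < R"
  have l: "lap (\<lambda>x. \<Sum>a\<in>A. c a * w a j x) x = (\<Sum>a\<in>A. c a * lap (w a j) x)"
    by (subst lap_sum[OF Ck_cmult[OF assms(1)] x]) (simp_all add: lap_cmult[OF assms(1) x])
  have d: "pd i (\<lambda>x. \<Sum>a\<in>A. c a * w a j x) y = (\<Sum>a\<in>A. c a * pd i (w a j) y)" if y: "norm y < R" for y i j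
    by (subst pd_sum[OF Ck_cmult[OF assms(1)] y]) (simp_all add: pd_cmult[OF assms(1) y])
  have "pd j (\<lambda>y. \<Sum>i\<in>UNIV. pd i (\<lambda>x. \<Sum>a\<in>A. c a * w a i x) y) x
     = pd j (\<lambda>y. \<Sum>a\<in>A. c a * (\<Sum>i\<in>UNIV. pd i (w a i) y)) x"
  proof (rule pd_cong_ball[OF _ x])
    fix y :: R3 assume y: "norm y < R"
    show "(\<Sum>i\<in>UNIV. pd i (\<lambda>x. \<Sum>a\<in>A. c a * w a i x) y) = (\<Sum>a\<in>A. c a * (\<Sum>i\<in>UNIV. pd i (w a i) y))"
      unfolding d[OF y] by (subst sum.swap) (simp add: sum_distrib_left)
  qed
  also have "\<dots> = (\<Sum>a\<in>A. c a * pd j (\<lambda>y. \<Sum>i\<in>UNIV. pd i (w a i) y) x)"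
    by (intro has_pd_imp_pd has_pd_sum has_pd_cmult Ck_has_pd[OF Ck_sum[OF Ck_pd[OF assms(1)]] x])
  finally have p: "pd j (\<lambda>y. \<Sum>i\<in>UNIV. pd i (\<lambda>x. \<Sum>a\<in>A. c a * w a i x) y) x =
     (\<Sum>a\<in>A. c a * pd j (\<lambda>y. \<Sum>i\<in>UNIV. pd i (w a i) y) x)" .
  have "mu * (\<Sum>a\<in>A. c a * lap (w a j) x) + (lam + mu) * (\<Sum>a\<in>A. c a * pd j (\<lambda>y. \<Sum>i\<in>UNIV. pd i (w a i) y) x)
    = (\<Sum>a\<in>A. c a * (mu * lap (w a j) x + (lam + mu) * pd j (\<lambda>y. \<Sum>i\<in>UNIV. pd i (w a i) y) x))"
    by (simp add: sum_distrib_left sum.distrib algebra_simps)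
  also have "\<dots> = 0" using assms(2) x by (intro sum.neutral) (auto simp: lame_solution_def)
  finally show "mu * lap (\<lambda>x. \<Sum>a\<in>A. c a * w a j x) x +
     (lam + mu) * pd j (\<lambda>y. \<Sum>i\<in>UNIV. pd i (\<lambda>x. \<Sum>a\<in>A. c a * w a i x) y) x = 0"
    unfolding l p .
qed

lemma lame_solution_cong:
  assumes "\<And>j x. norm x < R \<Longrightarrow> u j x = v j x"
  shows "lame_solution R u \<longleftrightarrow> lame_solution R v"
proof -
  have "lap (u j) x = lap (v j) x" "pd j (\<lambda>y. \<Sum>i\<in>UNIV. pd i (u i) y) x = pd j (\<lambda>y. \<Sum>i\<in>UNIV. pd i (v i) y) x"
    if x: "norm x < R" for x j
  proof -
    show "lap (u j) x = lap (v j) x" by (rule lap_cong[OF assms x])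
    show "pd j (\<lambda>y. \<Sum>i\<in>UNIV. pd i (u i) y) x = pd j (\<lambda>y. \<Sum>i\<in>UNIV. pd i (v i) y) x"
      by (rule pd_cong_ball[OF _ x], rule sum.cong[OF refl], rule pd_cong_ball[OF assms])
  qed
  then show ?thesis unfolding lame_solution_def by simp
qed

text \<open>The index set is left open: three columns for a boundary function, six (component and
  sign) for a vector measure.\<close>

lemma elastic_harmonic_columns:
  fixes A :: "'a set" and M :: "'a \<Rightarrow> R3 measure"
  assumes M: "\<And>a. sets (M a) = sets sphere_measure" and g: "\<And>a. integrable (M a) (g a)"
    and u: "\<And>j x. norm x < 1 \<Longrightarrow> u x $ j = (\<Sum>a\<in>A. c a * kernel_column (i a) (poissonI (M a) (g a)) j x)"
  shows "elastic_harmonic lam mu u"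
proof -
  let ?w = "\<lambda>a. kernel_column (i a) (poissonI (M a) (g a))"
  have C: "Ck k 1 (?w a j)" for a j k
    by (rule Ck_column[OF Ck_poissonI[OF M g]])
  have s: "lame_solution 1 (?w a)" for a
    by (rule lame_solution_column[OF Ck_poissonI[OF M g] lap_poissonI[OF M g]])
  have "lame_solution 1 (\<lambda>j x. \<Sum>a\<in>A. c a * ?w a j x)" by (rule lame_solution_sum[OF C s])
  then have "lame_solution 1 (\<lambda>j x. u x $ j)" using lame_solution_cong[of 1 "\<lambda>j x. u x $ j" "\<lambda>j x. \<Sum>a\<in>A. c a * ?w a j x"] u by blast
  moreover have "Ck (Suc (Suc 0)) 1 (\<lambda>x. \<Sum>a\<in>A. c a * ?w a j x)" for j by (intro Ck_sum Ck_cmult C)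
  then have "Ck (Suc (Suc 0)) 1 (\<lambda>x. u x $ j)" for j
    using Ck_cong[of 1 "\<lambda>x. u x $ j" "\<lambda>x. \<Sum>a\<in>A. c a * ?w a j x"] u by blast
  ultimately show ?thesis unfolding elastic_harmonic_iff by blast
qed

end

section \<open>Elastic Poisson integrals lie in the Hardy spaces\<close>

lemma R3_expansion: "x = (\<Sum>j\<in>UNIV. (x $ j) *\<^sub>R axis j (1::real))" for x :: R3
  using basis_expansion[of x] by (simp add: scalar_mult_eq_scaleR)

lemma integrable_vecI:
  fixes F :: "'a \<Rightarrow> R3"
  assumes "\<And>j. integrable M (\<lambda>x. F x $ j)"
  shows "integrable M F"
proof -
  have "integrable M (\<lambda>x. \<Sum>j\<in>UNIV. (F x $ j) *\<^sub>R axis j (1::real))"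
    by (intro Bochner_Integration.integrable_sum integrable_scaleR_left assms)
  then show ?thesis by (simp flip: R3_expansion)
qed

lemma integrable_vec_nth: "integrable M F \<Longrightarrow> integrable M (\<lambda>x. F x $ j)" for F :: "'a \<Rightarrow> R3"
  by (rule integrable_bounded_linear[OF bounded_linear_vec_nth])

lemma integral_vec_nth:
  fixes F :: "'a \<Rightarrow> R3"
  assumes "integrable M F" shows "(\<integral>x. F x \<partial>M) $ j = (\<integral>x. F x $ j \<partial>M)"
  by (rule integral_bounded_linear[OF bounded_linear_vec_nth assms, symmetric])

text \<open>Both squared distances equal \<open>1 + r ^ 2\<close> minus \<open>2 * r\<close> times
  the inner product of the unit vectors. This lets the mass identity in \<eta> serve for integration
  over \<open>w\<close>.\<close>

lemma poissonK_symmetric: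
  assumes "norm w = 1" "norm \<eta> = 1"
  shows "poissonK (r *\<^sub>R w) \<eta> = poissonK (r *\<^sub>R \<eta>) w"
proof -
  have e: "norm w ^ 2 = 1" "norm \<eta> ^ 2 = 1" using assms by simp_all
  have "norm (r *\<^sub>R w - \<eta>) ^ 2 = norm (r *\<^sub>R \<eta> - w) ^ 2"
    using e by (simp add: power2_norm_eq_inner inner_diff_left inner_diff_right inner_commute)
  then have "norm (r *\<^sub>R w - \<eta>) = norm (r *\<^sub>R \<eta> - w)" by simp
  then show ?thesis by (simp add: poissonK_def assms)
qed

lemma poissonI_nonneg: "norm x < 1 \<Longrightarrow> (\<And>\<eta>. k \<eta> \<ge> 0) \<Longrightarrow> poissonI M k x \<ge> 0"
  unfolding poissonI_def by (intro Bochner_Integration.integral_nonneg mult_nonneg_nonneg poissonK_nonneg) auto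

lemma integrable_poissonK_mult:
  assumes "sets M = sets sphere_measure" "integrable M k" "norm x < 1"
  shows "integrable M (\<lambda>\<eta>. poissonK x \<eta> * k \<eta>)"
  by (rule integrable_continuous_mult[OF continuous_on_poissonK[OF assms(3)] compact_sphere _ assms(2)])
     (use assms(1) in \<open>simp add: sets_sphere_measure\<close>)

lemma continuous_on_poissonI_dilate:
  assumes "sets M = sets sphere_measure" "integrable M k" "0 \<le> r" "r < 1"
  shows "continuous_on S2 (\<lambda>w. poissonI M k (r *\<^sub>R w))"
  by (rule continuous_on_compose2[OF Ck_continuous[OF Ck_poissonI[OF assms(1,2), of 0]]])
     (use assms in \<open>auto intro!: continuous_intros\<close>)

text \<open>Tonelli and the symmetry of the kernel: integrated first over the sphere of radius
  \<open>r\<close>, the kernel gives mass one to each boundary point. The Hardy space bounds for all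
  finite p come from this.\<close>

lemma nn_integral_poissonI_sphere:
  assumes M: "sets M = sets sphere_measure" "finite_measure M" and k: "integrable M k" "\<And>\<eta>. k \<eta> \<ge> 0"
    and r: "0 \<le> r" "r < 1"
  shows "(\<integral>\<^sup>+ w. ennreal (poissonI M k (r *\<^sub>R w)) \<partial>sphere_measure) = ennreal (\<integral>\<eta>. k \<eta> \<partial>M)"
proof -
  note M' = M(1)[unfolded sets_sphere_measure]
  have sp: "space M = S2" by (rule space_eq_of_sets_restrict[OF M'])
  interpret M: finite_measure M by (rule M(2))
  interpret S: finite_measure sphere_measure by (rule finite_sphere_measure)
  interpret P: pair_sigma_finite M sphere_measure ..
  have n1: "norm (r *\<^sub>R w) < 1" if "w \<in> S2" for w :: R3 using that r by simp
  have "continuous_on (S2 \<times> S2) (\<lambda>p. (r *\<^sub>R snd p, fst p))" by (intro continuous_intros)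
  then have "continuous_on (S2 \<times> S2) (\<lambda>p. (\<lambda>(x, z). poissonK x z) (r *\<^sub>R snd p, fst p))"
    by (rule continuous_on_compose2[OF CkP_imp_continuous[OF CkP_poissonK[of 0]]]) (use r in auto)
  then have "continuous_on (S2 \<times> S2) (\<lambda>p. poissonK (r *\<^sub>R snd p) (fst p))" by simp
  from measurable_continuous_pair[OF this M' sets_sphere_measure]
  have mP: "(\<lambda>p. poissonK (r *\<^sub>R snd p) (fst p)) \<in> borel_measurable (M \<Otimes>\<^sub>M sphere_measure)" .
  have mk: "(\<lambda>p. k (fst p)) \<in> borel_measurable (M \<Otimes>\<^sub>M sphere_measure)"
    by (rule measurable_compose[OF measurable_fst borel_measurable_integrable[OF k(1)]])
  have m: "(\<lambda>p. ennreal (poissonK (r *\<^sub>R snd p) (fst p) * k (fst p))) \<in> borel_measurable (M \<Otimes>\<^sub>M sphere_measure)"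
    by (rule measurable_compose[OF borel_measurable_times[OF mP mk] measurable_ennreal])
  have "(\<integral>\<^sup>+ w. ennreal (poissonI M k (r *\<^sub>R w)) \<partial>sphere_measure) =
     (\<integral>\<^sup>+ w. \<integral>\<^sup>+ \<eta>. ennreal (poissonK (r *\<^sub>R w) \<eta> * k \<eta>) \<partial>M \<partial>sphere_measure)"
  proof (rule nn_integral_cong)
    fix w assume "w \<in> space sphere_measure"
    then have "norm (r *\<^sub>R w) < 1" using n1 by (simp add: space_sphere_measure)
    then show "ennreal (poissonI M k (r *\<^sub>R w)) = (\<integral>\<^sup>+ \<eta>. ennreal (poissonK (r *\<^sub>R w) \<eta> * k \<eta>) \<partial>M)"
      unfolding poissonI_def using k(2) poissonK_nonneg
      by (intro nn_integral_eq_integral[symmetric] integrable_poissonK_mult[OF M(1) k(1)]) auto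
  qed
  also have "\<dots> = (\<integral>\<^sup>+ \<eta>. \<integral>\<^sup>+ w. ennreal (poissonK (r *\<^sub>R w) \<eta> * k \<eta>) \<partial>sphere_measure \<partial>M)"
    using P.Fubini[OF m] by simp
  also have "\<dots> = (\<integral>\<^sup>+ \<eta>. ennreal (k \<eta>) \<partial>M)"
  proof (rule nn_integral_cong)
    fix \<eta> assume "\<eta> \<in> space M"
    then have e: "\<eta> \<in> S2" by (simp add: sp)
    have c: "continuous_on S2 (poissonK (r *\<^sub>R \<eta>))" by (rule continuous_on_poissonK[OF n1[OF e]])
    have "(\<integral>\<^sup>+ w. ennreal (poissonK (r *\<^sub>R w) \<eta> * k \<eta>) \<partial>sphere_measure) =
        (\<integral>\<^sup>+ w. ennreal (poissonK (r *\<^sub>R \<eta>) w * k \<eta>) \<partial>sphere_measure)"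
      by (rule nn_integral_cong) (use e in \<open>simp add: space_sphere_measure poissonK_symmetric\<close>)
    also have "\<dots> = ennreal (\<integral>w. poissonK (r *\<^sub>R \<eta>) w * k \<eta> \<partial>sphere_measure)"
      by (rule nn_integral_eq_integral)
         (use poissonK_nonneg[OF n1[OF e]] k(2) in \<open>auto intro!: integrable_sphere_continuous continuous_intros c\<close>)
    also have "(\<integral>w. poissonK (r *\<^sub>R \<eta>) w * k \<eta> \<partial>sphere_measure) = k \<eta>"
      by (simp add: integral_poissonK[OF n1[OF e]])
    finally show "(\<integral>\<^sup>+ w. ennreal (poissonK (r *\<^sub>R w) \<eta> * k \<eta>) \<partial>sphere_measure) = ennreal (k \<eta>)" .
  qed
  also have "\<dots> = ennreal (\<integral>\<eta>. k \<eta> \<partial>M)"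
    by (rule nn_integral_eq_integral[OF k(1)]) (simp add: k(2))
  finally show ?thesis .
qed

text \<open>Supporting line of a convex power at \<open>a\<close>; averaging it yields both Jensen's
  inequality and midpoint convexity. The endpoint \<open>b = 0\<close> lies outside the open
  half-line and is computed by hand.\<close>

lemma powr_ge_tangent:
  fixes a b p :: real
  assumes "p \<ge> 1" "a > 0" "b \<ge> 0"
  shows "b powr p \<ge> a powr p + p * a powr (p - 1) * (b - a)"
proof (cases "b = 0")
  case True
  have "a powr (p - 1) * a = a powr p" using assms powr_add[of a "p - 1" 1] by simp
  then have "a powr p + p * a powr (p - 1) * (b - a) = (1 - p) * a powr p" using True by (simp add: algebra_simps)
  also have "\<dots> \<le> 0" using assms by (simp add: mult_nonpos_nonneg)
  finally show ?thesis using True by simp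
next
  case False
  have "b powr p - a powr p \<ge> (p * a powr (p - 1)) * (b - a)"
    by (rule convex_on_imp_above_tangent[OF powr_convex[OF assms(1)]])
       (use assms False in \<open>auto intro!: derivative_eq_intros simp: interior_open\<close>)
  then show ?thesis by simp
qed

text \<open>Integrate the supporting-line inequality at the mean \<open>a\<close> against the
  kernel, a probability density: the linear term averages to zero. The line requires
  \<open>a > 0\<close>; for \<open>a = 0\<close> positivity suffices.\<close>

lemma poissonI_jensen:
  assumes p: "p \<ge> 1" and h: "integrable sphere_measure h" "\<And>\<eta>. h \<eta> \<ge> 0"
    and hp: "integrable sphere_measure (\<lambda>\<eta>. h \<eta> powr p)" and x: "norm x < 1"
  shows "poissonI sphere_measure h x powr p \<le> poissonI sphere_measure (\<lambda>\<eta>. h \<eta> powr p) x"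
proof -
  define a where "a = poissonI sphere_measure h x"
  have a0: "a \<ge> 0" unfolding a_def by (rule poissonI_nonneg[OF x h(2)])
  show ?thesis
  proof (cases "a = 0")
    case True
    then show ?thesis unfolding a_def[symmetric]
      using poissonI_nonneg[OF x, of "\<lambda>\<eta>. h \<eta> powr p" sphere_measure] by simp
  next
    case False
    then have a: "a > 0" using a0 by simp
    note i1 = integrable_poissonK_mult[OF refl h(1) x] and i2 = integrable_poissonK_mult[OF refl hp x]
      and i0 = integrable_poissonK_mult[OF refl integrable_sphere_const x]
    have "a powr p = (\<integral>\<eta>. poissonK x \<eta> * (a powr p - p * a powr (p - 1) * a) \<partial>sphere_measure) +
       p * a powr (p - 1) * (\<integral>\<eta>. poissonK x \<eta> * h \<eta> \<partial>sphere_measure)"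
      using a_def unfolding poissonI_def by (simp add: integral_poissonK[OF x])
    also have "\<dots> = (\<integral>\<eta>. poissonK x \<eta> * (a powr p - p * a powr (p - 1) * a) + p * a powr (p - 1) * (poissonK x \<eta> * h \<eta>) \<partial>sphere_measure)"
      by (subst Bochner_Integration.integral_add[OF i0 integrable_mult_right[OF i1]]) (simp only: integral_mult_right_zero)
    also have "\<dots> \<le> (\<integral>\<eta>. poissonK x \<eta> * h \<eta> powr p \<partial>sphere_measure)"
    proof (rule integral_mono)
      show "integrable sphere_measure (\<lambda>\<eta>. poissonK x \<eta> * (a powr p - p * a powr (p - 1) * a) + p * a powr (p - 1) * (poissonK x \<eta> * h \<eta>))"
        by (intro Bochner_Integration.integrable_add i0 integrable_mult_right i1)
      fix \<eta>
      have "poissonK x \<eta> * (a powr p + p * a powr (p - 1) * (h \<eta> - a)) \<le> poissonK x \<eta> * h \<eta> powr p"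
        by (intro mult_left_mono powr_ge_tangent p a h(2) poissonK_nonneg[OF x])
      then show "poissonK x \<eta> * (a powr p - p * a powr (p - 1) * a) + p * a powr (p - 1) * (poissonK x \<eta> * h \<eta>) \<le> poissonK x \<eta> * h \<eta> powr p"
        by (simp add: algebra_simps)
    qed (rule i2)
    finally show ?thesis unfolding a_def poissonI_def .
  qed
qed

lemma sum_UNIV_prod_bool:
  fixes F :: "'a::finite \<times> bool \<Rightarrow> real"
  shows "(\<Sum>a\<in>UNIV. F a) = (\<Sum>i\<in>UNIV. F (i, True) + F (i, False))"
proof -
  have "(\<Sum>a\<in>UNIV. F a) = (\<Sum>(i, b)\<in>UNIV \<times> UNIV. F (i, b))" by simp
  also have "\<dots> = (\<Sum>i\<in>UNIV. \<Sum>b\<in>UNIV. F (i, b))" by (rule sum.cartesian_product[symmetric])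
  finally show ?thesis by (simp add: UNIV_bool add.commute)
qed

context lame
begin

lemma Pe_component:
  assumes f: "integrable sphere_measure f" and x: "norm x < 1"
  shows "Pe lam mu f x $ j = (\<Sum>i\<in>UNIV. kernel_column i (poissonI sphere_measure (\<lambda>\<eta>. f \<eta> $ i)) j x)"
proof -
  have int: "integrable sphere_measure (\<lambda>\<eta>. elastic_poisson_kernel lam mu x \<eta> $ j $ i * f \<eta> $ i)" for i j
    by (rule integrable_continuous_mult[OF continuous_on_kernel[OF x] compact_sphere sets_sphere_measure integrable_vec_nth[OF f]])
  have e: "(elastic_poisson_kernel lam mu x \<eta> *v f \<eta>) $ j = (\<Sum>i\<in>UNIV. elastic_poisson_kernel lam mu x \<eta> $ j $ i * f \<eta> $ i)" for \<eta> j
    by (simp add: matrix_vector_mult_def)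
  have "integrable sphere_measure (\<lambda>\<eta>. elastic_poisson_kernel lam mu x \<eta> *v f \<eta>)"
    by (rule integrable_vecI) (unfold e, intro Bochner_Integration.integrable_sum int)
  then have "Pe lam mu f x $ j = (\<integral>\<eta>. (\<Sum>i\<in>UNIV. elastic_poisson_kernel lam mu x \<eta> $ j $ i * f \<eta> $ i) \<partial>sphere_measure)"
    unfolding Pe_def by (simp add: integral_vec_nth e)
  also have "\<dots> = (\<Sum>i\<in>UNIV. \<integral>\<eta>. elastic_poisson_kernel lam mu x \<eta> $ j $ i * f \<eta> $ i \<partial>sphere_measure)"
    by (rule Bochner_Integration.integral_sum[OF int])
  also have "\<dots> = (\<Sum>i\<in>UNIV. kernel_column i (poissonI sphere_measure (\<lambda>\<eta>. f \<eta> $ i)) j x)"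
    by (simp add: integral_kernel[OF refl finite_sphere_measure integrable_vec_nth[OF f] x])
  finally show ?thesis .
qed

lemma column_bound:
  assumes M: "sets M = sets sphere_measure" "finite_measure M" and g: "integrable M g" "integrable M k"
    and le: "AE \<eta> in M. \<bar>g \<eta>\<bar> \<le> k \<eta>" and x: "norm x < 1"
  shows "\<bar>kernel_column i (poissonI M g) j x\<bar> \<le> kernel_const * poissonI M k x"
proof -
  note M' = M(1)[unfolded sets_sphere_measure]
  have sp: "space M = S2" by (rule space_eq_of_sets_restrict[OF M'])
  have i1: "integrable M (\<lambda>\<eta>. elastic_poisson_kernel lam mu x \<eta> $ j $ i * g \<eta>)"
    by (rule integrable_continuous_mult[OF continuous_on_kernel[OF x] compact_sphere M' g(1)])
  have i2: "integrable M (\<lambda>\<eta>. kernel_const * (poissonK x \<eta> * k \<eta>))"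
    by (intro integrable_mult_right integrable_poissonK_mult M g x)
  have "\<bar>kernel_column i (poissonI M g) j x\<bar> \<le> (\<integral>\<eta>. \<bar>elastic_poisson_kernel lam mu x \<eta> $ j $ i * g \<eta>\<bar> \<partial>M)"
    unfolding integral_kernel[OF M g(1) x, symmetric] by (rule integral_abs_bound)
  also have "\<dots> \<le> (\<integral>\<eta>. kernel_const * (poissonK x \<eta> * k \<eta>) \<partial>M)"
  proof (rule integral_mono_AE)
    show "AE \<eta> in M. \<bar>elastic_poisson_kernel lam mu x \<eta> $ j $ i * g \<eta>\<bar> \<le> kernel_const * (poissonK x \<eta> * k \<eta>)"
      using le
    proof (rule AE_mp, intro AE_I2 impI)
      fix \<eta> assume "\<eta> \<in> space M" and g: "\<bar>g \<eta>\<bar> \<le> k \<eta>"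
      then have "norm \<eta> = 1" by (simp add: sp)
      from kernel_bound[OF x this, of j i] g
      have "\<bar>elastic_poisson_kernel lam mu x \<eta> $ j $ i\<bar> * \<bar>g \<eta>\<bar> \<le> (kernel_const * poissonK x \<eta>) * k \<eta>"
        using kernel_const_pos poissonK_nonneg[OF x, of \<eta>] by (intro mult_mono) auto
      then show "\<bar>elastic_poisson_kernel lam mu x \<eta> $ j $ i * g \<eta>\<bar> \<le> kernel_const * (poissonK x \<eta> * k \<eta>)"
        by (simp add: abs_mult mult.assoc)
    qed
  qed (use i1 i2 in auto)
  also have "\<dots> = kernel_const * poissonI M k x" by (simp add: poissonI_def)
  finally show ?thesis .
qed

text \<open>The factor 9 counts the entries of the kernel: three columns for each of three
  components.\<close>

lemma Pe_bound:
  assumes f: "integrable sphere_measure f" "integrable sphere_measure k"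
    and le: "AE \<eta> in sphere_measure. norm (f \<eta>) \<le> k \<eta>" and x: "norm x < 1"
  shows "norm (Pe lam mu f x) \<le> 9 * kernel_const * poissonI sphere_measure k x"
proof -
  have c: "\<bar>kernel_column i (poissonI sphere_measure (\<lambda>\<eta>. f \<eta> $ i)) j x\<bar> \<le> kernel_const * poissonI sphere_measure k x" for i j
    by (rule column_bound[OF refl finite_sphere_measure integrable_vec_nth[OF f(1)] f(2) _ x])
       (use le in eventually_elim, metis component_le_norm_cart order_trans)
  have "\<bar>Pe lam mu f x $ j\<bar> \<le> (\<Sum>i::3\<in>UNIV. kernel_const * poissonI sphere_measure k x)" for j
    unfolding Pe_component[OF f(1) x] by (rule order_trans[OF sum_abs sum_mono]) (rule c)
  then have j: "\<bar>Pe lam mu f x $ j\<bar> \<le> 3 * (kernel_const * poissonI sphere_measure k x)" for j by simp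
  have "norm (Pe lam mu f x) \<le> (\<Sum>j\<in>UNIV. \<bar>Pe lam mu f x $ j\<bar>)" by (rule norm_le_l1_cart)
  also have "\<dots> \<le> (\<Sum>j::3\<in>UNIV. 3 * (kernel_const * poissonI sphere_measure k x))" by (rule sum_mono) (rule j)
  finally show ?thesis by simp
qed

lemma Pe_cong_ball_elastic:
  assumes f: "integrable sphere_measure f" and u: "\<And>x. norm x < 1 \<Longrightarrow> u x = Pe lam mu f x"
  shows "elastic_harmonic lam mu u"
  by (rule elastic_harmonic_columns[where A=UNIV and i="\<lambda>i. i" and c="\<lambda>_. 1" and M="\<lambda>_. sphere_measure" and g="\<lambda>i \<eta>. f \<eta> $ i"])
     (use integrable_vec_nth[OF f] in \<open>auto simp: u Pe_component[OF f]\<close>)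

lemma Lp_integrable:
  assumes f: "f \<in> Lp_sphere p" and p: "1 < p"
  shows "integrable sphere_measure f"
    and "p \<noteq> \<infinity> \<Longrightarrow> integrable sphere_measure (\<lambda>w. norm (f w) powr real_of_ereal p)"
proof -
  have m[measurable]: "f \<in> borel_measurable sphere_measure" using f by (simp add: Lp_sphere_def)
  show i: "integrable sphere_measure (\<lambda>w. norm (f w) powr real_of_ereal p)" if "p \<noteq> \<infinity>"
    using f that by (intro integrableI_bounded) (auto simp: Lp_sphere_def)
  show "integrable sphere_measure f"
  proof (cases "p = \<infinity>")
    case True
    then obtain C where "AE w in sphere_measure. norm (f w) \<le> C" using f by (auto simp: Lp_sphere_def)
    then show ?thesis
      by (intro finite_measure.integrable_const_bound[OF finite_sphere_measure _ m])
  next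
    case False
    then have rp: "real_of_ereal p \<ge> 1" using p by (cases p) auto
    have "norm (f w) \<le> 1 + norm (f w) powr real_of_ereal p" for w
    proof (cases "norm (f w) \<le> 1")
      case False
      then have "norm (f w) powr 1 \<le> norm (f w) powr real_of_ereal p" using rp by (intro powr_mono) auto
      then show ?thesis using False by simp
    qed (simp add: add_increasing2)
    then show ?thesis
      by (intro Bochner_Integration.integrable_bound[OF Bochner_Integration.integrable_add[OF integrable_sphere_const i[OF False]] m, of 1]) auto
  qed
qed

lemma Pe_in_hpe:
  assumes p: "1 < p" and f: "f \<in> Lp_sphere p" and u: "\<And>x. norm x < 1 \<Longrightarrow> u x = Pe lam mu f x"
  shows "u \<in> hpe lam mu p"
proof -
  note fi = Lp_integrable(1)[OF f p]
  have eh: "elastic_harmonic lam mu u" by (rule Pe_cong_ball_elastic[OF fi u])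
  show ?thesis
  proof (cases "p = \<infinity>")
    case True
    then obtain C where C: "AE w in sphere_measure. norm (f w) \<le> C" using f by (auto simp: Lp_sphere_def)
    have "norm (u x) \<le> 9 * kernel_const * C" if x: "norm x < 1" for x
      using Pe_bound[OF fi integrable_sphere_const C x] u[OF x] by (simp add: poissonI_def integral_poissonK[OF x])
    then have "bounded (u ` ball 0 1)"
      unfolding bounded_iff by (intro exI[of _ "9 * kernel_const * C"]) auto
    then show ?thesis using eh True by (simp add: hpe_def)
  next
    case False
    define q where "q = real_of_ereal p"
    have q: "q \<ge> 1" using p False by (cases p) (auto simp: q_def)
    note fq = Lp_integrable(2)[OF f p False, folded q_def]
    let ?h = "\<lambda>\<eta>. norm (f \<eta>) powr q"
    define A where "A = (9 * kernel_const) powr q"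
    have A: "A \<ge> 0" by (simp add: A_def)
    have "(\<integral>\<^sup>+ w. ennreal (norm (u (r *\<^sub>R w)) powr q) \<partial>sphere_measure) \<le> ennreal (A * (\<integral>\<eta>. ?h \<eta> \<partial>sphere_measure))"
      if r: "0 \<le> r" "r < 1" for r
    proof -
      have "(\<integral>\<^sup>+ w. ennreal (norm (u (r *\<^sub>R w)) powr q) \<partial>sphere_measure) \<le>
        (\<integral>\<^sup>+ w. ennreal A * ennreal (poissonI sphere_measure ?h (r *\<^sub>R w)) \<partial>sphere_measure)"
      proof (rule nn_integral_mono)
        fix w assume "w \<in> space sphere_measure"
        then have x: "norm (r *\<^sub>R w) < 1" using r by (simp add: space_sphere_measure)
        have "norm (u (r *\<^sub>R w)) \<le> 9 * kernel_const * poissonI sphere_measure (\<lambda>\<eta>. norm (f \<eta>)) (r *\<^sub>R w)"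
          unfolding u[OF x] by (rule Pe_bound[OF fi _ _ x]) (use fi in auto)
        then have "norm (u (r *\<^sub>R w)) powr q \<le> (9 * kernel_const * poissonI sphere_measure (\<lambda>\<eta>. norm (f \<eta>)) (r *\<^sub>R w)) powr q"
          using q by (intro powr_mono2) auto
        also have "\<dots> = A * poissonI sphere_measure (\<lambda>\<eta>. norm (f \<eta>)) (r *\<^sub>R w) powr q"
          unfolding A_def using kernel_const_pos poissonI_nonneg[OF x] by (intro powr_mult)
        also have "\<dots> \<le> A * poissonI sphere_measure ?h (r *\<^sub>R w)"
          by (intro mult_left_mono poissonI_jensen q fq x A) (use fi in auto)
        finally show "ennreal (norm (u (r *\<^sub>R w)) powr q) \<le> ennreal A * ennreal (poissonI sphere_measure ?h (r *\<^sub>R w))"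
          using A by (simp add: ennreal_mult'[symmetric] ennreal_leI)
      qed
      also have "\<dots> = ennreal A * (\<integral>\<^sup>+ w. ennreal (poissonI sphere_measure ?h (r *\<^sub>R w)) \<partial>sphere_measure)"
        by (intro nn_integral_cmult measurable_compose[OF _ measurable_ennreal] measurable_continuous_sphere
            continuous_on_poissonI_dilate fq r refl)
      also have "\<dots> = ennreal (A * (\<integral>\<eta>. ?h \<eta> \<partial>sphere_measure))"
        using nn_integral_poissonI_sphere[OF refl finite_sphere_measure fq _ r] A by (simp add: ennreal_mult')
      finally show ?thesis .
    qed
    then have "\<exists>C::real. \<forall>r. 0 \<le> r \<and> r < 1 \<longrightarrow>
        (\<integral>\<^sup>+ w. ennreal (norm (u (r *\<^sub>R w)) powr q) \<partial>sphere_measure) \<le> ennreal C" by blast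
    then show ?thesis using eh False by (simp add: hpe_def q_def)
  qed
qed

lemma Pe_meas_component:
  assumes v: "vec_measure_on_sphere pos neg" and x: "norm x < 1"
  shows "Pe_meas lam mu pos neg x $ j =
    (\<Sum>i\<in>UNIV. kernel_column i (poissonI (pos i) (\<lambda>_. 1)) j x - kernel_column i (poissonI (neg i) (\<lambda>_. 1)) j x)"
proof -
  have "(\<integral>\<eta>. elastic_poisson_kernel lam mu x \<eta> $ j $ i \<partial>M) = kernel_column i (poissonI M (\<lambda>_. 1)) j x"
    if "sets M = sets sphere_measure" "finite_measure M" for M i
    using integral_kernel[OF that finite_measure.integrable_const[OF that(2), of 1] x] by simp
  then show ?thesis using v by (simp add: Pe_meas_def vec_measure_on_sphere_def)
qed

text \<open>The columns are dominated by the Poisson integrals of the positive and negative parts,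
  whose integral over every sphere is their total mass.\<close>

lemma Pe_meas_in_hpe:
  assumes v: "vec_measure_on_sphere pos neg" and u: "\<And>x. norm x < 1 \<Longrightarrow> u x = Pe_meas lam mu pos neg x"
  shows "u \<in> hpe lam mu 1"
proof -
  have s: "sets (pos i) = sets sphere_measure" "sets (neg i) = sets sphere_measure"
    "finite_measure (pos i)" "finite_measure (neg i)" for i
    using v by (auto simp: vec_measure_on_sphere_def)
  note ic = finite_measure.integrable_const[of _ "1::real"]
  have eh: "elastic_harmonic lam mu u"
  proof (rule elastic_harmonic_columns[where A="UNIV :: (3 \<times> bool) set" and i=fst
      and c="\<lambda>a. if snd a then 1 else - 1" and M="\<lambda>a. if snd a then pos (fst a) else neg (fst a)" and g="\<lambda>_ _. 1"])
    fix j and x :: R3 assume x: "norm x < 1"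
    show "u x $ j = (\<Sum>a\<in>UNIV. (if snd a then 1 else - 1) *
        kernel_column (fst a) (poissonI (if snd a then pos (fst a) else neg (fst a)) (\<lambda>_. 1)) j x)"
      unfolding u[OF x] Pe_meas_component[OF v x] sum_UNIV_prod_bool by simp
  qed (use s ic[OF s(3)] ic[OF s(4)] in auto)
  define K where "K = 3 * kernel_const"
  have K: "K \<ge> 0" using kernel_const_pos by (simp add: K_def)
  let ?P = "\<lambda>M. poissonI M (\<lambda>_. 1)"
  have b: "norm (u x) \<le> K * (\<Sum>i\<in>UNIV. ?P (pos i) x + ?P (neg i) x)" if x: "norm x < 1" for x
  proof -
    have c: "\<bar>kernel_column i (?P M) j x\<bar> \<le> kernel_const * ?P M x" if "sets M = sets sphere_measure" "finite_measure M" for M i j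
      by (rule column_bound[OF that ic[OF that(2)] ic[OF that(2)] _ x]) simp
    have "\<bar>u x $ j\<bar> \<le> (\<Sum>i\<in>UNIV. kernel_const * (?P (pos i) x + ?P (neg i) x))" for j
      unfolding u[OF x] Pe_meas_component[OF v x]
    proof (rule order_trans[OF sum_abs sum_mono])
      fix i
      show "\<bar>kernel_column i (?P (pos i)) j x - kernel_column i (?P (neg i)) j x\<bar> \<le> kernel_const * (?P (pos i) x + ?P (neg i) x)"
        using c[OF s(1,3), of i i j] c[OF s(2,4), of i i j] by (simp add: distrib_left)
    qed
    then have j: "\<bar>u x $ j\<bar> \<le> kernel_const * (\<Sum>i\<in>UNIV. ?P (pos i) x + ?P (neg i) x)" for j
      by (simp only: sum_distrib_left)
    have "norm (u x) \<le> (\<Sum>j\<in>UNIV. \<bar>u x $ j\<bar>)" by (rule norm_le_l1_cart)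
    also have "\<dots> \<le> (\<Sum>j::3\<in>UNIV. kernel_const * (\<Sum>i\<in>UNIV. ?P (pos i) x + ?P (neg i) x))" by (rule sum_mono) (rule j)
    finally show ?thesis by (simp add: K_def)
  qed
  have "(\<integral>\<^sup>+ w. ennreal (norm (u (r *\<^sub>R w)) powr 1) \<partial>sphere_measure) \<le>
     ennreal (K * (\<Sum>i\<in>UNIV. measure (pos i) (space (pos i)) + measure (neg i) (space (neg i))))"
    if r: "0 \<le> r" "r < 1" for r
  proof -
    have n: "norm (r *\<^sub>R w) < 1" if "w \<in> space sphere_measure" for w
      using that r by (simp add: space_sphere_measure)
    have nn: "?P M (r *\<^sub>R w) \<ge> 0" if "w \<in> space sphere_measure" for M w
      by (rule poissonI_nonneg[OF n[OF that]]) simp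
    have m: "(\<lambda>w. ennreal (?P M (r *\<^sub>R w))) \<in> borel_measurable sphere_measure"
      if "sets M = sets sphere_measure" "finite_measure M" for M
      by (intro measurable_compose[OF _ measurable_ennreal] measurable_continuous_sphere
            continuous_on_poissonI_dilate that ic r)
    have t: "(\<integral>\<^sup>+ w. ennreal (?P M (r *\<^sub>R w)) \<partial>sphere_measure) = ennreal (measure M (space M))"
      if "sets M = sets sphere_measure" "finite_measure M" for M
      using nn_integral_poissonI_sphere[OF that ic[OF that(2)] _ r] by simp
    have "(\<integral>\<^sup>+ w. ennreal (norm (u (r *\<^sub>R w)) powr 1) \<partial>sphere_measure) \<le>
      (\<integral>\<^sup>+ w. ennreal K * (\<Sum>i\<in>UNIV. ennreal (?P (pos i) (r *\<^sub>R w)) + ennreal (?P (neg i) (r *\<^sub>R w))) \<partial>sphere_measure)"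
    proof (rule nn_integral_mono)
      fix w assume w: "w \<in> space sphere_measure"
      have "(\<Sum>i\<in>UNIV. ennreal (?P (pos i) (r *\<^sub>R w)) + ennreal (?P (neg i) (r *\<^sub>R w)))
         = ennreal (\<Sum>i\<in>UNIV. ?P (pos i) (r *\<^sub>R w) + ?P (neg i) (r *\<^sub>R w))"
        using nn[OF w] by (subst sum_ennreal[symmetric]) (auto simp: ennreal_plus)
      then show "ennreal (norm (u (r *\<^sub>R w)) powr 1) \<le>
         ennreal K * (\<Sum>i\<in>UNIV. ennreal (?P (pos i) (r *\<^sub>R w)) + ennreal (?P (neg i) (r *\<^sub>R w)))"
        using b[OF n[OF w]] K by (simp add: ennreal_mult'[symmetric] ennreal_leI)
    qed
    also have "\<dots> = ennreal K * (\<Sum>i\<in>UNIV. ennreal (measure (pos i) (space (pos i))) + ennreal (measure (neg i) (space (neg i))))"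
      using s m by (subst nn_integral_cmult) (auto intro!: borel_measurable_sum borel_measurable_add simp: nn_integral_sum nn_integral_add t)
    also have "\<dots> = ennreal (K * (\<Sum>i\<in>UNIV. measure (pos i) (space (pos i)) + measure (neg i) (space (neg i))))"
      using K by (simp add: ennreal_mult' sum_ennreal[symmetric] ennreal_plus sum_nonneg)
    finally show ?thesis .
  qed
  then have "\<exists>C::real. \<forall>r. 0 \<le> r \<and> r < 1 \<longrightarrow>
        (\<integral>\<^sup>+ w. ennreal (norm (u (r *\<^sub>R w)) powr 1) \<partial>sphere_measure) \<le> ennreal C" by blast
  then show ?thesis using eh by (simp add: hpe_def)
qed

end

section \<open>Regularisation and the representation formula\<close>

lemma integrable_stek:
  assumes "Ck k R f" "e \<ge> 0" "norm x < R - e"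
  shows "integrable I01 (\<lambda>s. f (x + (e * s) *\<^sub>R axis i 1))"
  using continuous_on_param_slice[OF CkP_imp_continuous[OF CkP_shift[OF assms(1,2)]]] assms(3)
  by (intro integrable_I01_continuous) simp

lemma stek_add:
  "Ck k R f \<Longrightarrow> Ck l R g \<Longrightarrow> e \<ge> 0 \<Longrightarrow> norm x < R - e \<Longrightarrow>
    stek e i (\<lambda>x. f x + g x) x = stek e i f x + stek e i g x"
  unfolding stek_def by (intro Bochner_Integration.integral_add integrable_stek)

lemma stek_cmult: "stek e i (\<lambda>x. c * f x) x = c * stek e i f x"
  unfolding stek_def by simp

lemma stek_sum:
  "(\<And>a. a \<in> A \<Longrightarrow> Ck k R (f a)) \<Longrightarrow> e \<ge> 0 \<Longrightarrow> norm x < R - e \<Longrightarrow>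
    stek e i (\<lambda>x. \<Sum>a\<in>A. f a x) x = (\<Sum>a\<in>A. stek e i (f a) x)"
  unfolding stek_def by (intro Bochner_Integration.integral_sum integrable_stek)

lemma lap_stek:
  assumes f: "Ck (Suc (Suc k)) R f" and e: "e \<ge> 0" and x: "norm x < R - e"
  shows "lap (stek e i f) x = stek e i (lap f) x"
proof -
  have "pd j (pd j (stek e i f)) x = stek e i (pd j (pd j f)) x" for j
  proof -
    have "pd j (pd j (stek e i f)) x = pd j (stek e i (pd j f)) x"
      by (rule pd_cong_ball[OF pd_stek[OF f e] x])
    also have "\<dots> = stek e i (pd j (pd j f)) x" by (rule pd_stek[OF Ck_pd[OF f] e x])
    finally show ?thesis .
  qed
  then show ?thesis
    unfolding lap_def by (simp only:) (rule stek_sum[OF Ck_pd[OF Ck_pd[OF f]] e x, symmetric])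
qed

lemma Ck_shift: "Ck k R f \<Longrightarrow> e \<ge> 0 \<Longrightarrow> Ck k (R - e) (\<lambda>x. f (x + e *\<^sub>R axis i 1))"
  using CkP_slice[OF CkP_shift, of k R f e 1 i] by simp

text \<open>In the direction of averaging the derivative is a difference quotient of
  \<open>f\<close>, hence as smooth as \<open>f\<close> itself: this is the gain of one
  order.\<close>

lemma Ck_pd_stek_same:
  assumes f: "Ck (Suc k) R f" and e: "e > 0"
  shows "Ck (Suc k) (R - e) (pd i (stek e i f))"
proof -
  have "Ck (Suc k) (R - e) (\<lambda>x. (1 / e) * (f (x + e *\<^sub>R axis i 1) - f x))"
    by (intro Ck_cmult Ck_diff Ck_shift Ck_subset[OF f] f) (use e in auto)
  moreover have "(1 / e) * (f (x + e *\<^sub>R axis i 1) - f x) = pd i (stek e i f) x" if x: "norm x < R - e" for x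
    using pd_stek[OF f _ x, of i i] integral_pd_segment[OF f, of x e i] x e by (simp add: stek_def)
  ultimately show ?thesis using Ck_cong[of "R - e" "\<lambda>x. (1 / e) * (f (x + e *\<^sub>R axis i 1) - f x)"] by blast
qed

text \<open>In another direction the derivative passes onto \<open>f\<close>, so an order gained by
  an earlier average survives the later ones.\<close>

lemma Ck_pd_stek_other:
  assumes f: "Ck (Suc k) R f" "Ck (Suc k) R (pd i f)" and e: "e > 0"
  shows "Ck (Suc k) (R - e) (pd i (stek e j f))"
proof -
  have "Ck (Suc k) (R - e) (stek e j (pd i f))" by (rule Ck_stek[OF f(2)]) (use e in simp)
  then show ?thesis
    by (rule Ck_cong[THEN iffD1, rotated]) (use pd_stek[OF f(1)] e in simp)
qed

definition stek3 :: "real \<Rightarrow> (R3 \<Rightarrow> real) \<Rightarrow> R3 \<Rightarrow> real" where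
  "stek3 e f = stek e 1 (stek e 2 (stek e 3 f))"

text \<open>The gain is collected axis by axis: the first average makes the derivative in direction
  3 of class \<open>Suc k\<close>, the second adds direction 2, the third direction 1. Each average
  costs \<open>e\<close> of the radius.\<close>

lemma Ck_stek3:
  assumes f: "Ck (Suc k) R f" and e: "e > 0"
  shows "Ck (Suc (Suc k)) (R - 3 * e) (stek3 e f)"
proof -
  let ?g3 = "stek e 3 f" and ?g2 = "stek e 2 (stek e 3 f)"
  have e': "e \<ge> 0" using e by simp
  have g3: "Ck (Suc k) (R - e) ?g3" "Ck (Suc k) (R - e) (pd 3 ?g3)"
    by (rule Ck_stek[OF f e'], rule Ck_pd_stek_same[OF f e])
  have g2: "Ck (Suc k) (R - e - e) ?g2" "Ck (Suc k) (R - e - e) (pd 2 ?g2)" "Ck (Suc k) (R - e - e) (pd 3 ?g2)"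
    by (rule Ck_stek[OF g3(1) e'], rule Ck_pd_stek_same[OF g3(1) e], rule Ck_pd_stek_other[OF g3 e])
  have g1: "Ck (Suc k) (R - e - e - e) (stek e 1 ?g2)"
    "Ck (Suc k) (R - e - e - e) (pd 1 (stek e 1 ?g2))" "Ck (Suc k) (R - e - e - e) (pd 2 (stek e 1 ?g2))"
    "Ck (Suc k) (R - e - e - e) (pd 3 (stek e 1 ?g2))"
    by (rule Ck_stek[OF g2(1) e'], rule Ck_pd_stek_same[OF g2(1) e], rule Ck_pd_stek_other[OF g2(1,2) e],
        rule Ck_pd_stek_other[OF g2(1,3) e])
  have "Ck (Suc k) (R - 3 * e) (pd i (stek3 e f))" for i
    using g1 exhaust_3[of i] unfolding stek3_def by (auto simp: algebra_simps)
  moreover have "Ck (Suc k) (R - 3 * e) (stek3 e f)"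
    using g1(1) unfolding stek3_def by (simp add: algebra_simps)
  ultimately show ?thesis
    unfolding Ck_Suc[of "Suc k"] using Ck_continuous Ck_has_pd by auto
qed

lemma stek_close:
  assumes f: "Ck k R f" and R: "norm x0 + (a + e) < R" and e: "e \<ge> 0"
    and cl: "\<And>y. norm (y - x0) \<le> a + e \<Longrightarrow> \<bar>f y - c\<bar> \<le> d" and y: "norm (y - x0) \<le> a"
  shows "\<bar>stek e i f y - c\<bar> \<le> d"
proof -
  have yR: "norm y < R - e" using norm_triangle_ineq[of x0 "y - x0"] y R by simp
  note int = integrable_stek[OF f e yR, of i]
  have b: "\<bar>f (y + (e * s) *\<^sub>R axis i 1) - c\<bar> \<le> d" if s: "s \<in> {0..1}" for s
  proof (rule cl)
    have "norm (y + (e * s) *\<^sub>R axis i 1 - x0) \<le> norm (y - x0) + \<bar>e * s\<bar>"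
      using norm_axis_shift[of "y - x0" "e * s" i] by (simp add: algebra_simps)
    also have "\<dots> \<le> a + e" using y s e mult_left_mono[of s 1 e] by simp
    finally show "norm (y + (e * s) *\<^sub>R axis i 1 - x0) \<le> a + e" .
  qed
  have "stek e i f y - c = (\<integral>s. f (y + (e * s) *\<^sub>R axis i 1) - c \<partial>I01)"
    unfolding stek_def by (subst Bochner_Integration.integral_diff[OF int integrable_I01_const]) simp
  also have "\<bar>\<dots>\<bar> \<le> (\<integral>s. d \<partial>I01)"
    by (rule order_trans[OF integral_abs_bound integral_mono])
       (use int b in \<open>auto simp: space_I01 intro!: integrable_I01_const Bochner_Integration.integrable_diff integrable_abs\<close>)
  finally show ?thesis by simp
qed

lemma stek3_close:
  assumes f: "Ck k R f" and R: "norm x0 + (a + 3 * e) < R" and e: "e \<ge> 0"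
    and cl: "\<And>y. norm (y - x0) \<le> a + 3 * e \<Longrightarrow> \<bar>f y - c\<bar> \<le> d" and y: "norm (y - x0) \<le> a"
  shows "\<bar>stek3 e f y - c\<bar> \<le> d"
proof -
  have C3: "Ck k (R - e) (stek e 3 f)" by (rule Ck_stek[OF f e])
  have C2: "Ck k (R - e - e) (stek e 2 (stek e 3 f))" by (rule Ck_stek[OF C3 e])
  have 3: "\<bar>stek e 3 f y - c\<bar> \<le> d" if "norm (y - x0) \<le> a + e + e" for y
    by (rule stek_close[OF f _ e _ that]) (use R cl in auto)
  have 2: "\<bar>stek e 2 (stek e 3 f) y - c\<bar> \<le> d" if "norm (y - x0) \<le> a + e" for y
    by (rule stek_close[OF C3 _ e _ that]) (use R 3 in auto)
  show ?thesis unfolding stek3_def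
    by (rule stek_close[OF C2 _ e _ y]) (use R 2 in auto)
qed

lemma Ck_dilate:
  assumes "Ck k R f" "r > 0"
  shows "Ck k (R / r) (\<lambda>x. f (r *\<^sub>R x))"
proof -
  have "CkP k (R / r) {0::real} (\<lambda>x z. f (r *\<^sub>R x + 0))"
    by (rule Ck_affine[OF assms(1)]) (use assms(2) in \<open>auto simp: field_simps\<close>)
  then show ?thesis by (simp add: Ck_def)
qed

lemma pd_dilate:
  assumes f: "Ck (Suc k) R f" and r: "r > 0" and x: "norm x < R / r"
  shows "pd i (\<lambda>x. f (r *\<^sub>R x)) x = r * pd i f (r *\<^sub>R x)"
proof -
  have "norm (r *\<^sub>R x) < R" using x r by (simp add: field_simps)
  then have "has_pd i (\<lambda>x. f (r *\<^sub>R x + 0)) (r * pd i f (r *\<^sub>R x)) x"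
    by (intro has_pd_affine) (use Ck_has_pd[OF f] in simp)
  then show ?thesis using has_pd_imp_pd by simp
qed

context lame
begin

text \<open>The system has constant coefficients, so translates of solutions and their averages are
  solutions.\<close>

lemma lame_solution_stek:
  assumes u: "\<And>j. Ck (Suc (Suc k)) R (u j)" and s: "lame_solution R u" and e: "e \<ge> 0"
  shows "lame_solution (R - e) (\<lambda>j. stek e i (u j))"
  unfolding lame_solution_def
proof (intro allI impI)
  fix x :: R3 and j assume x: "norm x < R - e"
  let ?D = "\<lambda>y. \<Sum>i\<in>UNIV. pd i (u i) y"
  have CD: "Ck (Suc k) R ?D" by (intro Ck_sum Ck_pd u)
  have "pd j (\<lambda>y. \<Sum>i'\<in>UNIV. pd i' (stek e i (u i')) y) x = pd j (stek e i ?D) x"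
    by (rule pd_cong_ball[OF _ x]) (simp add: stek_sum[OF Ck_pd[OF u] e] pd_stek[OF u e])
  also have "\<dots> = stek e i (pd j ?D) x" by (rule pd_stek[OF CD e x])
  finally have p: "pd j (\<lambda>y. \<Sum>i'\<in>UNIV. pd i' (stek e i (u i')) y) x = stek e i (pd j ?D) x" .
  have "mu * stek e i (lap (u j)) x + (lam + mu) * stek e i (pd j ?D) x =
    stek e i (\<lambda>x. mu * lap (u j) x + (lam + mu) * pd j ?D x) x"
    using stek_add[OF Ck_cmult[OF Ck_lap[OF u]] Ck_cmult[OF Ck_pd[OF CD]] e x] by (simp add: stek_cmult)
  also have "\<dots> = (\<integral>s. 0 \<partial>I01)"
    unfolding stek_def
  proof (rule Bochner_Integration.integral_cong[OF refl])
    fix t assume "t \<in> space I01"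
    then have "\<bar>e * t\<bar> \<le> e" using e mult_left_mono[of t 1 e] by (simp add: space_I01)
    then have "norm (x + (e * t) *\<^sub>R axis i 1) < R" using norm_axis_shift[of x "e * t" i] x by simp
    then show "mu * lap (u j) (x + (e * t) *\<^sub>R axis i 1) + (lam + mu) * pd j ?D (x + (e * t) *\<^sub>R axis i 1) = 0"
      using s unfolding lame_solution_def by blast
  qed
  finally show "mu * lap (stek e i (u j)) x + (lam + mu) * pd j (\<lambda>y. \<Sum>i'\<in>UNIV. pd i' (stek e i (u i')) y) x = 0"
    unfolding p lap_stek[OF u e x] by simp
qed

lemma lame_solution_stek3:
  assumes u: "\<And>j. Ck (Suc (Suc k)) R (u j)" and s: "lame_solution R u" and e: "e \<ge> 0"
  shows "lame_solution (R - 3 * e) (\<lambda>j. stek3 e (u j))"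
proof -
  have "lame_solution (R - e - e - e) (\<lambda>j. stek3 e (u j))"
    unfolding stek3_def
    by (rule lame_solution_stek[OF Ck_stek[OF Ck_stek[OF u e] e]
        lame_solution_stek[OF Ck_stek[OF u e] lame_solution_stek[OF u s e] e] e])
  then show ?thesis by (simp add: algebra_simps)
qed

text \<open>Both terms of the system are of second order and scale by \<open>r ^ 2\<close>.\<close>

lemma lame_solution_dilate:
  assumes u: "\<And>j. Ck (Suc (Suc k)) R (u j)" and s: "lame_solution R u" and r: "r > 0"
  shows "lame_solution (R / r) (\<lambda>j x. u j (r *\<^sub>R x))"
  unfolding lame_solution_def
proof (intro allI impI)
  fix x :: R3 and j assume x: "norm x < R / r"
  let ?D = "\<lambda>y. \<Sum>i\<in>UNIV. pd i (u i) y"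
  have CD: "Ck (Suc k) R ?D" by (intro Ck_sum Ck_pd u)
  have "pd i (pd i (\<lambda>x. u j (r *\<^sub>R x))) x = r * (r * pd i (pd i (u j)) (r *\<^sub>R x))" for i
  proof -
    have "pd i (pd i (\<lambda>x. u j (r *\<^sub>R x))) x = pd i (\<lambda>x. r * pd i (u j) (r *\<^sub>R x)) x"
      by (rule pd_cong_ball[OF pd_dilate[OF u r] x])
    also have "\<dots> = r * pd i (\<lambda>x. pd i (u j) (r *\<^sub>R x)) x"
      by (rule pd_cmult[OF Ck_dilate[OF Ck_pd[OF u] r] x])
    finally show ?thesis unfolding pd_dilate[OF Ck_pd[OF u] r x] .
  qed
  then have l: "lap (\<lambda>x. u j (r *\<^sub>R x)) x = r * (r * lap (u j) (r *\<^sub>R x))"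
    by (simp add: lap_def sum_distrib_left)
  have "pd j (\<lambda>y. \<Sum>i\<in>UNIV. pd i (\<lambda>x. u i (r *\<^sub>R x)) y) x = pd j (\<lambda>y. r * ?D (r *\<^sub>R y)) x"
    by (rule pd_cong_ball[OF _ x]) (simp add: pd_dilate[OF u r] sum_distrib_left)
  also have "\<dots> = r * pd j (\<lambda>y. ?D (r *\<^sub>R y)) x"
    by (rule pd_cmult[OF Ck_dilate[OF CD r] x])
  also have "\<dots> = r * (r * pd j ?D (r *\<^sub>R x))" unfolding pd_dilate[OF CD r x] ..
  finally have p: "pd j (\<lambda>y. \<Sum>i\<in>UNIV. pd i (\<lambda>x. u i (r *\<^sub>R x)) y) x = r * (r * pd j ?D (r *\<^sub>R x))" .
  have "norm (r *\<^sub>R x) < R" using x r by (simp add: field_simps)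
  then have "mu * lap (u j) (r *\<^sub>R x) + (lam + mu) * pd j ?D (r *\<^sub>R x) = 0"
    using s unfolding lame_solution_def by blast
  then have "r * (r * (mu * lap (u j) (r *\<^sub>R x) + (lam + mu) * pd j ?D (r *\<^sub>R x))) = 0" by simp
  then show "mu * lap (\<lambda>x. u j (r *\<^sub>R x)) x + (lam + mu) * pd j (\<lambda>y. \<Sum>i\<in>UNIV. pd i (\<lambda>x. u i (r *\<^sub>R x)) y) x = 0"
    unfolding l p by (simp only: distrib_left mult_ac)
qed

text \<open>Domination of the kernel by a multiple of the Poisson kernel, of mass one, makes the
  columns stable in the sup norm of the boundary data. This carries the representation from
  regularised solutions to the given one.\<close>

lemma column_diff_bound:
  assumes g: "continuous_on S2 g" "continuous_on S2 h" and d: "\<And>\<eta>. norm \<eta> = 1 \<Longrightarrow> \<bar>g \<eta> - h \<eta>\<bar> \<le> d" and x: "norm x < 1"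
  shows "\<bar>kernel_column i (poissonI sphere_measure g) j x - kernel_column i (poissonI sphere_measure h) j x\<bar> \<le> kernel_const * d"
proof -
  note ig = integrable_sphere_continuous[OF g(1)] and ih = integrable_sphere_continuous[OF g(2)]
  have igh: "integrable sphere_measure (\<lambda>\<eta>. g \<eta> - h \<eta>)" using ig ih by simp
  note int = integrable_continuous_mult[OF continuous_on_kernel[OF x, of j i] compact_sphere sets_sphere_measure]
  note K = integral_kernel[OF refl finite_sphere_measure _ x]
  have "kernel_column i (poissonI sphere_measure g) j x - kernel_column i (poissonI sphere_measure h) j x =
      kernel_column i (poissonI sphere_measure (\<lambda>\<eta>. g \<eta> - h \<eta>)) j x"
    unfolding K[OF ig, symmetric] K[OF ih, symmetric] K[OF igh, symmetric]
    by (subst Bochner_Integration.integral_diff[OF int[OF ig] int[OF ih], symmetric]) (simp add: right_diff_distrib)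
  also have "\<bar>\<dots>\<bar> \<le> kernel_const * poissonI sphere_measure (\<lambda>_. d) x"
    by (rule column_bound[OF refl finite_sphere_measure igh integrable_sphere_const _ x])
       (use d in \<open>auto simp: space_sphere_measure\<close>)
  finally show ?thesis by (simp add: poissonI_def integral_poissonK[OF x])
qed

text \<open>The formula for smooth solutions asks for four derivatives on a ball larger than the
  unit one. Averaging twice along all axes raises C2 to C4, and dilation by \<open>r\<close> makes
  room; by uniform continuity the solution and its boundary data change arbitrarily little.\<close>

lemma elastic_harmonic_representation:
  assumes u: "elastic_harmonic lam mu u" and r: "0 < r" "r < 1" and x: "norm x < 1"
  shows "u (r *\<^sub>R x) = Pe lam mu (\<lambda>\<eta>. u (r *\<^sub>R \<eta>)) x"
proof -
  let ?U = "\<lambda>j x. u x $ j"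
  have C: "Ck (Suc (Suc 0)) 1 (?U j)" for j using u by (auto simp: elastic_harmonic_iff)
  have s: "lame_solution 1 ?U" using u by (auto simp: elastic_harmonic_iff)
  have cU: "continuous_on S2 (\<lambda>\<eta>. ?U j (r *\<^sub>R \<eta>))" for j
    by (rule continuous_on_compose2[OF Ck_continuous[OF C]]) (use r in \<open>auto intro!: continuous_intros\<close>)
  have iu: "integrable sphere_measure (\<lambda>\<eta>. u (r *\<^sub>R \<eta>))"
    by (rule integrable_vecI) (rule integrable_sphere_continuous[OF cU])
  let ?c = "\<lambda>j. \<Sum>i\<in>UNIV. kernel_column i (poissonI sphere_measure (\<lambda>\<eta>. ?U i (r *\<^sub>R \<eta>))) j x"
  have "u (r *\<^sub>R x) $ j = ?c j" for j
  proof (rule ccontr)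
    assume ne: "u (r *\<^sub>R x) $ j \<noteq> ?c j"
    \<comment> \<open>The value contributes \<open>d\<close> to the error and each of the three
      columns \<open>kernel_const * d\<close>; with this \<open>d\<close> the sum is half of the
      assumed discrepancy.\<close>
    define d where "d = \<bar>u (r *\<^sub>R x) $ j - ?c j\<bar> / (2 * (1 + 3 * kernel_const))"
    have kc: "1 + 3 * kernel_const > 0" using kernel_const_pos by simp
    have d: "d > 0" using ne kc by (simp add: d_def)
    define R1 where "R1 = (1 + r) / 2"
    have R1: "r < R1" "R1 < 1" using r by (auto simp: R1_def)
    have "\<exists>\<delta>>0. \<forall>y\<in>cball 0 R1. \<forall>z\<in>cball 0 R1. dist z y < \<delta> \<longrightarrow> dist (?U i z) (?U i y) < d" for i
    proof -
      have "continuous_on (cball 0 R1) (?U i)"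
        by (rule continuous_on_subset[OF Ck_continuous[OF C]]) (use R1 in auto)
      then have "uniformly_continuous_on (cball 0 R1) (?U i)"
        by (rule compact_uniformly_continuous) (rule compact_cball)
      then show ?thesis using d unfolding uniformly_continuous_on_def by blast
    qed
    then obtain \<delta> where \<delta>: "\<And>i. \<delta> i > 0"
      "\<And>i y z. y \<in> cball 0 R1 \<Longrightarrow> z \<in> cball 0 R1 \<Longrightarrow> dist z y < \<delta> i \<Longrightarrow> dist (?U i z) (?U i y) < d" by metis
    \<comment> \<open>Averaging twice along each axis involves points at distance up to
      \<open>6 * e\<close>; the divisor 12 keeps this strictly below \<open>R1 - r\<close> and below
      the moduli of continuity.\<close>
    define e where "e = Min (insert (R1 - r) (range \<delta>)) / 12"
    have "Min (insert (R1 - r) (range \<delta>)) > 0" using \<delta>(1) R1 by (subst Min_gr_iff) auto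
    then have e: "e > 0" by (simp add: e_def)
    have "Min (insert (R1 - r) (range \<delta>)) \<le> R1 - r" "Min (insert (R1 - r) (range \<delta>)) \<le> \<delta> i" for i
      by (rule Min_le; simp)+
    then have e2: "12 * e \<le> R1 - r" "12 * e \<le> \<delta> i" for i
      unfolding e_def by simp_all
    define V where "V = (\<lambda>j. stek3 e (stek3 e (?U j)))"
    have C1: "Ck (Suc (Suc (Suc 0))) (1 - 3 * e) (stek3 e (?U j))" for j by (rule Ck_stek3[OF C e])
    have CV: "Ck (Suc (Suc (Suc (Suc 0)))) (1 - 3 * e - 3 * e) (V j)" for j
      unfolding V_def by (rule Ck_stek3[OF C1 e])
    have sV: "lame_solution (1 - 3 * e - 3 * e) V"
      unfolding V_def using e by (intro lame_solution_stek3[OF C1] lame_solution_stek3[OF C s]) auto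
    have close: "\<bar>V j y - ?U j y\<bar> \<le> d" if y: "norm y \<le> r" for y j
    proof -
      have base: "\<bar>?U j z - ?U j y\<bar> \<le> d" if z: "norm (z - y) \<le> 0 + 3 * e + 3 * e" for z
      proof -
        have "norm z \<le> R1" using norm_triangle_ineq[of y "z - y"] z y e2(1) e by simp
        moreover have "dist z y < \<delta> j" using z e e2(2)[of j] by (simp add: dist_norm)
        ultimately show ?thesis using \<delta>(2)[of y z j] y R1 by (simp add: dist_real_def)
      qed
      have "\<bar>stek3 e (?U j) z - ?U j y\<bar> \<le> d" if z: "norm (z - y) \<le> 0 + 3 * e" for z
        by (rule stek3_close[OF C _ _ base z]) (use e e2(1) R1 y in auto)
      then show ?thesis unfolding V_def
        by (intro stek3_close[OF C1, of y 0]) (use e e2(1) R1 y in auto)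
    qed
    define W where "W = (\<lambda>j x. V j (r *\<^sub>R x))"
    have CW: "Ck (Suc (Suc (Suc (Suc 0)))) ((1 - 3 * e - 3 * e) / r) (W j)" for j
      unfolding W_def by (rule Ck_dilate[OF CV r(1)])
    have sW: "lame_solution ((1 - 3 * e - 3 * e) / r) W"
      unfolding W_def by (rule lame_solution_dilate[OF Ck_lower[OF CV, of "Suc (Suc 0)"] sV r(1)]) simp
    have R: "(1 - 3 * e - 3 * e) / r > 1" using e2(1) R1 r e by (simp add: field_simps)
    have cW: "continuous_on S2 (W j)" for j
      by (rule continuous_on_subset[OF Ck_continuous[OF CW]]) (use R in auto)
    have rep: "W j x = (\<Sum>i\<in>UNIV. kernel_column i (poissonI sphere_measure (W i)) j x)"
      by (rule lame_solution_representation[OF CW R sW x])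
    have b: "\<bar>kernel_column i (poissonI sphere_measure (W i)) j x - kernel_column i (poissonI sphere_measure (\<lambda>\<eta>. ?U i (r *\<^sub>R \<eta>))) j x\<bar> \<le> kernel_const * d" for i
      by (rule column_diff_bound[OF cW cU _ x]) (use close r in \<open>auto simp: W_def\<close>)
    have "\<bar>W j x - ?c j\<bar> \<le> (\<Sum>i::3\<in>UNIV. kernel_const * d)"
      unfolding rep sum_subtractf[symmetric] by (rule order_trans[OF sum_abs sum_mono]) (rule b)
    moreover have "\<bar>W j x - u (r *\<^sub>R x) $ j\<bar> \<le> d"
      unfolding W_def by (rule close) (use x r in \<open>simp add: mult_le_cancel_left2\<close>)
    ultimately have "\<bar>u (r *\<^sub>R x) $ j - ?c j\<bar> \<le> (1 + 3 * kernel_const) * d" by (simp add: algebra_simps)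
    also have "\<dots> = \<bar>u (r *\<^sub>R x) $ j - ?c j\<bar> / 2"
    proof -
      have "a * (b / (2 * a)) = b / 2" if "a > 0" for a b :: real using that by simp
      from this[OF kc] show ?thesis unfolding d_def .
    qed
    finally show False using ne by simp
  qed
  then show ?thesis by (simp add: vec_eq_iff Pe_component[OF iu x])
qed

end

section \<open>Compactness for exponents greater than one\<close>

text \<open>Functions obtained from the tail \<open>F n, F (n + 1), \<dots>\<close> of a sequence by taking midpoints
  repeatedly; this dyadic form of Mazur's lemma is all that is needed from convex combinations.\<close>

inductive tail_mid :: "(nat \<Rightarrow> 'a \<Rightarrow> 'b::real_vector) \<Rightarrow> nat \<Rightarrow> ('a \<Rightarrow> 'b) \<Rightarrow> bool" for F n where
  tail_base: "n \<le> m \<Longrightarrow> tail_mid F n (F m)"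
| tail_midpoint: "tail_mid F n g \<Longrightarrow> tail_mid F n h \<Longrightarrow> tail_mid F n (\<lambda>x. (1/2) *\<^sub>R (g x + h x))"

lemma tail_mid_antimono: "tail_mid F n g \<Longrightarrow> m \<le> n \<Longrightarrow> tail_mid F m g"
  by (induction rule: tail_mid.induct) (auto intro: tail_mid.intros)

section \<open>Quantitative strict convexity\<close>

lemma powr_midpoint_le:
  fixes x y q :: real
  assumes "q \<ge> 1" "x \<ge> 0" "y \<ge> 0"
  shows "((x + y) / 2) powr q \<le> (x powr q + y powr q) / 2"
proof (cases "x + y = 0")
  case True then show ?thesis using assms by auto
next
  case False
  define a where "a = (x + y) / 2"
  have a: "a > 0" using False assms by (simp add: a_def)
  have "x powr q \<ge> a powr q + q * a powr (q - 1) * (x - a)" "y powr q \<ge> a powr q + q * a powr (q - 1) * (y - a)"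
    using powr_ge_tangent[OF assms(1) a] assms by auto
  moreover have "q * a powr (q - 1) * (x - a) + q * a powr (q - 1) * (y - a) = 0"
    by (simp add: a_def field_simps)
  ultimately show ?thesis unfolding a_def[symmetric] by simp
qed

text \<open>Strictly convex, smooth at the origin and of linear growth: over a finite measure its
  integral is finite on L^q functions, and one function serves every q > 1.\<close>

definition psi :: "'b::real_normed_vector \<Rightarrow> real" where
  "psi v = sqrt (1 + norm v ^ 2)"

lemma psi_bounds: "1 \<le> psi v" "norm v \<le> psi v" "psi v \<le> 1 + norm v"
proof -
  show "1 \<le> psi v" by (simp add: psi_def)
  show "norm v \<le> psi v" unfolding psi_def by (rule real_le_rsqrt) simp
  show "psi v \<le> 1 + norm v" unfolding psi_def by (rule real_le_lsqrt) (auto simp: power2_eq_square algebra_simps)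
qed

lemma psi_sq: "psi v ^ 2 = 1 + norm v ^ 2"
  unfolding psi_def by (simp add: add_nonneg_nonneg)

text \<open>The radial second derivative of \<open>psi\<close> is the inverse cube of
  \<open>psi\<close>, which explains the cube weighing the midpoint gap. The parallelogram law
  expresses \<open>c ^ 2\<close> through \<open>A\<close>, \<open>B\<close> and
  \<open>norm (a - b)\<close>, and the difference of squares \<open>(A + B) ^ 2 - 4 * c ^ 2\<close>
  has the gap as a factor.\<close>

lemma psi_convexity:
  fixes a b :: "'b::real_inner"
  shows "norm (a - b) ^ 2 \<le> ((psi a + psi b) / 2 - psi ((1/2) *\<^sub>R (a + b))) * (psi a + psi b) ^ 3"
    and "psi ((1/2) *\<^sub>R (a + b)) \<le> (psi a + psi b) / 2"
proof -
  define A B c where "A = psi a" and "B = psi b" and "c = psi ((1/2) *\<^sub>R (a + b))"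
  have A: "A \<ge> 1" "A ^ 2 = 1 + norm a ^ 2" and B: "B \<ge> 1" "B ^ 2 = 1 + norm b ^ 2" and c: "c \<ge> 1"
    by (simp_all add: A_def B_def c_def psi_bounds psi_sq)
  \<comment> \<open>Cauchy-Schwarz for the plane vectors \<open>(1, norm a)\<close> and
    \<open>(1, norm b)\<close>.\<close>
  have AB: "A * B \<ge> 1 + norm a * norm b"
  proof (rule power2_le_imp_le)
    have "(A * B) ^ 2 = (1 + norm a ^ 2) * (1 + norm b ^ 2)" by (simp add: power_mult_distrib A B)
    moreover have "(norm a - norm b) ^ 2 \<ge> 0" by simp
    ultimately show "(1 + norm a * norm b) ^ 2 \<le> (A * B) ^ 2" by (simp add: power2_eq_square algebra_simps)
  qed (use A B in simp)
  have "c ^ 2 = 1 + norm (a + b) ^ 2 / 4" by (simp add: c_def psi_sq power_divide)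
  moreover have "norm (a + b) ^ 2 + norm (a - b) ^ 2 = 2 * norm a ^ 2 + 2 * norm b ^ 2"
    by (simp add: power2_norm_eq_inner inner_add_left inner_add_right inner_diff_left inner_diff_right)
  ultimately have c2: "c ^ 2 = (A ^ 2 + B ^ 2) / 2 - norm (a - b) ^ 2 / 4"
    unfolding A B by (simp add: field_simps)
  have id: "((A + B) / 2 - c) * (4 * ((A + B) / 2 + c)) = norm (a - b) ^ 2 - (A - B) ^ 2"
  proof -
    have "((A + B) / 2 - c) * (4 * ((A + B) / 2 + c)) = (A + B) ^ 2 - 4 * c ^ 2"
      by (simp add: power2_eq_square field_simps)
    also have "\<dots> = norm (a - b) ^ 2 - (A - B) ^ 2"
      unfolding c2 by (simp add: power2_eq_square field_simps)
    finally show ?thesis .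
  qed
  have AmB: "(A - B) ^ 2 * (A + B) ^ 2 \<le> norm (a - b) ^ 2 * (norm a + norm b) ^ 2"
  proof -
    have "(A - B) ^ 2 * (A + B) ^ 2 = (A ^ 2 - B ^ 2) ^ 2"
      by (simp add: power2_eq_square algebra_simps)
    also have "A ^ 2 - B ^ 2 = (norm a - norm b) * (norm a + norm b)"
      unfolding A B by (simp add: power2_eq_square algebra_simps)
    also have "\<dots> ^ 2 = (norm a - norm b) ^ 2 * (norm a + norm b) ^ 2" by (rule power_mult_distrib)
    also have "\<dots> \<le> norm (a - b) ^ 2 * (norm a + norm b) ^ 2"
      using norm_triangle_ineq3[of a b] by (intro mult_right_mono abs_le_square_iff[THEN iffD1]) auto
    finally show ?thesis .
  qed
  have "(A + B) ^ 2 = A ^ 2 + B ^ 2 + 2 * (A * B)" by (simp add: power2_eq_square algebra_simps)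
  then have gap: "(A + B) ^ 2 \<ge> (norm a + norm b) ^ 2 + 4"
    using AB unfolding A B by (simp add: power2_eq_square algebra_simps)
  \<comment> \<open>The surplus 4 in \<open>gap\<close> keeps \<open>norm (a - b) ^ 2\<close> from
    being absorbed by \<open>(A - B) ^ 2\<close>; it is what makes the convexity strict.\<close>
  have key: "(norm (a - b) ^ 2 - (A - B) ^ 2) * (A + B) ^ 2 \<ge> 4 * norm (a - b) ^ 2"
  proof -
    have "norm (a - b) ^ 2 * ((norm a + norm b) ^ 2 + 4) \<le> norm (a - b) ^ 2 * (A + B) ^ 2"
      using gap by (intro mult_left_mono) auto
    then show ?thesis using AmB by (simp add: algebra_simps)
  qed
  then have "0 \<le> (norm (a - b) ^ 2 - (A - B) ^ 2) * (A + B) ^ 2"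
    by (rule order_trans[rotated]) simp
  then have "0 \<le> norm (a - b) ^ 2 - (A - B) ^ 2"
    using A B by (simp add: zero_le_mult_iff)
  then have "0 \<le> ((A + B) / 2 - c) * (4 * ((A + B) / 2 + c))" unfolding id .
  then have d0: "c \<le> (A + B) / 2"
  proof (rule contrapos_pp)
    assume "\<not> c \<le> (A + B) / 2"
    have "((A + B) / 2 - c) * (4 * ((A + B) / 2 + c)) < 0"
    proof (rule mult_neg_pos)
      show "0 < 4 * ((A + B) / 2 + c)" using A(1) B(1) c by argo
    qed (use \<open>\<not> c \<le> (A + B) / 2\<close> in argo)
    then show "\<not> 0 \<le> ((A + B) / 2 - c) * (4 * ((A + B) / 2 + c))" by simp
  qed
  then show "psi ((1/2) *\<^sub>R (a + b)) \<le> (psi a + psi b) / 2" by (simp add: A_def B_def c_def)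
  have "4 * norm (a - b) ^ 2 \<le> ((A + B) / 2 - c) * (4 * ((A + B) / 2 + c)) * (A + B) ^ 2"
    using key unfolding id .
  also have "\<dots> \<le> ((A + B) / 2 - c) * (4 * (A + B)) * (A + B) ^ 2"
  proof (intro mult_right_mono mult_left_mono)
    show "(A + B) / 2 + c \<le> A + B" using d0 by argo
    show "0 \<le> (A + B) / 2 - c" using d0 by simp
  qed simp_all
  also have "\<dots> = 4 * (((A + B) / 2 - c) * (A + B) ^ 3)" by (simp add: power2_eq_square power3_eq_cube)
  finally show "norm (a - b) ^ 2 \<le> ((psi a + psi b) / 2 - psi ((1/2) *\<^sub>R (a + b))) * (psi a + psi b) ^ 3"
    by (simp add: A_def B_def c_def)
qed

lemma psi_sum_powr_le:
  assumes "q \<ge> 1"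
  shows "(psi a + psi b) powr q \<le> 4 powr q * (1 + norm a powr q + norm b powr q)"
proof -
  define m where "m = max 1 (max (norm a) (norm b))"
  have m: "1 \<le> m" "norm a \<le> m" "norm b \<le> m" by (auto simp: m_def)
  have "(psi a + psi b) powr q \<le> (4 * m) powr q"
    using psi_bounds(3)[of a] psi_bounds(3)[of b] psi_bounds(1)[of a] psi_bounds(1)[of b] m assms by (intro powr_mono2) auto
  also have "\<dots> = 4 powr q * m powr q" using m by (simp add: powr_mult)
  also have "m powr q \<le> 1 + norm a powr q + norm b powr q"
    by (auto simp: m_def max_def)
  finally show ?thesis by simp
qed

text \<open>Split at \<open>psi a + psi b = K\<close>. Below,
  \<open>4 * t * norm (a - b) \<le> 4 * t ^ 2 + norm (a - b) ^ 2\<close> makes the estimate linear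
  in the convexity gap, so that it can be integrated; above, the q-th powers pay with the factor
  \<open>K powr (1 - q)\<close>, small for large \<open>K\<close>.\<close>

lemma norm_diff_le_psi:
  fixes a b :: "'b::real_inner"
  assumes q: "q > 1" and K: "K > 0" and t: "t > 0"
  shows "norm (a - b) \<le> t + K ^ 3 / (4 * t) * ((psi a + psi b) / 2 - psi ((1/2) *\<^sub>R (a + b)))
     + K powr (1 - q) * (4 powr q * (1 + norm a powr q + norm b powr q))"
proof -
  let ?S = "psi a + psi b" and ?d = "(psi a + psi b) / 2 - psi ((1/2) *\<^sub>R (a + b))"
  have S: "?S \<ge> 2" using psi_bounds(1)[of a] psi_bounds(1)[of b] by simp
  have d: "?d \<ge> 0" using psi_convexity(2)[of a b] by simp
  have L: "0 \<le> K powr (1 - q) * (4 powr q * (1 + norm a powr q + norm b powr q))" by simp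
  show ?thesis
  proof (cases "?S \<le> K")
    case True
    have "norm (a - b) ^ 2 \<le> ?d * ?S ^ 3" by (rule psi_convexity(1))
    also have "\<dots> \<le> ?d * K ^ 3" using True S d by (intro mult_left_mono power_mono) auto
    finally have 1: "norm (a - b) ^ 2 \<le> ?d * K ^ 3" .
    have "0 \<le> (norm (a - b) - 2 * t) ^ 2" by simp
    then have "norm (a - b) * (4 * t) \<le> 4 * t * t + norm (a - b) ^ 2" by (simp add: power2_eq_square algebra_simps)
    also have "\<dots> \<le> 4 * t * t + ?d * K ^ 3" using 1 by simp
    finally have "norm (a - b) \<le> (4 * t * t + ?d * K ^ 3) / (4 * t)" using t by (simp add: pos_le_divide_eq)
    also have "\<dots> = t + K ^ 3 / (4 * t) * ?d" using t by (simp add: add_divide_distrib)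
    finally show ?thesis using L by linarith
  next
    case False
    have "norm (a - b) \<le> norm a + norm b" by (rule norm_triangle_ineq4)
    also have "\<dots> \<le> ?S" using psi_bounds(2)[of a] psi_bounds(2)[of b] by simp
    also have "?S = ?S powr (1 - q) * ?S powr q" using S by (simp add: powr_add[symmetric])
    also have "\<dots> \<le> K powr (1 - q) * ?S powr q"
      using False K q by (intro mult_right_mono powr_mono2') auto
    also have "\<dots> \<le> K powr (1 - q) * (4 powr q * (1 + norm a powr q + norm b powr q))"
      using psi_sum_powr_le[of q a b] q by (intro mult_left_mono) auto
    finally have "norm (a - b) \<le> K powr (1 - q) * (4 powr q * (1 + norm a powr q + norm b powr q))" .
    moreover have "0 \<le> K ^ 3 / (4 * t) * ?d" using K t d by simp
    ultimately show ?thesis using t by simp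
  qed
qed

text \<open>The Riesz-Fischer argument: summable increments give a limit almost everywhere, and the
  sum of their norms is at the same time the core of an integrable majorant.\<close>

lemma L1_fast_Cauchy_limit:
  fixes g :: "nat \<Rightarrow> 'a \<Rightarrow> R3"
  assumes int: "\<And>k. integrable M (g k)" and fast: "\<And>k. (\<integral>x. norm (g (Suc k) x - g k x) \<partial>M) \<le> (1/2) ^ k"
  shows "\<exists>f h. f \<in> borel_measurable M \<and> integrable M (h :: 'a \<Rightarrow> real) \<and>
     (AE x in M. (\<lambda>k. g k x) \<longlonglongrightarrow> f x) \<and> (\<forall>k. AE x in M. norm (g k x) \<le> h x)"
proof -
  let ?d = "\<lambda>k x. g (Suc k) x - g k x"
  have mg[measurable]: "g k \<in> borel_measurable M" for k using int by auto
  have id: "integrable M (?d k)" for k using int by simp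
  have "(\<integral>\<^sup>+ x. (\<Sum>k. ennreal (norm (?d k x))) \<partial>M) = (\<Sum>k. \<integral>\<^sup>+ x. ennreal (norm (?d k x)) \<partial>M)"
    by (rule nn_integral_suminf) measurable
  also have "\<dots> \<le> (\<Sum>k. ennreal ((1/2) ^ k))"
  proof (rule suminf_le)
    show "(\<integral>\<^sup>+ x. ennreal (norm (?d k x)) \<partial>M) \<le> ennreal ((1/2) ^ k)" for k
      by (subst nn_integral_eq_integral[OF integrable_norm[OF id]]) (use fast in \<open>auto intro: ennreal_leI\<close>)
  qed auto
  also have "\<dots> = ennreal (\<Sum>k. (1/2) ^ k)"
    by (rule suminf_ennreal2) (auto intro: summable_geometric)
  also have "\<dots> < \<infinity>" by simp
  finally have fin: "(\<integral>\<^sup>+ x. (\<Sum>k. ennreal (norm (?d k x))) \<partial>M) \<noteq> \<infinity>" by simp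
  have "AE x in M. (\<Sum>k. ennreal (norm (?d k x))) \<noteq> \<infinity>"
    by (rule nn_integral_PInf_AE[OF _ fin]) measurable
  then have sm: "AE x in M. summable (\<lambda>k. norm (?d k x))"
    by eventually_elim (rule summable_suminf_not_top, auto)
  have ss: "summable (\<lambda>k. \<integral>x. norm (?d k x) \<partial>M)"
    by (rule summable_comparison_test'[of "\<lambda>k. (1/2::real) ^ k"]) (use fast in \<open>auto intro: summable_geometric\<close>)
  have "AE x in M. summable (\<lambda>k. norm (norm (?d k x)))" using sm by simp
  then have ih: "integrable M (\<lambda>x. \<Sum>k. norm (?d k x))"
    by (intro integrable_suminf integrable_norm id) (use ss in auto)
  define f where "f = (\<lambda>x. g 0 x + (\<Sum>k. ?d k x))"
  define h where "h = (\<lambda>x. norm (g 0 x) + (\<Sum>k. norm (?d k x)))"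
  have "f \<in> borel_measurable M" unfolding f_def by measurable
  moreover have "integrable M h" unfolding h_def using int ih by auto
  moreover have tel: "g k x = g 0 x + (\<Sum>i<k. ?d i x)" for k x
    by (induction k) auto
  have "AE x in M. (\<lambda>k. g k x) \<longlonglongrightarrow> f x"
    using sm
  proof eventually_elim
    case (elim x)
    then have "(\<lambda>k. \<Sum>i<k. ?d i x) \<longlonglongrightarrow> (\<Sum>k. ?d k x)"
      by (rule summable_LIMSEQ[OF summable_norm_cancel])
    then have "(\<lambda>k. g 0 x + (\<Sum>i<k. ?d i x)) \<longlonglongrightarrow> f x" unfolding f_def by (intro tendsto_intros)
    then show ?case by (simp only: tel[symmetric])
  qed
  moreover have "AE x in M. norm (g k x) \<le> h x" for k
    using sm
  proof eventually_elim
    case (elim x)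
    have "norm (g k x) \<le> norm (g 0 x) + norm (\<Sum>i<k. ?d i x)" unfolding tel[of k] by (rule norm_triangle_ineq)
    also have "norm (\<Sum>i<k. ?d i x) \<le> (\<Sum>i<k. norm (?d i x))" by (rule norm_sum)
    also have "\<dots> \<le> (\<Sum>i. norm (?d i x))" by (rule sum_le_suminf[OF elim]) auto
    finally show ?case by (simp add: h_def)
  qed
  ultimately show ?thesis by blast
qed

text \<open>Minimise the integral of \<open>psi\<close> over the tails. The infima increase and stay
  bounded, so they converge; midpoints of near-minimisers lie again in the tail, so their convexity
  gap is small and \<open>norm_diff_le_psi\<close> makes the near-minimisers Cauchy in L1.\<close>

lemma midpoint_tail_limit:
  fixes F :: "nat \<Rightarrow> 'a \<Rightarrow> R3"
  assumes M: "finite_measure M" and q: "q > 1"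
    and mF: "\<And>n. F n \<in> borel_measurable M"
    and iF: "\<And>n. integrable M (\<lambda>x. norm (F n x) powr q)"
    and bF: "\<And>n. (\<integral>x. norm (F n x) powr q \<partial>M) \<le> C"
  shows "\<exists>g f h. (\<forall>k. tail_mid F k (g k)) \<and> f \<in> borel_measurable M \<and> integrable M (h :: 'a \<Rightarrow> real) \<and>
     (AE x in M. (\<lambda>k. g k x) \<longlonglongrightarrow> f x) \<and> (\<forall>k. AE x in M. norm (g k x) \<le> h x) \<and>
     (\<integral>\<^sup>+ x. ennreal (norm (f x) powr q) \<partial>M) < \<infinity>"
proof -
  interpret finite_measure M by (rule M)
  have tail: "g \<in> borel_measurable M \<and> integrable M (\<lambda>x. norm (g x) powr q) \<and> (\<integral>x. norm (g x) powr q \<partial>M) \<le> C"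
    if "tail_mid F n g" for n g
    using that
  proof induction
    case (tail_base m) then show ?case using mF iF bF by blast
  next
    case (tail_midpoint g h)
    then have [measurable]: "g \<in> borel_measurable M" "h \<in> borel_measurable M"
      and ig: "integrable M (\<lambda>x. norm (g x) powr q)" and ih: "integrable M (\<lambda>x. norm (h x) powr q)" by auto
    have pt: "norm ((1/2) *\<^sub>R (g x + h x)) powr q \<le> (norm (g x) powr q + norm (h x) powr q) / 2" for x
    proof -
      have "norm ((1/2) *\<^sub>R (g x + h x)) \<le> (norm (g x) + norm (h x)) / 2"
        using norm_triangle_ineq[of "g x" "h x"] by simp
      then have "norm ((1/2) *\<^sub>R (g x + h x)) powr q \<le> ((norm (g x) + norm (h x)) / 2) powr q"
        using q by (intro powr_mono2) auto
      also have "\<dots> \<le> (norm (g x) powr q + norm (h x) powr q) / 2" using q by (intro powr_midpoint_le) auto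
      finally show ?thesis .
    qed
    have i2: "integrable M (\<lambda>x. (norm (g x) powr q + norm (h x) powr q) / 2)" using ig ih by auto
    have i3: "integrable M (\<lambda>x. norm ((1/2) *\<^sub>R (g x + h x)) powr q)"
      by (rule Bochner_Integration.integrable_bound[OF i2]) (use pt in auto)
    have "(\<integral>x. norm ((1/2) *\<^sub>R (g x + h x)) powr q \<partial>M) \<le> (\<integral>x. (norm (g x) powr q + norm (h x) powr q) / 2 \<partial>M)"
      by (rule integral_mono[OF i3 i2 pt])
    also have "\<dots> \<le> C" using ig ih tail_midpoint by simp
    finally show ?case using i3 by simp
  qed
  have le1: "norm v \<le> 1 + norm v powr q" for v :: R3
  proof (cases "norm v \<le> 1")
    case False
    then have "norm v powr 1 \<le> norm v powr q" using q by (intro powr_mono) auto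
    then show ?thesis using False by simp
  qed (simp add: add_increasing2)
  have ti: "integrable M g" "integrable M (\<lambda>x. psi (g x))" if t: "tail_mid F n g" for n g
  proof -
    have [measurable]: "g \<in> borel_measurable M" using tail[OF t] by blast
    have i1: "integrable M (\<lambda>x. 1 + norm (g x) powr q)" using tail[OF t] by auto
    show i: "integrable M g"
      by (rule Bochner_Integration.integrable_bound[OF i1]) (use le1 in auto)
    have m: "(\<lambda>x. psi (g x)) \<in> borel_measurable M" unfolding psi_def by measurable
    show "integrable M (\<lambda>x. psi (g x))"
    proof (rule Bochner_Integration.integrable_bound[OF _ m])
      show "integrable M (\<lambda>x. 1 + norm (g x))" using i by auto
      show "AE x in M. norm (psi (g x)) \<le> norm (1 + norm (g x))"
      proof (rule AE_I2)
        fix x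
        show "norm (psi (g x)) \<le> norm (1 + norm (g x))"
          using psi_bounds(1)[of "g x"] psi_bounds(3)[of "g x"] by simp
      qed
    qed
  qed
  define J where "J = (\<lambda>g. \<integral>x. psi (g x :: R3) \<partial>M)"
  define B where "B = measure M (space M) * 2 + C"
  have J0: "0 \<le> J g" for g unfolding J_def
    by (rule Bochner_Integration.integral_nonneg) (use order_trans[OF zero_le_one psi_bounds(1)] in auto)
  have JB: "J g \<le> B" if t: "tail_mid F n g" for n g
  proof -
    have "J g \<le> (\<integral>x. 2 + norm (g x) powr q \<partial>M)"
      unfolding J_def
    proof (rule integral_mono)
      show "psi (g x) \<le> 2 + norm (g x) powr q" for x using psi_bounds(3)[of "g x"] le1[of "g x"] by simp
    qed (use ti[OF t] tail[OF t] in auto)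
    also have "\<dots> \<le> B" unfolding B_def using tail[OF t] by (subst Bochner_Integration.integral_add) auto
    finally show ?thesis .
  qed
  define I where "I = (\<lambda>n. Inf (J ` Collect (tail_mid F n)))"
  have ne: "J ` Collect (tail_mid F n) \<noteq> {}" for n using tail_base[of n n F] by blast
  have bb: "bdd_below (J ` Collect (tail_mid F n))" for n using J0 by (intro bdd_belowI[of _ 0]) auto
  have Ile: "I n \<le> J g" if "tail_mid F n g" for n g
    unfolding I_def by (rule cInf_lower[OF _ bb]) (use that in auto)
  have Imono: "I n \<le> I m" if "n \<le> m" for n m
    unfolding I_def by (rule cInf_superset_mono[OF ne bb]) (use tail_mid_antimono[OF _ that] in auto)
  have IB: "I n \<le> B" for n using Ile[OF tail_base[of n n F]] JB[OF tail_base[of n n F]] by simp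
  have "\<exists>g. tail_mid F n g \<and> J g < I n + 1 / real (Suc n)" for n
  proof -
    have "Inf (J ` Collect (tail_mid F n)) < I n + 1 / real (Suc n)" by (simp add: I_def)
    from cInf_lessD[OF ne this] show ?thesis by auto
  qed
  then obtain G where G: "\<And>n. tail_mid F n (G n)" "\<And>n. J (G n) < I n + 1 / real (Suc n)" by metis
  let ?mid = "\<lambda>n m x. (1/2) *\<^sub>R (G n x + G m x)"
  let ?D = "\<lambda>n m. (J (G n) + J (G m)) / 2 - J (?mid n m)"
  have "incseq I" by (simp add: incseq_def Imono)
  then obtain L where "I \<longlonglongrightarrow> L" using incseq_convergent[of I B] IB by blast
  then have CI: "Cauchy I" by (rule LIMSEQ_imp_Cauchy)
  \<comment> \<open>The midpoint of \<open>G n\<close> and \<open>G m\<close> belongs to the larger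
    tail \<open>n\<close>, so its integral is at least \<open>I n\<close>, while each near-minimiser
    exceeds its own infimum by less than \<open>1 / real (Suc n)\<close>.\<close>
  have D: "?D n m \<le> (I m - I n) / 2 + 1 / real (Suc n)" if nm: "n \<le> m" for n m
  proof -
    have "tail_mid F n (?mid n m)"
      by (intro tail_midpoint G tail_mid_antimono[OF G(1) nm])
    then have "I n \<le> J (?mid n m)" by (rule Ile)
    moreover have "1 / real (Suc m) \<le> 1 / real (Suc n)" using nm by (simp add: frac_le)
    moreover have "(a + b) / 2 - c \<le> (j - i) / 2 + d"
      if "i \<le> c" "e \<le> d" "a < i + d" "b < j + e" for a b c d e i j :: real
      using that by argo
    ultimately show ?thesis using G(2)[of n] G(2)[of m] by blast
  qed
  have L1: "(\<integral>x. norm (G n x - G m x) \<partial>M) \<le> t * measure M (space M) + K ^ 3 / (4 * t) * ?D n m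
      + K powr (1 - q) * (4 powr q * (measure M (space M) + 2 * C))"
    if nm: "n \<le> m" and K: "K > 0" and t: "t > 0" for n m K t
  proof -
    have tm: "tail_mid F n (?mid n m)"
      by (intro tail_midpoint G tail_mid_antimono[OF G(1) nm])
    note i = ti[OF G(1)] ti(2)[OF tm] tail[OF G(1), THEN conjunct2, THEN conjunct1]
    let ?R = "\<lambda>x. t + K ^ 3 / (4 * t) * ((psi (G n x) + psi (G m x)) / 2 - psi (?mid n m x))
     + K powr (1 - q) * (4 powr q * (1 + norm (G n x) powr q + norm (G m x) powr q))"
    have "(\<integral>x. norm (G n x - G m x) \<partial>M) \<le> (\<integral>x. ?R x \<partial>M)"
      by (rule integral_mono) (use i norm_diff_le_psi[OF q K t] in auto)
    also have "\<dots> = t * measure M (space M) + K ^ 3 / (4 * t) * ?D n m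
      + K powr (1 - q) * (4 powr q * (measure M (space M) + (\<integral>x. norm (G n x) powr q \<partial>M) + (\<integral>x. norm (G m x) powr q \<partial>M)))"
      using i unfolding J_def by (simp add: mult.commute)
    also have "\<dots> \<le> t * measure M (space M) + K ^ 3 / (4 * t) * ?D n m
      + K powr (1 - q) * (4 powr q * (measure M (space M) + 2 * C))"
      using tail[OF G(1)[of n]] tail[OF G(1)[of m]] by (intro add_left_mono mult_left_mono) auto
    finally show ?thesis .
  qed
  have cauchy: "\<exists>N. \<forall>n\<ge>N. \<forall>m\<ge>n. (\<integral>x. norm (G n x - G m x) \<partial>M) \<le> e" if e: "e > 0" for e
  proof -
    \<comment> \<open>Three errors of \<open>e / 3\<close>, in this order: \<open>t\<close> for the
      mass term, \<open>K\<close> for the large values, and last the index, which makes the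
      convexity gap small against the now fixed factor \<open>K ^ 3 / (4 * t)\<close>.\<close>
    define t where "t = e / (3 * (measure M (space M) + 1))"
    have m0: "measure M (space M) + 1 > 0" by (simp add: add_nonneg_pos)
    have t: "t > 0" "t * measure M (space M) \<le> e / 3"
      using e m0 by (simp_all add: t_def field_simps)
    have "((\<lambda>K. K powr (1 - q) * (4 powr q * (measure M (space M) + 2 * C))) \<longlongrightarrow> 0 * (4 powr q * (measure M (space M) + 2 * C))) at_top"
      using q by (intro tendsto_mult tendsto_neg_powr tendsto_const filterlim_ident) auto
    then have "eventually (\<lambda>K. K powr (1 - q) * (4 powr q * (measure M (space M) + 2 * C)) < e / 3) at_top"
      using e by (intro order_tendstoD(2)) auto
    then obtain K0 where K0: "\<And>K. K \<ge> K0 \<Longrightarrow> K powr (1 - q) * (4 powr q * (measure M (space M) + 2 * C)) < e / 3"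
      unfolding eventually_at_top_linorder by blast
    define K where "K = max 1 K0"
    have K: "K > 0" "K powr (1 - q) * (4 powr q * (measure M (space M) + 2 * C)) < e / 3"
      using K0[of K] by (simp_all add: K_def)
    define k where "k = K ^ 3 / (4 * t)"
    have k: "k > 0" using K t by (simp add: k_def)
    define d where "d = e / (3 * k)"
    have d: "d > 0" "k * d = e / 3" using e k by (simp_all add: d_def)
    obtain N1 where N1: "\<And>m n. m \<ge> N1 \<Longrightarrow> n \<ge> N1 \<Longrightarrow> dist (I m) (I n) < d" using CI d unfolding Cauchy_def by blast
    obtain N2 where N2: "1 / real (Suc N2) < d / 2" using nat_approx_posE[of "d / 2"] d by auto
    show ?thesis
    proof (intro exI[of _ "max N1 N2"] allI impI)
      fix n m assume n: "n \<ge> max N1 N2" and nm: "m \<ge> n"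
      have "1 / real (Suc n) \<le> 1 / real (Suc N2)" using n by (simp add: frac_le)
      moreover have "I m - I n \<le> d" using N1[of m n] n nm by (simp add: dist_real_def)
      moreover have "x \<le> d" if "a \<le> b" "i \<le> d" "b < d / 2" "x \<le> i / 2 + a" for x a b i :: real
        using that by argo
      ultimately have "?D n m \<le> d" using D[OF nm] N2 by blast
      then have "k * ?D n m \<le> e / 3" using mult_left_mono[of "?D n m" d k] k d by simp
      then show "(\<integral>x. norm (G n x - G m x) \<partial>M) \<le> e"
        using L1[OF nm K(1) t(1)] t(2) K(2) unfolding k_def by simp
    qed
  qed
  then have "\<forall>k. \<exists>N. \<forall>n\<ge>N. \<forall>m\<ge>n. (\<integral>x. norm (G n x - G m x) \<partial>M) \<le> (1/2) ^ k" by simp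
  then obtain N where N: "\<And>k n m. n \<ge> N k \<Longrightarrow> m \<ge> n \<Longrightarrow> (\<integral>x. norm (G n x - G m x) \<partial>M) \<le> (1/2) ^ k" by metis
  \<comment> \<open>Adding \<open>k\<close> to the partial sums gives increasing indices that are at
    least \<open>k\<close> and at least \<open>N k\<close>.\<close>
  define s where "s = (\<lambda>k. k + (\<Sum>i\<le>k. N i))"
  have s1: "k \<le> s k" "s k \<le> s (Suc k)" for k by (auto simp: s_def)
  have s2: "N k \<le> s k" for k unfolding s_def by (simp add: member_le_sum trans_le_add2)
  define g where "g = (\<lambda>k. G (s k))"
  have tg: "tail_mid F k (g k)" for k unfolding g_def by (rule tail_mid_antimono[OF G(1) s1(1)])
  have "\<exists>f h. f \<in> borel_measurable M \<and> integrable M (h :: 'a \<Rightarrow> real) \<and>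
     (AE x in M. (\<lambda>k. g k x) \<longlonglongrightarrow> f x) \<and> (\<forall>k. AE x in M. norm (g k x) \<le> h x)"
  proof (rule L1_fast_Cauchy_limit)
    show "integrable M (g k)" for k unfolding g_def by (rule ti(1)[OF G(1)])
    show "(\<integral>x. norm (g (Suc k) x - g k x) \<partial>M) \<le> (1/2) ^ k" for k
      using N[OF s2 s1(2), of k] by (simp add: g_def norm_minus_commute)
  qed
  then obtain f and h :: "'a \<Rightarrow> real" where fh: "f \<in> borel_measurable M" "integrable M h"
    "AE x in M. (\<lambda>k. g k x) \<longlonglongrightarrow> f x" "\<And>k. AE x in M. norm (g k x) \<le> h x" by blast
  have [measurable]: "g k \<in> borel_measurable M" for k using tail[OF tg] by blast
  have "(\<integral>\<^sup>+ x. ennreal (norm (f x) powr q) \<partial>M) = (\<integral>\<^sup>+ x. liminf (\<lambda>k. ennreal (norm (g k x) powr q)) \<partial>M)"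
  proof (rule nn_integral_cong_AE)
    show "AE x in M. ennreal (norm (f x) powr q) = liminf (\<lambda>k. ennreal (norm (g k x) powr q))"
      using fh(3)
    proof eventually_elim
      case (elim x)
      have "(\<lambda>k. norm (g k x) powr q) \<longlonglongrightarrow> norm (f x) powr q"
        by (rule tendsto_powr2[OF tendsto_norm[OF elim] tendsto_const]) (use q in auto)
      then have "(\<lambda>k. ennreal (norm (g k x) powr q)) \<longlonglongrightarrow> ennreal (norm (f x) powr q)" by (rule tendsto_ennrealI)
      from lim_imp_Liminf[OF _ this] show ?case by simp
    qed
  qed
  \<comment> \<open>Fatou's lemma carries the bound on the q-th powers to the limit.\<close>
  also have "\<dots> \<le> liminf (\<lambda>k. \<integral>\<^sup>+ x. ennreal (norm (g k x) powr q) \<partial>M)"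
    by (rule nn_integral_liminf) measurable
  also have "\<dots> \<le> liminf (\<lambda>k. ennreal C)"
  proof (rule Liminf_mono, rule always_eventually, rule allI)
    fix k
    have "(\<integral>\<^sup>+ x. ennreal (norm (g k x) powr q) \<partial>M) = ennreal (\<integral>x. norm (g k x) powr q \<partial>M)"
      by (rule nn_integral_eq_integral) (use tail[OF tg] in auto)
    then show "(\<integral>\<^sup>+ x. ennreal (norm (g k x) powr q) \<partial>M) \<le> ennreal C"
      using tail[OF tg[of k]] by (simp add: ennreal_leI)
  qed
  also have "\<dots> < \<infinity>" by (simp add: Liminf_const)
  finally show ?thesis using fh tg by blast
qed

section \<open>Weak compactness of measures on the sphere\<close>

text \<open>Schoenberg's space-filling curve reads off the ternary digits of its argument: \<open>hf\<close> has period 2,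
  vanishes on \<open>[0, 1/3]\<close> and equals 1 on \<open>[2/3, 1]\<close>. It transfers weak compactness of measures from
  the real line (Helly's theorem) to the sphere.\<close>

definition hf :: "real \<Rightarrow> real" where
  "hf t = min 1 (max 0 (1/2 - cos (pi * t)))"

lemma hf_bounds: "0 \<le> hf t" "hf t \<le> 1"
  by (simp_all add: hf_def)

lemma continuous_on_hf [continuous_intros]:
  fixes f :: "'a::metric_space \<Rightarrow> real"
  shows "continuous_on A f \<Longrightarrow> continuous_on A (\<lambda>x. hf (f x))"
  unfolding hf_def by (intro continuous_intros)

lemma hf_periodic: "hf (t + 2 * real n) = hf t"
proof (induction n)
  case (Suc n)
  have "cos (pi * (t + 2 * real (Suc n))) = cos (pi * (t + 2 * real n) + 2 * pi)" by (simp add: algebra_simps)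
  also have "\<dots> = cos (pi * (t + 2 * real n))" by (rule cos_periodic)
  finally show ?case using Suc by (simp add: hf_def)
qed simp

lemma hf_0: assumes "0 \<le> t" "t \<le> 1/3" shows "hf t = 0"
proof -
  have "cos (pi / 3) \<le> cos (pi * t)"
    by (rule cos_monotone_0_pi_le) (use assms in auto)
  then show ?thesis by (simp add: hf_def cos_60)
qed

lemma hf_1: assumes "2/3 \<le> t" "t \<le> 1" shows "hf t = 1"
proof -
  have "cos (pi * t) \<le> cos (2 * pi / 3)"
    by (rule cos_monotone_0_pi_le) (use assms in auto)
  then show ?thesis by (simp add: hf_def cos_120)
qed

text \<open>For a sequence of zeros and ones, the point of the Cantor set with ternary digits
  \<open>2 * a i\<close>.\<close>

definition ternary :: "(nat \<Rightarrow> real) \<Rightarrow> real" where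
  "ternary a = (\<Sum>i. 2 * a i / 3 ^ Suc i)"

lemma summable_ternary:
  fixes a :: "nat \<Rightarrow> real"
  assumes "\<And>i. a i \<in> {0, 1}" shows "summable (\<lambda>i. 2 * a i / 3 ^ Suc i)"
proof (rule summable_comparison_test'[of "\<lambda>i. 2 / 3 * (1 / 3) ^ i"])
  show "summable (\<lambda>i. 2 / 3 * (1 / 3 :: real) ^ i)" by (intro summable_mult summable_geometric) simp
  show "norm (2 * a n / 3 ^ Suc n) \<le> 2 / 3 * (1 / 3) ^ n" for n
    using assms[of n] by (auto simp: power_divide)
qed

lemma ternary_bounds:
  assumes a: "\<And>i. a i \<in> {0, 1}" shows "0 \<le> ternary a" "ternary a \<le> 1"
proof -
  have nn: "0 \<le> 2 * a i / 3 ^ Suc i" for i using a[of i] by auto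
  show "0 \<le> ternary a" unfolding ternary_def by (rule suminf_nonneg[OF summable_ternary[OF a] nn])
  have "ternary a \<le> (\<Sum>i. 2 / 3 * (1 / 3) ^ i)"
    unfolding ternary_def
  proof (rule suminf_le[OF _ summable_ternary[OF a]])
    show "2 * a i / 3 ^ Suc i \<le> 2 / 3 * (1 / 3) ^ i" for i
      using a[of i] by (auto simp: power_divide)
    show "summable (\<lambda>i. 2 / 3 * (1 / 3 :: real) ^ i)" by (intro summable_mult summable_geometric) simp
  qed
  also have "\<dots> = 2 / 3 * (1 / (1 - 1 / 3))"
    by (subst suminf_mult) (simp_all add: suminf_geometric summable_geometric)
  finally show "ternary a \<le> 1" by simp
qed

lemma ternary_Suc:
  assumes a: "\<And>i. a i \<in> {0, 1}" shows "3 * ternary a = 2 * a 0 + ternary (\<lambda>i. a (Suc i))"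
proof -
  have s: "summable (\<lambda>i. 2 * a i / 3 ^ Suc i)" by (rule summable_ternary) (rule a)
  have "ternary a = (\<Sum>i. 2 * a (Suc i) / 3 ^ Suc (Suc i)) + 2 * a 0 / 3 ^ Suc 0"
    unfolding ternary_def using suminf_split_head[OF s] by simp
  also have "(\<Sum>i. 2 * a (Suc i) / 3 ^ Suc (Suc i)) = (\<Sum>i. (1 / 3) * (2 * a (Suc i) / 3 ^ Suc i))"
    by (rule suminf_cong) simp
  also have "\<dots> = (1 / 3) * ternary (\<lambda>i. a (Suc i))"
    unfolding ternary_def by (rule suminf_mult[OF summable_ternary]) (rule a)
  finally show ?thesis by simp
qed

text \<open>Multiplication by \<open>3 ^ m\<close> moves the first \<open>m\<close> digits into an
  even integer, invisible to \<open>hf\<close> by its period 2; the next digit, 0 or 2, puts the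
  remainder into [0, 1/3] or [2/3, 1].\<close>

lemma hf_ternary:
  assumes "\<And>i. a i \<in> {0, 1}" shows "hf (3 ^ m * ternary a) = a m"
  using assms
proof (induction m arbitrary: a)
  case 0
  let ?b = "\<lambda>i. a (Suc i)"
  have b: "0 \<le> ternary ?b" "ternary ?b \<le> 1" by (rule ternary_bounds, rule 0)+
  have t: "ternary a = (2 * a 0 + ternary ?b) / 3" using ternary_Suc[of a, OF 0] by simp
  show ?case
  proof (cases "a 0 = 0")
    case True then show ?thesis using b t by (simp add: hf_0)
  next
    case False
    then have "a 0 = 1" using 0[of 0] by auto
    then show ?thesis using b t by (simp add: hf_1)
  qed
next
  case (Suc m)
  let ?b = "\<lambda>i. a (Suc i)"
  obtain n :: nat where n: "a 0 = real n" using Suc.prems[of 0] by (metis empty_iff insertE of_nat_0 of_nat_1)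
  have "3 ^ Suc m * ternary a = 3 ^ m * (3 * ternary a)" by simp
  also have "\<dots> = 3 ^ m * ternary ?b + 2 * real (3 ^ m * n)"
    unfolding ternary_Suc[of a, OF Suc.prems] n by (simp add: algebra_simps)
  finally have "hf (3 ^ Suc m * ternary a) = hf (3 ^ m * ternary ?b)" by (simp only: hf_periodic)
  also have "\<dots> = a (Suc m)" by (rule Suc.IH) (rule Suc.prems)
  finally show ?case .
qed

text \<open>The digit of weight \<open>1 / 2 ^ Suc k\<close> in the binary expansion of
  \<open>y\<close>.\<close>

definition bdig :: "nat \<Rightarrow> real \<Rightarrow> real" where
  "bdig k y = real_of_int \<lfloor>2 ^ Suc k * y\<rfloor> - 2 * real_of_int \<lfloor>2 ^ k * y\<rfloor>"

lemma bdig_01: "bdig k y \<in> {0, 1}"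
proof -
  let ?z = "2 ^ k * y"
  have e: "2 ^ Suc k * y = 2 * ?z" by simp
  have "2 * \<lfloor>?z\<rfloor> \<le> \<lfloor>2 * ?z\<rfloor>" "\<lfloor>2 * ?z\<rfloor> \<le> 2 * \<lfloor>?z\<rfloor> + 1" by linarith+
  then have "\<lfloor>2 * ?z\<rfloor> - 2 * \<lfloor>?z\<rfloor> = 0 \<or> \<lfloor>2 * ?z\<rfloor> - 2 * \<lfloor>?z\<rfloor> = 1" by linarith
  then have "real_of_int (\<lfloor>2 * ?z\<rfloor> - 2 * \<lfloor>?z\<rfloor>) = 0 \<or> real_of_int (\<lfloor>2 * ?z\<rfloor> - 2 * \<lfloor>?z\<rfloor>) = 1"
    by (metis of_int_0 of_int_1)
  then show ?thesis unfolding bdig_def e by simp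
qed

text \<open>The partial sums telescope to the truncations of \<open>y\<close> to \<open>n\<close>
  binary places.\<close>

lemma bdig_sums:
  assumes "0 \<le> y" "y < 1" shows "(\<lambda>k. bdig k y / 2 ^ Suc k) sums y"
proof -
  have s: "(\<Sum>k<n. bdig k y / 2 ^ Suc k) = real_of_int \<lfloor>2 ^ n * y\<rfloor> / 2 ^ n" for n
  proof (induction n)
    case 0
    have "\<lfloor>y\<rfloor> = 0" using assms by (simp add: floor_eq_iff)
    then show ?case by simp
  next
    case (Suc n) then show ?case by (simp add: bdig_def diff_divide_distrib)
  qed
  have "(\<lambda>n. real_of_int \<lfloor>2 ^ n * y\<rfloor> / 2 ^ n) \<longlonglongrightarrow> y"
  proof (rule LIMSEQ_I)
    fix e :: real assume e: "e > 0"
    obtain N where N: "(1/2 :: real) ^ N < e" using real_arch_pow_inv[OF e, of "1/2"] by auto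
    show "\<exists>N. \<forall>n\<ge>N. norm (real_of_int \<lfloor>2 ^ n * y\<rfloor> / 2 ^ n - y) < e"
    proof (intro exI[of _ N] allI impI)
      fix n assume n: "n \<ge> N"
      have "real_of_int \<lfloor>2 ^ n * y\<rfloor> / 2 ^ n - y = (real_of_int \<lfloor>2 ^ n * y\<rfloor> - 2 ^ n * y) * (1/2) ^ n"
        by (simp add: field_simps power_divide)
      moreover have "\<bar>real_of_int \<lfloor>2 ^ n * y\<rfloor> - 2 ^ n * y\<bar> \<le> 1" by linarith
      ultimately have "norm (real_of_int \<lfloor>2 ^ n * y\<rfloor> / 2 ^ n - y) \<le> 1 * (1/2) ^ n"
        by (simp only: real_norm_def abs_mult) (intro mult_mono, auto)
      also have "\<dots> \<le> (1/2) ^ N" using n by (simp add: power_decreasing)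
      finally show "norm (real_of_int \<lfloor>2 ^ n * y\<rfloor> / 2 ^ n - y) < e" using N by simp
    qed
  qed
  then show ?thesis unfolding sums_def s .
qed

section \<open>A Borel code of the sphere, inverted by a continuous curve\<close>

definition idx3 :: "3 \<Rightarrow> nat" where
  "idx3 j = (if j = 1 then 0 else if j = 2 then 1 else 2)"

definition sel3 :: "nat \<Rightarrow> 3" where
  "sel3 n = (if n = 0 then 1 else if n = 1 then 2 else 3)"

lemma sel3_idx3: "sel3 (idx3 j) = j" "idx3 j < 3"
  using exhaust_3[of j] by (auto simp: sel3_def idx3_def)

text \<open>Binary digits of the three coordinates, interleaved. The rescaling sends [-1, 1] to
  [0, 2/3], strictly below 1, so that the binary expansion is available at every point of the
  sphere.\<close>

definition sphere_digit :: "R3 \<Rightarrow> nat \<Rightarrow> real" where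
  "sphere_digit x i = bdig (i div 3) ((x $ sel3 (i mod 3) + 1) / 3)"

definition sphere_code :: "R3 \<Rightarrow> real" where
  "sphere_code x = ternary (sphere_digit x)"

text \<open>Sums the digits read off by \<open>hf\<close> back into each coordinate and undoes the
  rescaling. Its values lie in the cube with edges [-1, 2] and may miss the sphere.\<close>

definition curve :: "real \<Rightarrow> R3" where
  "curve t = (\<chi> j. 3 * (\<Sum>k. hf (3 ^ (3 * k + idx3 j) * t) / 2 ^ Suc k) - 1)"

text \<open>The code is Borel and the curve continuous: measures are pushed forward along the code,
  and test functions are pulled back along the curve.\<close>

lemma curve_code:
  assumes x: "norm x = 1" shows "curve (sphere_code x) = x"
proof -
  have "3 * (\<Sum>k. hf (3 ^ (3 * k + idx3 j) * sphere_code x) / 2 ^ Suc k) - 1 = x $ j" for j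
  proof -
    have d: "hf (3 ^ (3 * k + idx3 j) * sphere_code x) = bdig k ((x $ j + 1) / 3)" for k
    proof -
      have "hf (3 ^ (3 * k + idx3 j) * sphere_code x) = sphere_digit x (3 * k + idx3 j)"
        unfolding sphere_code_def by (rule hf_ternary) (simp add: sphere_digit_def bdig_01 del: insert_iff)
      also have "\<dots> = bdig k ((x $ j + 1) / 3)"
        using sel3_idx3[of j] by (simp add: sphere_digit_def)
      finally show ?thesis .
    qed
    have "\<bar>x $ j\<bar> \<le> 1" using component_le_norm_cart[of x j] x by simp
    then have "(\<lambda>k. bdig k ((x $ j + 1) / 3) / 2 ^ Suc k) sums ((x $ j + 1) / 3)"
      by (intro bdig_sums) auto
    then show ?thesis unfolding d by (simp add: sums_iff)
  qed
  then show ?thesis by (simp add: curve_def vec_eq_iff)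
qed

lemma continuous_on_curve: "continuous_on UNIV curve"
  unfolding curve_def
proof (intro continuous_on_vec_lambda continuous_intros)
  fix j
  let ?f = "\<lambda>k t. hf (3 ^ (3 * k + idx3 j) * t) / 2 ^ Suc k"
  have "uniform_limit UNIV (\<lambda>n t. \<Sum>k<n. ?f k t) (\<lambda>t. \<Sum>k. ?f k t) sequentially"
  proof (rule Weierstrass_m_test)
    show "norm (?f k t) \<le> (1/2) ^ Suc k" for k t
      using hf_bounds[of "3 ^ (3 * k + idx3 j) * t"] by (simp add: power_divide divide_right_mono)
    show "summable (\<lambda>k. (1/2 :: real) ^ Suc k)" by (subst summable_Suc_iff) (simp add: summable_geometric)
  qed
  then show "continuous_on UNIV (\<lambda>t. \<Sum>k. ?f k t)"
    by (rule uniform_limit_theorem[rotated]) (auto intro!: always_eventually continuous_intros)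
qed

lemma sphere_code_measurable: "sphere_code \<in> borel_measurable borel"
  unfolding sphere_code_def ternary_def sphere_digit_def bdig_def by measurable

section \<open>Weak limits of positive densities\<close>

definition sphere_weak_limit :: "(nat \<Rightarrow> R3 \<Rightarrow> real) \<Rightarrow> R3 measure \<Rightarrow> bool" where
  "sphere_weak_limit G \<nu> \<longleftrightarrow> sets \<nu> = sets sphere_measure \<and> finite_measure \<nu> \<and>
     (\<forall>\<phi>. continuous_on S2 \<phi> \<longrightarrow> (\<lambda>n. \<integral>w. \<phi> w * G n w \<partial>sphere_measure) \<longlonglongrightarrow> (\<integral>w. \<phi> w \<partial>\<nu>))"

text \<open>Normalised and coded, the densities are probability measures on a fixed interval, hence
  tight, and Helly's theorem gives a weak limit on the line. It is brought back to the sphere along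
  the curve and multiplied by the limit \<open>l\<close> of the masses.\<close>

lemma sphere_weak_compactness:
  assumes iG: "\<And>n. integrable sphere_measure (G n)" and nn: "\<And>n w. G n w \<ge> 0"
    and pos: "\<And>n. (\<integral>w. G n w \<partial>sphere_measure) > 0" and bd: "\<And>n. (\<integral>w. G n w \<partial>sphere_measure) \<le> C"
  shows "\<exists>s \<nu>. strict_mono (s :: nat \<Rightarrow> nat) \<and> sphere_weak_limit (\<lambda>n. G (s n)) \<nu>"
proof -
  let ?\<sigma> = sphere_measure
  define m where "m = (\<lambda>n. \<integral>w. G n w \<partial>?\<sigma>)"
  have m: "m n > 0" "m n \<le> C" for n using pos bd by (auto simp: m_def)
  have mG[measurable]: "G n \<in> borel_measurable ?\<sigma>" for n using iG by auto
  have mc[measurable]: "sphere_code \<in> borel_measurable ?\<sigma>"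
    unfolding measurable_cong_sets[OF sets_sphere_measure refl]
    by (rule measurable_restrict_space1[OF sphere_code_measurable])
  define D where "D = (\<lambda>n. density ?\<sigma> (\<lambda>w. ennreal (G n w / m n)))"
  define N where "N = (\<lambda>n. distr (D n) borel sphere_code)"
  have mD: "sphere_code \<in> borel_measurable (D n)" for n unfolding D_def by simp
  have intD: "(\<integral>w. f w \<partial>D n) = (\<integral>w. f w * G n w \<partial>?\<sigma>) / m n" if "f \<in> borel_measurable ?\<sigma>" for f :: "R3 \<Rightarrow> real" and n
  proof -
    have "(\<integral>w. f w \<partial>D n) = (\<integral>w. (G n w / m n) *\<^sub>R f w \<partial>?\<sigma>)"
      unfolding D_def by (rule integral_density) (use that nn m in \<open>auto simp: less_imp_le\<close>)
    also have "\<dots> = (\<integral>w. (1 / m n) * (f w * G n w) \<partial>?\<sigma>)"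
      by (rule Bochner_Integration.integral_cong) auto
    finally show ?thesis by simp
  qed
  have pD: "prob_space (D n)" for n
  proof (rule prob_spaceI)
    have "emeasure (D n) (space (D n)) = (\<integral>\<^sup>+ w. ennreal (G n w / m n) \<partial>?\<sigma>)"
      unfolding D_def by (subst emeasure_density) (auto intro!: nn_integral_cong)
    also have "\<dots> = ennreal (\<integral>w. G n w / m n \<partial>?\<sigma>)"
      by (rule nn_integral_eq_integral) (use iG nn m in \<open>auto simp: less_imp_le\<close>)
    also have "(\<integral>w. G n w / m n \<partial>?\<sigma>) = 1" using m(1)[of n] by (simp add: m_def)
    finally show "emeasure (D n) (space (D n)) = 1" by simp
  qed
  have rN: "real_distribution (N n)" for n
    unfolding N_def by (rule prob_space.real_distribution_distr[OF pD mD])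
  have intN: "(\<integral>t. f t \<partial>N n) = (\<integral>w. f (sphere_code w) * G n w \<partial>?\<sigma>) / m n"
    if "f \<in> borel_measurable borel" for f :: "real \<Rightarrow> real" and n
  proof -
    have "(\<integral>t. f t \<partial>N n) = (\<integral>w. f (sphere_code w) \<partial>D n)"
      unfolding N_def by (rule integral_distr[OF mD that])
    also have "\<dots> = (\<integral>w. f (sphere_code w) * G n w \<partial>?\<sigma>) / m n"
      by (rule intD) (use measurable_compose[OF mc that] in simp)
    finally show ?thesis .
  qed
  have code01: "0 \<le> sphere_code w" "sphere_code w \<le> 1" for w
    unfolding sphere_code_def by (rule ternary_bounds, simp add: sphere_digit_def bdig_01 del: insert_iff)+
  have tight: "tight N"
    unfolding tight_def
  proof (intro conjI allI impI rN)
    fix e :: real assume e: "e > 0"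
    have "measure (N n) {-1<..2} = 1" for n
    proof -
      interpret prob_space "D n" by (rule pD)
      have "measure (N n) {-1<..2} = measure (D n) (sphere_code -` {-1<..2} \<inter> space (D n))"
        unfolding N_def by (rule measure_distr[OF mD]) simp
      also have "sphere_code -` {-1<..2} \<inter> space (D n) = space (D n)"
      proof -
        have "- 1 < sphere_code w" "sphere_code w \<le> 2" for w using code01[of w] by linarith+
        then show ?thesis by auto
      qed
      finally show ?thesis by (simp add: prob_space)
    qed
    then show "\<exists>a b. a < b \<and> (\<forall>n. 1 - e < measure (N n) {a<..b})"
      using e by (intro exI[of _ "-1"] exI[of _ 2]) auto
  qed
  have "bounded (range m)" unfolding bounded_iff using m by (intro exI[of _ C]) (auto simp: abs_of_pos)
  then obtain l s where s: "strict_mono (s :: nat \<Rightarrow> nat)" "(m \<circ> s) \<longlonglongrightarrow> l"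
    using bounded_imp_convergent_subsequence by blast
  obtain r M where r: "strict_mono (r :: nat \<Rightarrow> nat)" and M: "real_distribution M" and w: "weak_conv_m (N \<circ> s \<circ> r) M"
    using tight_imp_convergent_subsubsequence[OF tight s(1)] by blast
  define k where "k = s \<circ> r"
  have k: "strict_mono k" unfolding k_def by (rule strict_mono_o[OF s(1) r])
  have ml: "(\<lambda>n. m (k n)) \<longlonglongrightarrow> l" using LIMSEQ_subseq_LIMSEQ[OF s(2) r] by (simp add: k_def o_def)
  have l0: "l \<ge> 0" by (rule LIMSEQ_le_const[OF ml]) (use m in \<open>auto simp: less_imp_le\<close>)
  interpret M: real_distribution M by (rule M)
  have wk: "(\<lambda>n. \<integral>t. f t \<partial>N (k n)) \<longlonglongrightarrow> (\<integral>t. f t \<partial>M)"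
    if "continuous_on UNIV f" "\<And>t. \<bar>f t\<bar> \<le> B" for f :: "real \<Rightarrow> real" and B
    using weak_conv_imp_integral_bdd_continuous_conv[of "N \<circ> s \<circ> r" M f B] rN M w that
    by (simp add: k_def o_def continuous_on_eq_continuous_at)
  have cc: "curve (sphere_code w) = w" if "w \<in> space ?\<sigma>" for w
    by (rule curve_code) (use that in \<open>simp add: space_sphere_measure\<close>)
  have mcurve[measurable]: "curve \<in> borel_measurable borel"
    by (rule borel_measurable_continuous_onI[OF continuous_on_curve])
  have lim: "(\<lambda>n. \<integral>w. g w * G (k n) w \<partial>?\<sigma>) \<longlonglongrightarrow> l * (\<integral>t. g (curve t) \<partial>M)"
    if g: "continuous_on UNIV g" "\<And>y. \<bar>g y\<bar> \<le> B" for g :: "R3 \<Rightarrow> real" and B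
  proof -
    have c: "continuous_on UNIV (\<lambda>t. g (curve t))"
      by (rule continuous_on_compose2[OF g(1) continuous_on_curve]) simp
    have "(\<lambda>n. m (k n) * (\<integral>t. g (curve t) \<partial>N (k n))) \<longlonglongrightarrow> l * (\<integral>t. g (curve t) \<partial>M)"
      by (intro tendsto_mult ml wk[OF c]) (rule g(2))
    moreover have "m (k n) * (\<integral>t. g (curve t) \<partial>N (k n)) = (\<integral>w. g w * G (k n) w \<partial>?\<sigma>)" for n
    proof -
      have "(\<integral>t. g (curve t) \<partial>N (k n)) = (\<integral>w. g (curve (sphere_code w)) * G (k n) w \<partial>?\<sigma>) / m (k n)"
        by (rule intN) (rule borel_measurable_continuous_onI[OF c])
      also have "(\<integral>w. g (curve (sphere_code w)) * G (k n) w \<partial>?\<sigma>) = (\<integral>w. g w * G (k n) w \<partial>?\<sigma>)"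
        by (rule Bochner_Integration.integral_cong) (simp_all add: cc)
      finally show ?thesis using m(1)[of "k n"] by simp
    qed
    ultimately show ?thesis by simp
  qed
  \<comment> \<open>The limit might charge parameters that the curve maps off the sphere. A bounded
    continuous function of \<open>t\<close>, zero exactly when \<open>curve t\<close> is on the
    sphere, integrates to 0 along the sequence and hence in the limit, which excludes this.\<close>
  have onS: "AE t in M. curve t \<in> S2"
  proof -
    let ?g = "\<lambda>y::R3. min 1 \<bar>norm y - 1\<bar>"
    let ?gc = "\<lambda>t. ?g (curve t)"
    have c: "continuous_on UNIV ?gc"
      by (intro continuous_intros continuous_on_compose2[OF continuous_on_norm_id continuous_on_curve]) auto
    have mgc: "?gc \<in> borel_measurable borel" by (rule borel_measurable_continuous_onI[OF c])
    have "(\<integral>t. ?gc t \<partial>N (k n)) = 0" for n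
    proof -
      have "(\<integral>w. ?gc (sphere_code w) * G (k n) w \<partial>?\<sigma>) = (\<integral>w. 0 \<partial>?\<sigma>)"
        by (rule Bochner_Integration.integral_cong[OF refl]) (simp add: cc, simp add: space_sphere_measure)
      then show ?thesis unfolding intN[OF mgc] by simp
    qed
    moreover have "(\<lambda>n. \<integral>t. ?gc t \<partial>N (k n)) \<longlonglongrightarrow> (\<integral>t. ?gc t \<partial>M)"
      by (rule wk[OF c, of 1]) auto
    ultimately have z: "(\<integral>t. ?gc t \<partial>M) = 0" by (simp add: LIMSEQ_const_iff)
    have i: "integrable M ?gc"
      by (rule M.integrable_const_bound[of _ 1]) (use mgc in auto)
    have "AE t in M. ?gc t = 0"
      using integral_nonneg_eq_0_iff_AE[OF i] z by simp
    then show ?thesis by eventually_elim (simp add: min_def split: if_splits)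
  qed
  \<comment> \<open>The curve, changed on a null set so as to stay on the sphere;
    \<open>axis 1 1\<close> is an arbitrary point of it.\<close>
  define cur where "cur = (\<lambda>t. if curve t \<in> S2 then curve t else axis 1 1)"
  have mS: "{t. curve t \<in> S2} \<in> sets borel"
    using measurable_sets[OF mcurve, of S2] by (simp add: vimage_def)
  have cur1: "cur \<in> borel_measurable borel"
    unfolding cur_def by (rule measurable_If[OF mcurve]) (use mS in auto)
  have cur2: "cur \<in> measurable (density M (\<lambda>_. ennreal l)) (restrict_space borel S2)"
  proof (rule measurable_restrict_space2)
    show "cur \<in> borel_measurable (density M (\<lambda>_. ennreal l))" using cur1 by simp
    show "cur \<in> space (density M (\<lambda>_. ennreal l)) \<rightarrow> S2" by (auto simp: cur_def)
  qed
  define \<nu> where "\<nu> = distr (density M (\<lambda>_. ennreal l)) (restrict_space borel S2) cur"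
  have s\<nu>: "sets \<nu> = sets ?\<sigma>" by (simp add: \<nu>_def sets_sphere_measure)
  have f\<nu>: "finite_measure \<nu>"
  proof (rule finite_measureI)
    have "finite_measure (density M (\<lambda>_. ennreal l))"
      by (rule finite_measureI) (simp add: emeasure_density M.emeasure_eq_measure ennreal_mult_eq_top_iff)
    from finite_measure.finite_measure_distr[OF this cur2] have "finite_measure \<nu>" unfolding \<nu>_def .
    then show "emeasure \<nu> (space \<nu>) \<noteq> \<infinity>" by (simp add: finite_measure.emeasure_finite)
  qed
  have "(\<lambda>n. \<integral>w. \<phi> w * G (k n) w \<partial>?\<sigma>) \<longlonglongrightarrow> (\<integral>w. \<phi> w \<partial>\<nu>)" if \<phi>: "continuous_on S2 \<phi>" for \<phi> :: "R3 \<Rightarrow> real"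
  proof -
    obtain B where bB: "\<forall>q\<in>\<phi> ` S2. norm q \<le> B"
      using compact_imp_bounded[OF compact_continuous_image[OF \<phi> compact_sphere]] unfolding bounded_iff by blast
    have B: "norm (\<phi> w) \<le> \<bar>B\<bar>" if "w \<in> S2" for w
    proof -
      have "norm (\<phi> w) \<le> B" using bB that by blast
      then show ?thesis by linarith
    qed
    \<comment> \<open>The Tietze extension makes the test function composable with
      \<open>curve\<close>, whose values may leave the sphere.\<close>
    obtain g where g: "continuous_on UNIV g" "\<And>x. x \<in> S2 \<Longrightarrow> g x = \<phi> x" "\<And>x. x \<in> UNIV \<Longrightarrow> norm (g x) \<le> \<bar>B\<bar>"
      using Tietze[OF \<phi>, of UNIV "\<bar>B\<bar>"] B by auto
    have eq: "(\<integral>w. g w * G (k n) w \<partial>?\<sigma>) = (\<integral>w. \<phi> w * G (k n) w \<partial>?\<sigma>)" for n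
      by (rule Bochner_Integration.integral_cong) (use g(2) in \<open>auto simp: space_sphere_measure\<close>)
    have m\<phi>: "\<phi> \<in> borel_measurable (restrict_space borel S2)" by (rule borel_measurable_continuous_on_restrict[OF \<phi>])
    have m\<phi>c: "(\<lambda>t. \<phi> (cur t)) \<in> borel_measurable M"
      using measurable_compose[OF cur2 m\<phi>] by simp
    have "(\<integral>w. \<phi> w \<partial>\<nu>) = (\<integral>t. \<phi> (cur t) \<partial>density M (\<lambda>_. ennreal l))"
      unfolding \<nu>_def by (rule integral_distr[OF cur2 m\<phi>])
    also have "\<dots> = (\<integral>t. l *\<^sub>R \<phi> (cur t) \<partial>M)"
      by (rule integral_density) (use m\<phi>c l0 in auto)
    also have "\<dots> = l * (\<integral>t. \<phi> (cur t) \<partial>M)" by simp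
    also have "(\<integral>t. \<phi> (cur t) \<partial>M) = (\<integral>t. g (curve t) \<partial>M)"
    proof (rule integral_cong_AE[OF m\<phi>c])
      show "(\<lambda>t. g (curve t)) \<in> borel_measurable M"
        using measurable_compose[OF mcurve borel_measurable_continuous_onI[OF g(1)]] by simp
      show "AE t in M. \<phi> (cur t) = g (curve t)"
        using onS by eventually_elim (use g(2) in \<open>auto simp: cur_def\<close>)
    qed
    finally show ?thesis using lim[OF g(1), of "\<bar>B\<bar>"] g(3) unfolding eq by simp
  qed
  then have "sphere_weak_limit (\<lambda>n. G (k n)) \<nu>" unfolding sphere_weak_limit_def using s\<nu> f\<nu> by blast
  then show ?thesis using k by blast
qed

lemma sphere_weak_limit_subseq:
  assumes "sphere_weak_limit G \<nu>" "strict_mono r"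
  shows "sphere_weak_limit (\<lambda>n. G (r n)) \<nu>"
  using assms LIMSEQ_subseq_LIMSEQ[OF _ assms(2)] unfolding sphere_weak_limit_def o_def by fastforce

text \<open>Successive extraction gives a common subsequence for the six densities of a vector
  field, one for each component and sign.\<close>

lemma sphere_weak_compactness_finite:
  fixes G :: "'i \<Rightarrow> nat \<Rightarrow> R3 \<Rightarrow> real"
  assumes "finite A" and iG: "\<And>a n. integrable sphere_measure (G a n)" and nn: "\<And>a n w. G a n w \<ge> 0"
    and pos: "\<And>a n. (\<integral>w. G a n w \<partial>sphere_measure) > 0" and bd: "\<And>a n. (\<integral>w. G a n w \<partial>sphere_measure) \<le> C"
  shows "\<exists>s \<nu>. strict_mono (s :: nat \<Rightarrow> nat) \<and> (\<forall>a\<in>A. sphere_weak_limit (\<lambda>n. G a (s n)) (\<nu> a))"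
  using assms(1)
proof induction
  case empty
  show ?case by (intro exI[of _ id]) (auto simp: strict_mono_def)
next
  case (insert a A)
  then obtain s \<nu> where s: "strict_mono (s :: nat \<Rightarrow> nat)" "\<And>b. b \<in> A \<Longrightarrow> sphere_weak_limit (\<lambda>n. G b (s n)) (\<nu> b)" by blast
  obtain r \<nu>0 where r: "strict_mono (r :: nat \<Rightarrow> nat)" "sphere_weak_limit (\<lambda>n. G a (s (r n))) \<nu>0"
    using sphere_weak_compactness[of "\<lambda>n. G a (s n)" C] iG nn pos bd by blast
  show ?case
  proof (intro exI[of _ "s \<circ> r"] exI[of _ "\<nu>(a := \<nu>0)"] conjI ballI)
    show "strict_mono (s \<circ> r)" by (rule strict_mono_o[OF s(1) r(1)])
    fix b assume "b \<in> insert a A"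
    then show "sphere_weak_limit (\<lambda>n. G b ((s \<circ> r) n)) ((\<nu>(a := \<nu>0)) b)"
      using r(2) sphere_weak_limit_subseq[OF s(2) r(1)] insert.hyps by (cases "b = a") auto
  qed
qed

section \<open>Boundary values\<close>

text \<open>The shift by 2 keeps every radius strictly between 0 and 1, as the representation of
  dilates requires.\<close>

definition radii :: "nat \<Rightarrow> real" where
  "radii n = 1 - 1 / real (n + 2)"

lemma radii: "0 < radii n" "radii n < 1"
  by (simp_all add: radii_def)

lemma radii_tendsto: "radii \<longlonglongrightarrow> 1"
proof -
  have "(\<lambda>n. 1 / real (n + 2)) \<longlonglongrightarrow> 0" by (rule LIMSEQ_ignore_initial_segment[OF lim_1_over_n])
  then have "(\<lambda>n. 1 - 1 / real (n + 2)) \<longlonglongrightarrow> 1 - 0" by (intro tendsto_intros)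
  then show ?thesis by (simp add: radii_def[abs_def])
qed

context lame
begin

lemma elastic_harmonic_continuous: "elastic_harmonic lam mu u \<Longrightarrow> continuous_on (ball 0 1) u"
  by (auto simp: elastic_harmonic_def C2_ball_def)

lemma elastic_trace:
  assumes u: "elastic_harmonic lam mu u" and r: "0 < r" "r < 1"
  shows "continuous_on S2 (\<lambda>w. u (r *\<^sub>R w))" "integrable sphere_measure (\<lambda>w. u (r *\<^sub>R w))"
proof -
  show c: "continuous_on S2 (\<lambda>w. u (r *\<^sub>R w))"
    by (rule continuous_on_compose2[OF elastic_harmonic_continuous[OF u]])
       (use r in \<open>auto intro!: continuous_intros\<close>)
  show "integrable sphere_measure (\<lambda>w. u (r *\<^sub>R w))"
    by (rule integrable_vecI) (intro integrable_sphere_continuous continuous_on_component c)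
qed

lemma elastic_dilate_tendsto:
  assumes u: "elastic_harmonic lam mu u" and x: "norm x < 1"
  shows "(\<lambda>n. u (radii n *\<^sub>R x)) \<longlonglongrightarrow> u x"
proof -
  have "isCont u x" using elastic_harmonic_continuous[OF u] x by (simp add: continuous_on_eq_continuous_at)
  moreover have "(\<lambda>n. radii n *\<^sub>R x) \<longlonglongrightarrow> 1 *\<^sub>R x" by (intro tendsto_intros radii_tendsto)
  ultimately show ?thesis using isCont_tendsto_compose[of x u] by simp
qed

text \<open>For fixed \<open>x\<close> the kernel is continuous on the sphere, so the representation
  of the dilates passes to the weak limits of the positive and negative parts of their boundary
  values.\<close>

lemma hpe_1_imp_Pe_meas:
  assumes u: "u \<in> hpe lam mu 1"
  shows "\<exists>pos neg. vec_measure_on_sphere pos neg \<and> (\<forall>x\<in>ball 0 1. u x = Pe_meas lam mu pos neg x)"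
proof -
  have eh: "elastic_harmonic lam mu u" using u by (simp add: hpe_def)
  obtain C where C: "\<And>r. 0 \<le> r \<Longrightarrow> r < 1 \<Longrightarrow>
      (\<integral>\<^sup>+ w. ennreal (norm (u (r *\<^sub>R w)) powr 1) \<partial>sphere_measure) \<le> ennreal C"
    using u by (auto simp: hpe_def)
  define F where "F = (\<lambda>n w. u (radii n *\<^sub>R w))"
  have cF: "continuous_on S2 (F n)" and iF: "integrable sphere_measure (F n)" for n
    unfolding F_def by (rule elastic_trace[OF eh radii])+
  have bF: "(\<integral>w. norm (F n w) \<partial>sphere_measure) \<le> \<bar>C\<bar>" for n
  proof -
    have "ennreal (\<integral>w. norm (F n w) \<partial>sphere_measure) = (\<integral>\<^sup>+ w. ennreal (norm (F n w)) \<partial>sphere_measure)"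
      by (rule nn_integral_eq_integral[symmetric]) (use iF in auto)
    also have "\<dots> \<le> ennreal C" using C[of "radii n"] radii[of n] by (simp add: F_def)
    also have "\<dots> \<le> ennreal \<bar>C\<bar>" by (rule ennreal_leI) simp
    finally show ?thesis by simp
  qed
  \<comment> \<open>The added constant bounds the masses away from zero; it cancels in the difference of the two parts.\<close>
  define G where "G = (\<lambda>(i, b) n w. max 0 ((if b then 1 else - 1) * F n w $ i) + 1 :: real)"
  have cG: "continuous_on S2 (G a n)" for a n
    unfolding G_def by (auto simp: case_prod_beta' intro!: continuous_intros continuous_on_max cF)
  note iG = integrable_sphere_continuous[OF cG]
  have G1: "G a n w \<ge> 1" for a n w by (simp add: G_def case_prod_beta')
  have Gle: "G a n w \<le> norm (F n w) + 1" for a n w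
    using component_le_norm_cart[of "F n w" "fst a"] by (auto simp: G_def case_prod_beta')
  have pos: "(\<integral>w. G a n w \<partial>sphere_measure) > 0" for a n
  proof -
    have "(\<integral>w. 1 \<partial>sphere_measure) \<le> (\<integral>w. G a n w \<partial>sphere_measure)"
      by (rule integral_mono[OF integrable_sphere_const iG G1])
    then show ?thesis by (simp add: measure_sphere_measure) (smt (verit) pi_gt_zero)
  qed
  have bd: "(\<integral>w. G a n w \<partial>sphere_measure) \<le> \<bar>C\<bar> + 4 * pi" for a n
  proof -
    have "(\<integral>w. G a n w \<partial>sphere_measure) \<le> (\<integral>w. norm (F n w) + 1 \<partial>sphere_measure)"
      by (rule integral_mono[OF iG _ Gle]) (use iF integrable_sphere_const in auto)
    also have "\<dots> = (\<integral>w. norm (F n w) \<partial>sphere_measure) + 4 * pi"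
      using iF integrable_sphere_const[of 1] by (simp add: measure_sphere_measure)
    finally show ?thesis using bF[of n] by simp
  qed
  obtain s \<nu> where s: "strict_mono (s :: nat \<Rightarrow> nat)" and \<nu>: "\<And>a. sphere_weak_limit (\<lambda>n. G a (s n)) (\<nu> a)"
    using sphere_weak_compactness_finite[of "UNIV :: (3 \<times> bool) set" G "\<bar>C\<bar> + 4 * pi"] iG G1 pos bd
      order_trans[OF zero_le_one G1] by auto
  let ?pos = "\<lambda>i. \<nu> (i, True)" and ?neg = "\<lambda>i. \<nu> (i, False)"
  have "vec_measure_on_sphere ?pos ?neg"
    using \<nu> by (simp add: vec_measure_on_sphere_def sphere_weak_limit_def)
  moreover have "u x = Pe_meas lam mu ?pos ?neg x" if x: "norm x < 1" for x
  proof -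
    have "u x $ j = Pe_meas lam mu ?pos ?neg x $ j" for j
    proof -
      let ?K = "\<lambda>i \<eta>. elastic_poisson_kernel lam mu x \<eta> $ j $ i"
      have cK: "continuous_on S2 (?K i)" for i by (rule continuous_on_kernel[OF x])
      note iK = integrable_continuous_mult[OF cK compact_sphere sets_sphere_measure]
      have "(\<lambda>n. \<integral>w. ?K i w * G (i, b) (s n) w \<partial>sphere_measure) \<longlonglongrightarrow> (\<integral>w. ?K i w \<partial>\<nu> (i, b))" for i b
        using \<nu>[of "(i, b)"] cK unfolding sphere_weak_limit_def by blast
      then have "(\<lambda>n. \<Sum>i\<in>UNIV. (\<integral>w. ?K i w * G (i, True) (s n) w \<partial>sphere_measure) - (\<integral>w. ?K i w * G (i, False) (s n) w \<partial>sphere_measure))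
         \<longlonglongrightarrow> (\<Sum>i\<in>UNIV. (\<integral>w. ?K i w \<partial>?pos i) - (\<integral>w. ?K i w \<partial>?neg i))"
        by (intro tendsto_sum tendsto_diff)
      moreover have "(\<Sum>i\<in>UNIV. (\<integral>w. ?K i w * G (i, True) n w \<partial>sphere_measure) - (\<integral>w. ?K i w * G (i, False) n w \<partial>sphere_measure))
         = u (radii n *\<^sub>R x) $ j" for n
      proof -
        have "(\<integral>w. ?K i w * G (i, True) n w \<partial>sphere_measure) - (\<integral>w. ?K i w * G (i, False) n w \<partial>sphere_measure)
           = kernel_column i (poissonI sphere_measure (\<lambda>w. F n w $ i)) j x" for i
        proof -
          have "(\<integral>w. ?K i w * G (i, True) n w \<partial>sphere_measure) - (\<integral>w. ?K i w * G (i, False) n w \<partial>sphere_measure)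
            = (\<integral>w. ?K i w * G (i, True) n w - ?K i w * G (i, False) n w \<partial>sphere_measure)"
            by (rule Bochner_Integration.integral_diff[symmetric]) (rule iK[OF iG])+
          also have "\<dots> = (\<integral>w. ?K i w * F n w $ i \<partial>sphere_measure)"
            by (rule Bochner_Integration.integral_cong) (auto simp: G_def max_def algebra_simps)
          also have "\<dots> = kernel_column i (poissonI sphere_measure (\<lambda>w. F n w $ i)) j x"
            by (rule integral_kernel[OF refl finite_sphere_measure integrable_vec_nth[OF iF] x])
          finally show ?thesis .
        qed
        then show ?thesis
          using Pe_component[OF iF x, of n j] elastic_harmonic_representation[OF eh radii x, of n] by (simp add: F_def)
      qed
      ultimately have "(\<lambda>n. u (radii (s n) *\<^sub>R x) $ j) \<longlonglongrightarrow> Pe_meas lam mu ?pos ?neg x $ j"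
        by (simp add: Pe_meas_def)
      moreover have "(\<lambda>n. u (radii (s n) *\<^sub>R x) $ j) \<longlonglongrightarrow> u x $ j"
        using tendsto_vec_nth[OF LIMSEQ_subseq_LIMSEQ[OF elastic_dilate_tendsto[OF eh x] s]] by (simp add: o_def)
      ultimately show ?thesis using LIMSEQ_unique by blast
    qed
    then show ?thesis by (simp add: vec_eq_iff)
  qed
  ultimately show ?thesis by (intro exI[of _ ?pos] exI[of _ ?neg]) auto
qed

lemma integrable_kernel_mult:
  assumes f: "integrable sphere_measure f" and x: "norm x < 1"
  shows "integrable sphere_measure (\<lambda>\<eta>. elastic_poisson_kernel lam mu x \<eta> *v f \<eta>)"
  by (rule integrable_vecI)
     (simp add: matrix_vector_mult_def, intro Bochner_Integration.integrable_sum
       integrable_continuous_mult[OF continuous_on_kernel[OF x] compact_sphere sets_sphere_measure integrable_vec_nth[OF f]])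

lemma Pe_midpoint:
  assumes f: "integrable sphere_measure f" "integrable sphere_measure g" and x: "norm x < 1"
  shows "Pe lam mu (\<lambda>\<eta>. (1/2) *\<^sub>R (f \<eta> + g \<eta>)) x = (1/2) *\<^sub>R (Pe lam mu f x + Pe lam mu g x)"
proof -
  let ?K = "\<lambda>\<eta>. elastic_poisson_kernel lam mu x \<eta>"
  have "?K \<eta> *v ((1/2) *\<^sub>R (f \<eta> + g \<eta>)) = (1/2) *\<^sub>R (?K \<eta> *v f \<eta> + ?K \<eta> *v g \<eta>)" for \<eta>
    by (simp add: matrix_vector_right_distrib matrix_vector_mult_scaleR)
  then show ?thesis
    unfolding Pe_def using integrable_kernel_mult[OF f(1) x] integrable_kernel_mult[OF f(2) x] by simp
qed

text \<open>The operator is linear and balls are convex, so closeness to \<open>y\<close> is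
  inherited by midpoints.\<close>

lemma Pe_tail_mid:
  assumes "tail_mid F n g" and iF: "\<And>m. integrable sphere_measure (F m)" and x: "norm x < 1"
    and cl: "\<And>m. n \<le> m \<Longrightarrow> norm (Pe lam mu (F m) x - y) \<le> e"
  shows "integrable sphere_measure g \<and> norm (Pe lam mu g x - y) \<le> e"
  using assms(1)
proof induction
  case (tail_base m)
  then show ?case using iF cl by blast
next
  case (tail_midpoint g h)
  have m: "Pe lam mu (\<lambda>x. (1/2) *\<^sub>R (g x + h x)) x = (1/2) *\<^sub>R (Pe lam mu g x + Pe lam mu h x)"
    by (rule Pe_midpoint[OF _ _ x]) (use tail_midpoint.IH in auto)
  have "Pe lam mu (\<lambda>x. (1/2) *\<^sub>R (g x + h x)) x - y = (1/2) *\<^sub>R ((Pe lam mu g x - y) + (Pe lam mu h x - y))"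
    unfolding m by (simp add: vec_eq_iff field_simps)
  also have "norm \<dots> \<le> (1/2) * (e + e)"
    using tail_midpoint.IH norm_triangle_ineq[of "Pe lam mu g x - y" "Pe lam mu h x - y"] by simp
  finally show ?case using tail_midpoint.IH by simp
qed

text \<open>Midpoint combinations of the traces represent the same combinations of the values
  \<open>u (r x)\<close>, which still converge to \<open>u x\<close>; dominated convergence
  identifies this limit with the elastic Poisson integral of \<open>f\<close>.\<close>

lemma hpe_imp_Pe:
  assumes p: "1 < p" and u: "u \<in> hpe lam mu p"
  shows "\<exists>f. f \<in> Lp_sphere p \<and> (\<forall>x\<in>ball 0 1. u x = Pe lam mu f x)"
proof -
  have eh: "elastic_harmonic lam mu u" using u by (simp add: hpe_def)
  define F where "F = (\<lambda>n w. u (radii n *\<^sub>R w))"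
  have cF: "continuous_on S2 (F n)" and iF: "integrable sphere_measure (F n)" for n
    unfolding F_def by (rule elastic_trace[OF eh radii])+
  have mF: "F n \<in> borel_measurable sphere_measure" for n using iF by auto
  \<comment> \<open>For \<open>p = \<infinity>\<close> the exponent 2 serves to extract a limit; the
    uniform bound is carried through midpoints and limits afterwards.\<close>
  define q where "q = (if p = \<infinity> then 2 else real_of_ereal p)"
  have q: "q > 1" using p by (cases p) (auto simp: q_def)
  have iFq: "integrable sphere_measure (\<lambda>w. norm (F n w) powr q)" for n
    using q by (intro integrable_sphere_continuous continuous_on_powr' continuous_on_norm cF continuous_on_const) auto
  have "\<exists>C. \<forall>n. (\<integral>w. norm (F n w) powr q \<partial>sphere_measure) \<le> C"
  proof (cases "p = \<infinity>")
    case True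
    then have "bounded (u ` ball 0 1)" using u by (simp add: hpe_def)
    then obtain B where "\<forall>y\<in>u ` ball 0 1. norm y \<le> B" unfolding bounded_iff by blast
    then have B: "\<And>x. norm x < 1 \<Longrightarrow> norm (u x) \<le> B" by simp
    have "(\<integral>w. norm (F n w) powr q \<partial>sphere_measure) \<le> (\<integral>w. B powr q \<partial>sphere_measure)" for n
    proof (rule integral_mono[OF iFq integrable_sphere_const])
      fix w assume "w \<in> space sphere_measure"
      then have "norm (radii n *\<^sub>R w) < 1" using radii[of n] by (simp add: space_sphere_measure)
      then show "norm (F n w) powr q \<le> B powr q" using B q unfolding F_def by (intro powr_mono2) auto
    qed
    then show ?thesis by blast
  next
    case False
    then obtain C where C: "\<And>r. 0 \<le> r \<Longrightarrow> r < 1 \<Longrightarrow>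
        (\<integral>\<^sup>+ w. ennreal (norm (u (r *\<^sub>R w)) powr q) \<partial>sphere_measure) \<le> ennreal C"
      using u by (auto simp: hpe_def q_def)
    have "(\<integral>w. norm (F n w) powr q \<partial>sphere_measure) \<le> \<bar>C\<bar>" for n
    proof -
      have "ennreal (\<integral>w. norm (F n w) powr q \<partial>sphere_measure) = (\<integral>\<^sup>+ w. ennreal (norm (F n w) powr q) \<partial>sphere_measure)"
        by (rule nn_integral_eq_integral[symmetric]) (use iFq in auto)
      also have "\<dots> \<le> ennreal C" using C[of "radii n"] radii[of n] by (simp add: F_def)
      also have "\<dots> \<le> ennreal \<bar>C\<bar>" by (rule ennreal_leI) simp
      finally show ?thesis by simp
    qed
    then show ?thesis by blast
  qed
  then obtain C where C: "\<And>n. (\<integral>w. norm (F n w) powr q \<partial>sphere_measure) \<le> C" by blast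
  obtain g f and h :: "R3 \<Rightarrow> real" where g: "\<And>k. tail_mid F k (g k)" and f: "f \<in> borel_measurable sphere_measure"
    and h: "integrable sphere_measure h" and lim: "AE x in sphere_measure. (\<lambda>k. g k x) \<longlonglongrightarrow> f x"
    and dom: "\<And>k. AE x in sphere_measure. norm (g k x) \<le> h x"
    and fq: "(\<integral>\<^sup>+ x. ennreal (norm (f x) powr q) \<partial>sphere_measure) < \<infinity>"
    using midpoint_tail_limit[of sphere_measure q F C, OF finite_sphere_measure q mF iFq C] by blast
  have fLp: "f \<in> Lp_sphere p"
  proof (cases "p = \<infinity>")
    case False then show ?thesis using f fq by (simp add: Lp_sphere_def q_def)
  next
    case True
    then have "bounded (u ` ball 0 1)" using u by (simp add: hpe_def)
    then obtain B where "\<forall>y\<in>u ` ball 0 1. norm y \<le> B" unfolding bounded_iff by blast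
    then have B: "\<And>x. norm x < 1 \<Longrightarrow> norm (u x) \<le> B" by simp
    have FB: "norm (F n w) \<le> B" if "w \<in> S2" for n w
      unfolding F_def by (rule B) (use that radii[of n] in simp)
    have tB: "norm (g' w) \<le> B" if "tail_mid F k g'" "w \<in> S2" for k g' w
      using that(1)
    proof induction
      case (tail_base m) then show ?case using FB[OF that(2)] by simp
    next
      case (tail_midpoint a b)
      then show ?case using norm_triangle_ineq[of "a w" "b w"] by simp
    qed
    have "AE w in sphere_measure. norm (f w) \<le> B"
      using lim AE_space
    proof eventually_elim
      case (elim w)
      then have "w \<in> S2" by (simp add: space_sphere_measure)
      then show ?case using tB[OF g] by (intro LIMSEQ_le_const2[OF tendsto_norm[OF elim(1)]]) blast
    qed
    then show ?thesis using f True by (auto simp: Lp_sphere_def)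
  qed
  note fi = Lp_integrable(1)[OF fLp p]
  have "u x = Pe lam mu f x" if x: "norm x < 1" for x
  proof -
    have PF: "Pe lam mu (F n) x = u (radii n *\<^sub>R x)" for n
      unfolding F_def by (rule elastic_harmonic_representation[OF eh radii x, symmetric])
    \<comment> \<open>Integrability is read off from \<open>Pe_tail_mid\<close>, for which the
      convergent sequence of values at \<open>x\<close> supplies a bound.\<close>
    have gi: "integrable sphere_measure (g k)" for k
    proof -
      have "bounded (range (\<lambda>n. Pe lam mu (F n) x))"
        unfolding PF by (rule convergent_imp_bounded[OF elastic_dilate_tendsto[OF eh x]])
      then obtain b where "\<And>n. norm (Pe lam mu (F n) x - 0) \<le> b" by (auto simp: bounded_iff)
      then show ?thesis using Pe_tail_mid[OF g iF x, of k 0 b] by blast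
    qed
    have 1: "(\<lambda>k. Pe lam mu (g k) x) \<longlonglongrightarrow> u x"
    proof (rule LIMSEQ_I)
      fix e :: real assume e: "e > 0"
      obtain N where N: "\<And>n. n \<ge> N \<Longrightarrow> norm (u (radii n *\<^sub>R x) - u x) < e / 2"
        using LIMSEQ_D[OF elastic_dilate_tendsto[OF eh x], of "e / 2"] e by auto
      show "\<exists>N. \<forall>n\<ge>N. norm (Pe lam mu (g n) x - u x) < e"
      proof (intro exI[of _ N] allI impI)
        fix n assume n: "n \<ge> N"
        have "norm (Pe lam mu (g n) x - u x) \<le> e / 2"
          by (rule Pe_tail_mid[OF g iF x, THEN conjunct2]) (use N n in \<open>auto simp: PF less_imp_le\<close>)
        then show "norm (Pe lam mu (g n) x - u x) < e" using e by simp
      qed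
    qed
    have 2: "(\<lambda>k. Pe lam mu (g k) x $ j) \<longlonglongrightarrow> Pe lam mu f x $ j" for j
    proof -
      let ?K = "\<lambda>i \<eta>. elastic_poisson_kernel lam mu x \<eta> $ j $ i"
      have mK: "?K i \<in> borel_measurable sphere_measure" for i
        by (rule measurable_continuous_sphere[OF continuous_on_kernel[OF x]])
      have c: "(\<lambda>k. \<integral>\<eta>. ?K i \<eta> * g k \<eta> $ i \<partial>sphere_measure) \<longlonglongrightarrow> (\<integral>\<eta>. ?K i \<eta> * f \<eta> $ i \<partial>sphere_measure)" for i
      proof (rule integral_dominated_convergence[where w="\<lambda>\<eta>. \<bar>?K i \<eta> * h \<eta>\<bar>"])
        show "integrable sphere_measure (\<lambda>\<eta>. \<bar>?K i \<eta> * h \<eta>\<bar>)"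
          by (intro integrable_abs integrable_continuous_mult[OF continuous_on_kernel[OF x] compact_sphere sets_sphere_measure h])
        show "(\<lambda>\<eta>. ?K i \<eta> * f \<eta> $ i) \<in> borel_measurable sphere_measure"
          by (intro borel_measurable_times mK borel_measurable_integrable integrable_vec_nth fi)
        show "(\<lambda>\<eta>. ?K i \<eta> * g k \<eta> $ i) \<in> borel_measurable sphere_measure" for k
          by (intro borel_measurable_times mK borel_measurable_integrable integrable_vec_nth gi)
        show "AE \<eta> in sphere_measure. (\<lambda>k. ?K i \<eta> * g k \<eta> $ i) \<longlonglongrightarrow> ?K i \<eta> * f \<eta> $ i"
          using lim by eventually_elim (intro tendsto_intros)
        show "AE \<eta> in sphere_measure. norm (?K i \<eta> * g k \<eta> $ i) \<le> \<bar>?K i \<eta> * h \<eta>\<bar>" for k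
          using dom[of k]
        proof eventually_elim
          case (elim \<eta>)
          have "\<bar>g k \<eta> $ i\<bar> \<le> \<bar>h \<eta>\<bar>" using component_le_norm_cart[of "g k \<eta>" i] elim by linarith
          then show ?case by (simp add: abs_mult mult_left_mono)
        qed
      qed
      have e: "Pe lam mu f' x $ j = (\<Sum>i\<in>UNIV. \<integral>\<eta>. ?K i \<eta> * f' \<eta> $ i \<partial>sphere_measure)"
        if "integrable sphere_measure f'" for f'
        unfolding Pe_component[OF that x] by (simp add: integral_kernel[OF refl finite_sphere_measure integrable_vec_nth[OF that] x])
      show ?thesis unfolding e[OF gi] e[OF fi] by (intro tendsto_sum c)
    qed
    have "u x $ j = Pe lam mu f x $ j" for j
      using LIMSEQ_unique[OF tendsto_vec_nth[OF 1] 2] .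
    then show ?thesis by (simp add: vec_eq_iff)
  qed
  then show ?thesis using fLp by (intro exI[of _ f]) auto
qed

end

theorem mainTheorem4:
  fixes lam mu :: real
  assumes "mu > 0" and "2 * mu + lam > 0"
  shows "(\<forall>p::ereal. 1 < p \<longrightarrow>
            (\<forall>u. u \<in> hpe lam mu p \<longleftrightarrow>
                 (\<exists>f. f \<in> Lp_sphere p \<and> (\<forall>x\<in>ball 0 1. u x = Pe lam mu f x))))
       \<and> (\<forall>u. u \<in> hpe lam mu 1 \<longleftrightarrow>
                 (\<exists>pos neg. vec_measure_on_sphere pos neg \<and>
                     (\<forall>x\<in>ball 0 1. u x = Pe_meas lam mu pos neg x)))"
proof -
  interpret lame lam mu by standard (rule assms)+
  show ?thesis
  proof (intro conjI allI impI iffI)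
    fix p :: ereal and u assume "1 < p" "u \<in> hpe lam mu p"
    then show "\<exists>f. f \<in> Lp_sphere p \<and> (\<forall>x\<in>ball 0 1. u x = Pe lam mu f x)" by (rule hpe_imp_Pe)
  next
    fix p :: ereal and u assume "1 < p" "\<exists>f. f \<in> Lp_sphere p \<and> (\<forall>x\<in>ball 0 1. u x = Pe lam mu f x)"
    then show "u \<in> hpe lam mu p" by (auto intro: Pe_in_hpe)
  next
    fix u assume "u \<in> hpe lam mu 1"
    then show "\<exists>pos neg. vec_measure_on_sphere pos neg \<and> (\<forall>x\<in>ball 0 1. u x = Pe_meas lam mu pos neg x)"
      by (rule hpe_1_imp_Pe_meas)
  next
    fix u assume "\<exists>pos neg. vec_measure_on_sphere pos neg \<and> (\<forall>x\<in>ball 0 1. u x = Pe_meas lam mu pos neg x)"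
    then show "u \<in> hpe lam mu 1" by (auto intro: Pe_meas_in_hpe)
  qed
qed

end
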